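(* Use the setting and notation of the context. Let $(\theta_k,\psi_k)_{k\ge 0}$ be produced by the algorithm $$\begin{pmatrix}\theta_{k+1}\\ \psi_{k+1}\end{pmatrix}=\begin{pmatrix}\theta_k\\ \psi_k\end{pmatrix}-\eta_k\,G(\theta_k,\psi_k)^\dagger\begin{pmatrix}\nabla_\theta L(\theta_k,\psi_k)\\ \nabla_\psi L(\theta_k,\psi_k)\end{pmatrix},\qquad \eta_k>0,$$ with $G=G^{\mathrm{GN}}$ the Gauss-Newton matrix, producing the sequences of neural networks $(u_{\theta_k})$ and $(p_{\psi_k})$. Let $$\begin{pmatrix}d_{\theta_k}\\ d_{\psi_k}\end{pmatrix}=[DR(u_{\theta_k},p_{\psi_k})^*DR(u_{\theta_k},p_{\psi_k})]^{-1}DE(u_{\theta_k},p_{\psi_k})\in\mathcal H$$ be the function-space Gauss-Newton direction at $(u_{\theta_k},p_{\psi_k})$. Then $$\begin{pmatrix}u_{\theta_{k+1}}\\ p_{\psi_{k+1}}\end{pmatrix}=\begin{pmatrix}u_{\theta_k}\\ p_{\psi_k}\end{pmatrix}-\eta_k\,\Pi_k\begin{pmatrix}d_{\theta_k}\\ d_{\psi_k}\end{pmatrix}+\epsilon_k,$$ where $\Pi_k$ denotes the orthogonal projection onto the tangent space $T_{u_{\theta_k},p_{\psi_k}}\mathcal M$ with respect to the inner product $g(u_{\theta_k},p_{\psi_k})$. The term $\epsilon_k$ is an error vanishing quadratically in the step and step size length: $$\epsilon_k=\mathcal O\big(\eta_k^2\,\|G(\theta_k,\psi_k)^\dagger\nabla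 L(\theta_k,\psi_k)\|^2\big).$$
   Context: **PDE setting.** Let $\Omega\subset\mathbb R^d$, $d\in\{2,3\}$, be bounded, open and connected, $I=[0,T]$, $\Omega_T=I\times\Omega$, $\nu>0$. Let $f$ (forcing), $b$ (Dirichlet boundary data on $I\times\partial\Omega$) and $u_0$ (initial data) be given. Put $$\mathcal H=\big(H^1(I,L^2(\Omega))\cap L^2(I,H^2(\Omega))\big)\times L^2(I,H^1(\Omega)),$$ $$\mathcal Q=L^2(\Omega_T)\times L^2(\Omega_T)\times L^2(I\times\partial\Omega)\times L^2(\Omega),$$ where velocities $u$ are $\mathbb R^d$-valued and pressures $p$ are scalar. The residual $R:\mathcal H\to\mathcal Q$ of the incompressible Navier-Stokes equations is $$R(u,p)=\big(\partial_tu-\nu\Delta u+(u\cdot\nabla)u+\nabla p-f,\ \operatorname{div}u,\ u|_{I\times\partial\Omega}-b,\ u(0)-u_0\big),$$ and $E(w)=\frac12\|R(w)\|_{\mathcal Q}^2$ for $w=(u,p)\in\mathcal H$. Fréchet derivatives are denoted by $D$, so $DR(w)\in\mathcal L(\mathcal H,\mathcal Q)$ and $DE(w)\in\mathcal H^*$. The operator $DR(w)^*DR(w):\mathcal H\to\mathcal H^*$ is defined by $$\langle DR(w)^*DR(w)\delta,\bar\delta\rangle=(DR(w)\delta,DR(w)\bar\delta)_{\mathcal Q},\qquad \delta,\bar\delta\in\mathcal H.$$ Standing assumptions: sufficient smoothness, and existence of the inverse of $DR(w)^*DR(w)$ wherever it is used. **Riemannian metric.** For $w\in\mathcal H$ and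 $\delta,\bar\delta\in\mathcal H$ put $$g(w)(\delta,\bar\delta)=(DR(w)\delta,DR(w)\bar\delta)_{\mathcal Q}.$$ **Ansatz.** Let $u_\theta$, $p_\psi$ be neural networks for velocity and pressure with parameters $\theta\in\Theta=\mathbb R^{p_\Theta}$, $\psi\in\Psi=\mathbb R^{p_\Psi}$. Put $\mathcal M=\{(u_\theta,p_\psi):\theta\in\Theta,\psi\in\Psi\}$ and $$T_{u_\theta,p_\psi}\mathcal M=\operatorname{span}\{(\partial_{\theta_i}u_\theta,0),(0,\partial_{\psi_j}p_\psi):1\le i\le p_\Theta,\ 1\le j\le p_\Psi\}.$$ The loss is $L(\theta,\psi)=E(u_\theta,p_\psi)$ and $\nabla L=(\nabla_\theta L,\nabla_\psi L)$. **Gauss-Newton matrix.** Set $$G^{\mathrm{GN}}(\theta,\psi)=\begin{pmatrix}A&B\\ B^T&C\end{pmatrix},$$ where, writing $g=g(u_\theta,p_\psi)$, $$A_{ij}=g\big((\partial_{\theta_i}u_\theta,0),(\partial_{\theta_j}u_\theta,0)\big),\quad B_{ij}=g\big((\partial_{\theta_i}u_\theta,0),(0,\partial_{\psi_j}p_\psi)\big),\quad C_{ij}=g\big((0,\partial_{\psi_i}p_\psi),(0,\partial_{\psi_j}p_\psi)\big).$$ That is, $G^{\mathrm{GN}}$ is the Galerkin discretization of $DR(u_\theta,p_\psi)^*DR(u_\theta,p_\psi)$ in the tangent space. $G^\dagger$ denotes the pseudoinverse. *)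

theory Defs
  imports "HOL-Analysis.Analysis" "HOL-Library.Function_Algebras"
begin

section \<open>Functions as a real vector space; calculus on seminormed function spaces\<close>

instantiation "fun" :: (type, real_vector) real_vector
begin

definition scaleR_fun :: "real \<Rightarrow> ('a \<Rightarrow> 'b) \<Rightarrow> 'a \<Rightarrow> 'b"
  where "scaleR_fun c f = (\<lambda>x. c *\<^sub>R f x)"

instance
  by standard (auto simp: scaleR_fun_def fun_eq_iff algebra_simps)

end

text \<open>
  Lebesgue and Sobolev spaces are represented by sets of functions (not classes modulo null
  sets) with their seminorms, as pairs (carrier, seminorm). Accordingly, a linear map
  between two such spaces is linear up to elements of seminorm zero of the target.
\<close>

type_synonym 'a snspace = "'a set \<times> ('a \<Rightarrow> real)"

definition bounded_linear_into ::
    "'a::real_vector snspace \<Rightarrow> 'b::real_vector snspace \<Rightarrow> ('a \<Rightarrow> 'b) \<Rightarrow> bool" where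
  "bounded_linear_into X Y A \<longleftrightarrow>
     (\<forall>x\<in>fst X. A x \<in> fst Y) \<and>
     (\<forall>x\<in>fst X. \<forall>y\<in>fst X. \<forall>a b. snd Y (A (a *\<^sub>R x + b *\<^sub>R y) - (a *\<^sub>R A x + b *\<^sub>R A y)) = 0) \<and>
     (\<exists>C. \<forall>x\<in>fst X. snd Y (A x) \<le> C * snd X x)"

definition has_frechet_deriv ::
    "'a::real_vector snspace \<Rightarrow> 'b::real_vector snspace \<Rightarrow> ('a \<Rightarrow> 'b) \<Rightarrow> ('a \<Rightarrow> 'b) \<Rightarrow> 'a \<Rightarrow> bool" where
  "has_frechet_deriv X Y F A w \<longleftrightarrow>
     bounded_linear_into X Y A \<and>
     (\<forall>e>0. \<exists>r>0. \<forall>h\<in>fst X. snd X h < r \<longrightarrow> snd Y (F (w + h) - F w - A h) \<le> e * snd X h)"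

text \<open>Like \<^const>\<open>frechet_derivative\<close>; determined up to seminorm zero where it exists.\<close>

definition frechet_deriv ::
    "'a::real_vector snspace \<Rightarrow> 'b::real_vector snspace \<Rightarrow> ('a \<Rightarrow> 'b) \<Rightarrow> 'a \<Rightarrow> 'a \<Rightarrow> 'b" where
  "frechet_deriv X Y F w = (SOME A. has_frechet_deriv X Y F A w)"

definition normed_UNIV :: "'a::real_normed_vector snspace" where
  "normed_UNIV = (UNIV, norm)"

primrec Ck_into :: "nat \<Rightarrow> 'b::real_vector snspace \<Rightarrow> ('a::real_normed_vector \<Rightarrow> 'b) \<Rightarrow> bool" where
  "Ck_into 0 Y F \<longleftrightarrow>
     (\<forall>x. F x \<in> fst Y) \<and> (\<forall>x. ((\<lambda>x'. snd Y (F x' - F x)) \<longlongrightarrow> 0) (at x))"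
| "Ck_into (Suc k) Y F \<longleftrightarrow>
     (\<forall>x. F x \<in> fst Y) \<and>
     (\<exists>F'. (\<forall>x. has_frechet_deriv normed_UNIV Y F (F' x) x) \<and>
           (\<forall>v. Ck_into k Y (\<lambda>x. F' x v)))"

section \<open>Lebesgue spaces, weak derivatives, surface measure, traces\<close>

definition L2 :: "'a measure \<Rightarrow> ('a \<Rightarrow> 'b::euclidean_space) set" where
  "L2 M = {f \<in> borel_measurable M. integrable M (\<lambda>x. (norm (f x))\<^sup>2)}"

definition L2_inner :: "'a measure \<Rightarrow> ('a \<Rightarrow> 'b::euclidean_space) \<Rightarrow> ('a \<Rightarrow> 'b) \<Rightarrow> real" where
  "L2_inner M f g = (\<integral>x. f x \<bullet> g x \<partial>M)"

definition L2_norm :: "'a measure \<Rightarrow> ('a \<Rightarrow> 'b::euclidean_space) \<Rightarrow> real" where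
  "L2_norm M f = sqrt (L2_inner M f f)"

definition L2_lim :: "'a measure \<Rightarrow> (nat \<Rightarrow> 'a \<Rightarrow> 'b::euclidean_space) \<Rightarrow> ('a \<Rightarrow> 'b) \<Rightarrow> bool" where
  "L2_lim M F f \<longleftrightarrow>
     (\<forall>m. F m \<in> L2 M) \<and> f \<in> L2 M \<and> (\<lambda>m. L2_norm M (F m - f)) \<longlonglongrightarrow> 0"

definition C1 :: "('a::euclidean_space \<Rightarrow> 'b::real_normed_vector) \<Rightarrow> bool" where
  "C1 \<phi> \<longleftrightarrow> (\<exists>\<phi>'. (\<forall>x. (\<phi> has_derivative \<phi>' x) (at x)) \<and> (\<forall>v. continuous_on UNIV (\<lambda>x. \<phi>' x v)))"

definition C1c :: "'a::euclidean_space set \<Rightarrow> ('a \<Rightarrow> real) set" where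
  "C1c S = {\<phi>. C1 \<phi> \<and> compact (closure {x. \<phi> x \<noteq> 0}) \<and> closure {x. \<phi> x \<noteq> 0} \<subseteq> S}"

text \<open>\<open>g\<close> is the weak derivative of \<open>f\<close> on the open set \<open>S\<close> in direction \<open>e\<close>.\<close>

definition has_weak_deriv ::
    "'a::euclidean_space set \<Rightarrow> 'a \<Rightarrow> ('a \<Rightarrow> 'b::euclidean_space) \<Rightarrow> ('a \<Rightarrow> 'b) \<Rightarrow> bool" where
  "has_weak_deriv S e f g \<longleftrightarrow>
     (\<forall>\<phi>\<in>C1c S. (\<integral>x. frechet_derivative \<phi> (at x) e *\<^sub>R f x \<partial>lebesgue_on S) =
                 - (\<integral>x. \<phi> x *\<^sub>R g x \<partial>lebesgue_on S))"

text \<open>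
  Hausdorff measure of dimension \<open>s \<ge> 1\<close>, normalised so that it is the usual
  \<open>s\<close>-dimensional area on smooth \<open>s\<close>-dimensional surfaces. The outer measure is metric, hence
  countably additive on Borel sets by Caratheodory's criterion.
\<close>

definition hausdorff_pre :: "nat \<Rightarrow> real \<Rightarrow> 'a::metric_space set \<Rightarrow> ennreal" where
  "hausdorff_pre s \<delta> A =
     (INF U \<in> {U :: nat \<Rightarrow> 'a set. A \<subseteq> (\<Union>i. U i) \<and> (\<forall>i. bounded (U i) \<and> diameter (U i) \<le> \<delta>)}.
        \<Sum>i. ennreal (unit_ball_vol (real s) * (diameter (U i) / 2) ^ s))"

definition hausdorff_outer :: "nat \<Rightarrow> 'a::metric_space set \<Rightarrow> ennreal" where
  "hausdorff_outer s A = (SUP \<delta>\<in>{0<..}. hausdorff_pre s \<delta> A)"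

definition hausdorff_measure :: "nat \<Rightarrow> 'a::metric_space measure" where
  "hausdorff_measure s = measure_of UNIV (sets borel) (hausdorff_outer s)"

definition surface :: "(real^'n) set \<Rightarrow> (real^'n) measure" where
  "surface \<Omega> = restrict_space (hausdorff_measure (CARD('n) - 1)) (frontier \<Omega>)"

text \<open>
  \<open>g\<close> is the trace on the boundary of the \<open>H\<^sup>1\<close> function \<open>f\<close>: the trace operator is the
  continuous extension of the restriction map from functions that are smooth up to the boundary.
\<close>

definition has_trace ::
    "(real^'n) set \<Rightarrow> (real^'n \<Rightarrow> 'b::euclidean_space) \<Rightarrow> (real^'n \<Rightarrow> 'b) \<Rightarrow> bool" where
  "has_trace \<Omega> f g \<longleftrightarrow>
     (\<exists>\<phi>. (\<forall>m. C1 (\<phi> m)) \<and>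
          L2_lim (lebesgue_on \<Omega>) \<phi> f \<and>
          (\<forall>k. \<exists>h. has_weak_deriv \<Omega> (axis k 1) f h \<and>
             L2_lim (lebesgue_on \<Omega>) (\<lambda>m x. frechet_derivative (\<phi> m) (at x) (axis k 1)) h) \<and>
          L2_lim (surface \<Omega>) \<phi> g)"

section \<open>The Navier-Stokes residual\<close>

text \<open>Space-time functions are defined on points \<open>(t, x)\<close>.\<close>

type_synonym 'n velocity = "real \<times> (real^'n) \<Rightarrow> real^'n"
type_synonym 'n pressure = "real \<times> (real^'n) \<Rightarrow> real"
type_synonym 'n state = "'n velocity \<times> 'n pressure"
type_synonym 'n resid =
  "(real \<times> (real^'n) \<Rightarrow> real^'n) \<times> (real \<times> (real^'n) \<Rightarrow> real) \<times>
   (real \<times> (real^'n) \<Rightarrow> real^'n) \<times> (real^'n \<Rightarrow> real^'n)"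

record 'n ns_data =
  horizon :: real
  domain :: "(real^'n) set"
  viscosity :: real
  forcing :: "real \<times> (real^'n) \<Rightarrow> real^'n"
  bdry_data :: "real \<times> (real^'n) \<Rightarrow> real^'n"
  init_data :: "real^'n \<Rightarrow> real^'n"

definition interval :: "('n::finite) ns_data \<Rightarrow> real measure" where
  "interval P = lebesgue_on {0..horizon P}"

definition space_dom :: "('n::finite) ns_data \<Rightarrow> (real^'n) measure" where
  "space_dom P = lebesgue_on (domain P)"

definition cylinder :: "('n::finite) ns_data \<Rightarrow> (real \<times> (real^'n)) measure" where
  "cylinder P = lebesgue_on ({0..horizon P} \<times> domain P)"

definition lateral :: "('n::finite) ns_data \<Rightarrow> (real \<times> (real^'n)) measure" where
  "lateral P = interval P \<Otimes>\<^sub>M surface (domain P)"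

definition ns_setting :: "('n::finite) ns_data \<Rightarrow> bool" where
  "ns_setting P \<longleftrightarrow>
     CARD('n) \<in> {2, 3} \<and> horizon P > 0 \<and> viscosity P > 0 \<and>
     bounded (domain P) \<and> open (domain P) \<and> connected (domain P) \<and> domain P \<noteq> {} \<and>
     forcing P \<in> L2 (cylinder P) \<and> bdry_data P \<in> L2 (lateral P) \<and> init_data P \<in> L2 (space_dom P)"

text \<open>
  Weak derivative in time of \<open>u\<close> as an \<open>L\<^sup>2(\<Omega>)\<close>-valued function on \<open>(0,T)\<close>: both sides are
  Bochner integrals in \<open>L\<^sup>2(\<Omega>)\<close>, evaluated at almost every \<open>x\<close>.
\<close>

definition has_time_deriv ::
    "('n::finite) ns_data \<Rightarrow> (real \<times> (real^'n) \<Rightarrow> 'b::euclidean_space) \<Rightarrow> (real \<times> (real^'n) \<Rightarrow> 'b) \<Rightarrow> bool" where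
  "has_time_deriv P u v \<longleftrightarrow> v \<in> L2 (cylinder P) \<and>
     (\<forall>\<phi>\<in>C1c {0<..<horizon P}. AE x in space_dom P.
        (\<integral>t. frechet_derivative \<phi> (at t) 1 *\<^sub>R u (t, x) \<partial>interval P) =
        - (\<integral>t. \<phi> t *\<^sub>R v (t, x) \<partial>interval P))"

definition has_space_deriv ::
    "('n::finite) ns_data \<Rightarrow> 'n \<Rightarrow> (real \<times> (real^'n) \<Rightarrow> 'b::euclidean_space) \<Rightarrow> (real \<times> (real^'n) \<Rightarrow> 'b) \<Rightarrow> bool" where
  "has_space_deriv P k u v \<longleftrightarrow> v \<in> L2 (cylinder P) \<and>
     (AE t in interval P. has_weak_deriv (domain P) (axis k 1) (\<lambda>x. u (t, x)) (\<lambda>x. v (t, x)))"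

definition dt :: "('n::finite) ns_data \<Rightarrow> (real \<times> (real^'n) \<Rightarrow> 'b::euclidean_space) \<Rightarrow> real \<times> (real^'n) \<Rightarrow> 'b" where
  "dt P u = (SOME v. has_time_deriv P u v)"

definition dx :: "('n::finite) ns_data \<Rightarrow> 'n \<Rightarrow> (real \<times> (real^'n) \<Rightarrow> 'b::euclidean_space) \<Rightarrow> real \<times> (real^'n) \<Rightarrow> 'b" where
  "dx P k u = (SOME v. has_space_deriv P k u v)"

text \<open>The Bochner spaces \<open>H\<^sup>1(I, L\<^sup>2(\<Omega>))\<close>, \<open>L\<^sup>2(I, H\<^sup>1(\<Omega>))\<close>, \<open>L\<^sup>2(I, H\<^sup>2(\<Omega>))\<close>.\<close>

definition H1_L2 :: "('n::finite) ns_data \<Rightarrow> (real \<times> (real^'n) \<Rightarrow> 'b::euclidean_space) set" where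
  "H1_L2 P = {u \<in> L2 (cylinder P). \<exists>v. has_time_deriv P u v}"

definition L2_H1 :: "('n::finite) ns_data \<Rightarrow> (real \<times> (real^'n) \<Rightarrow> 'b::euclidean_space) set" where
  "L2_H1 P = {u \<in> L2 (cylinder P). \<forall>k. \<exists>v. has_space_deriv P k u v}"

definition L2_H2 :: "('n::finite) ns_data \<Rightarrow> (real \<times> (real^'n) \<Rightarrow> 'b::euclidean_space) set" where
  "L2_H2 P = {u \<in> L2_H1 P. \<forall>k. \<exists>v\<in>L2_H1 P. has_space_deriv P k u v}"

definition velocity_norm :: "('n::finite) ns_data \<Rightarrow> 'n velocity \<Rightarrow> real" where
  "velocity_norm P u = sqrt (
     ((L2_norm (cylinder P) u)\<^sup>2 + (L2_norm (cylinder P) (dt P u))\<^sup>2) +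
     ((L2_norm (cylinder P) u)\<^sup>2 + (\<Sum>k\<in>UNIV. (L2_norm (cylinder P) (dx P k u))\<^sup>2) +
      (\<Sum>k\<in>UNIV. \<Sum>l\<in>UNIV. (L2_norm (cylinder P) (dx P l (dx P k u)))\<^sup>2)))"

definition pressure_norm :: "('n::finite) ns_data \<Rightarrow> 'n pressure \<Rightarrow> real" where
  "pressure_norm P p = sqrt (
     (L2_norm (cylinder P) p)\<^sup>2 + (\<Sum>k\<in>UNIV. (L2_norm (cylinder P) (dx P k p))\<^sup>2))"

definition velocity_space :: "('n::finite) ns_data \<Rightarrow> 'n velocity snspace" where
  "velocity_space P = (H1_L2 P \<inter> L2_H2 P, velocity_norm P)"

definition pressure_space :: "('n::finite) ns_data \<Rightarrow> 'n pressure snspace" where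
  "pressure_space P = (L2_H1 P, pressure_norm P)"

definition H_carrier :: "('n::finite) ns_data \<Rightarrow> 'n state set" where
  "H_carrier P = fst (velocity_space P) \<times> fst (pressure_space P)"

definition H_norm :: "('n::finite) ns_data \<Rightarrow> 'n state \<Rightarrow> real" where
  "H_norm P w = sqrt ((velocity_norm P (fst w))\<^sup>2 + (pressure_norm P (snd w))\<^sup>2)"

definition H_space :: "('n::finite) ns_data \<Rightarrow> 'n state snspace" where
  "H_space P = (H_carrier P, H_norm P)"

definition Q_carrier :: "('n::finite) ns_data \<Rightarrow> 'n resid set" where
  "Q_carrier P = L2 (cylinder P) \<times> L2 (cylinder P) \<times> L2 (lateral P) \<times> L2 (space_dom P)"

definition Q_inner :: "('n::finite) ns_data \<Rightarrow> 'n resid \<Rightarrow> 'n resid \<Rightarrow> real" where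
  "Q_inner P r s = (case (r, s) of ((r1, r2, r3, r4), (s1, s2, s3, s4)) \<Rightarrow>
     L2_inner (cylinder P) r1 s1 + L2_inner (cylinder P) r2 s2 +
     L2_inner (lateral P) r3 s3 + L2_inner (space_dom P) r4 s4)"

definition Q_norm :: "('n::finite) ns_data \<Rightarrow> 'n resid \<Rightarrow> real" where
  "Q_norm P r = sqrt (Q_inner P r r)"

definition Q_space :: "('n::finite) ns_data \<Rightarrow> 'n resid snspace" where
  "Q_space P = (Q_carrier P, Q_norm P)"

definition has_lateral_trace :: "('n::finite) ns_data \<Rightarrow> 'n velocity \<Rightarrow> (real \<times> (real^'n) \<Rightarrow> real^'n) \<Rightarrow> bool" where
  "has_lateral_trace P u g \<longleftrightarrow> g \<in> L2 (lateral P) \<and>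
     (AE t in interval P. has_trace (domain P) (\<lambda>x. u (t, x)) (\<lambda>x. g (t, x)))"

definition lateral_trace :: "('n::finite) ns_data \<Rightarrow> 'n velocity \<Rightarrow> real \<times> (real^'n) \<Rightarrow> real^'n" where
  "lateral_trace P u = (SOME g. has_lateral_trace P u g)"

text \<open>\<open>u(0)\<close> is the value at 0 of the representative of \<open>u\<close> that is continuous into \<open>L\<^sup>2(\<Omega>)\<close>.\<close>

definition has_initial_value :: "('n::finite) ns_data \<Rightarrow> 'n velocity \<Rightarrow> (real^'n \<Rightarrow> real^'n) \<Rightarrow> bool" where
  "has_initial_value P u h \<longleftrightarrow>
     (\<exists>U :: real \<Rightarrow> real^'n \<Rightarrow> real^'n.
        (\<forall>t\<in>{0..horizon P}. U t \<in> L2 (space_dom P)) \<and>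
        (\<forall>t\<in>{0..horizon P}. ((\<lambda>s. L2_norm (space_dom P) (U s - U t)) \<longlongrightarrow> 0) (at t within {0..horizon P})) \<and>
        (AE t in interval P. AE x in space_dom P. U t x = u (t, x)) \<and>
        U 0 = h)"

definition initial_value :: "('n::finite) ns_data \<Rightarrow> 'n velocity \<Rightarrow> real^'n \<Rightarrow> real^'n" where
  "initial_value P u = (SOME h. has_initial_value P u h)"

definition residual :: "('n::finite) ns_data \<Rightarrow> 'n state \<Rightarrow> 'n resid" where
  "residual P w = (case w of (u, p) \<Rightarrow>
     (\<lambda>z. dt P u z - viscosity P *\<^sub>R (\<Sum>k\<in>UNIV. dx P k (dx P k u) z)
          + (\<Sum>k\<in>UNIV. (u z $ k) *\<^sub>R dx P k u z) + (\<chi> k. dx P k p z) - forcing P z,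
      \<lambda>z. \<Sum>k\<in>UNIV. dx P k u z $ k,
      lateral_trace P u - bdry_data P,
      initial_value P u - init_data P))"

text \<open>
  The smoothness of \<open>\<Omega>\<close> required for \<open>residual\<close> to be a well-defined, Frechet differentiable
  map between the two spaces (it holds, for instance, if the boundary is smooth).
\<close>

definition residual_smooth :: "('n::finite) ns_data \<Rightarrow> bool" where
  "residual_smooth P \<longleftrightarrow>
     (\<forall>u\<in>fst (velocity_space P). (\<exists>g. has_lateral_trace P u g) \<and>
        (\<forall>g g'. has_lateral_trace P u g \<and> has_lateral_trace P u g' \<longrightarrow> (AE z in lateral P. g z = g' z))) \<and>
     (\<forall>w\<in>H_carrier P. residual P w \<in> Q_carrier P) \<and>
     (\<forall>w\<in>H_carrier P. \<exists>A. has_frechet_deriv (H_space P) (Q_space P) (residual P) A w)"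

definition energy :: "('n::finite) ns_data \<Rightarrow> 'n state \<Rightarrow> real" where
  "energy P w = 1/2 * (Q_norm P (residual P w))\<^sup>2"

definition DR :: "('n::finite) ns_data \<Rightarrow> 'n state \<Rightarrow> 'n state \<Rightarrow> 'n resid" where
  "DR P w = frechet_deriv (H_space P) (Q_space P) (residual P) w"

definition DE :: "('n::finite) ns_data \<Rightarrow> 'n state \<Rightarrow> 'n state \<Rightarrow> real" where
  "DE P w = frechet_deriv (H_space P) normed_UNIV (energy P) w"

definition metric :: "('n::finite) ns_data \<Rightarrow> 'n state \<Rightarrow> 'n state \<Rightarrow> 'n state \<Rightarrow> real" where
  "metric P w \<delta> \<delta>' = Q_inner P (DR P w \<delta>) (DR P w \<delta>')"

text \<open>The operator \<open>DR(w)\<^sup>* DR(w)\<close> from the state space to its dual.\<close>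

definition gn_operator :: "('n::finite) ns_data \<Rightarrow> 'n state \<Rightarrow> 'n state \<Rightarrow> 'n state \<Rightarrow> real" where
  "gn_operator P w \<delta> = (\<lambda>\<delta>'. Q_inner P (DR P w \<delta>) (DR P w \<delta>'))"

text \<open>\<open>d\<close> is the preimage of \<open>DE(w)\<close> under \<open>DR(w)\<^sup>* DR(w)\<close>.\<close>

definition gn_direction :: "('n::finite) ns_data \<Rightarrow> 'n state \<Rightarrow> 'n state \<Rightarrow> bool" where
  "gn_direction P w d \<longleftrightarrow>
     d \<in> H_carrier P \<and> (\<forall>\<delta>\<in>H_carrier P. gn_operator P w d \<delta> = DE P w \<delta>)"

definition metric_definite_on :: "('n::finite) ns_data \<Rightarrow> 'n state \<Rightarrow> 'n state set \<Rightarrow> bool" where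
  "metric_definite_on P w S \<longleftrightarrow> (\<forall>v\<in>S. metric P w v v = 0 \<longrightarrow> H_norm P v = 0)"

text \<open>
  Invertibility of \<open>DR(w)\<^sup>* DR(w)\<close> implies that a direction exists and that the metric is definite.
  The operator is never injective on the whole space, because spatially constant
  pressures \<open>p(t,x) = c(t)\<close> lie in the kernel of \<open>DR(w)\<close>. What is used of its inverse is therefore
  only the solvability of the equation for the direction, and definiteness of the metric
  on the tangent space.
\<close>

definition gn_invertible :: "('n::finite) ns_data \<Rightarrow> 'n state \<Rightarrow> bool" where
  "gn_invertible P w \<longleftrightarrow>
     (\<forall>\<delta>\<in>H_carrier P. (\<forall>\<delta>'\<in>H_carrier P. gn_operator P w \<delta> \<delta>' = 0) \<longrightarrow> H_norm P \<delta> = 0) \<and>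
     (\<forall>l. bounded_linear_into (H_space P) normed_UNIV l \<longrightarrow>
        (\<exists>\<delta>\<in>H_carrier P. \<forall>\<delta>'\<in>H_carrier P. gn_operator P w \<delta> \<delta>' = l \<delta>'))"

lemma gn_invertible_imp_direction:
  assumes "gn_invertible P w" and "has_frechet_deriv (H_space P) normed_UNIV (energy P) A w"
  shows "\<exists>d. gn_direction P w d"
proof -
  have "has_frechet_deriv (H_space P) normed_UNIV (energy P) (DE P w) w"
    unfolding DE_def frechet_deriv_def using assms(2) by (metis someI_ex)
  then show ?thesis
    using assms(1) unfolding gn_invertible_def gn_direction_def has_frechet_deriv_def by blast
qed

lemma L2_inner_eq_0:
  assumes "f \<in> L2 M" and "L2_inner M f f = 0"
  shows "L2_inner M f g = 0"
proof -
  have "integrable M (\<lambda>x. f x \<bullet> f x)"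
    using assms(1) by (simp add: L2_def power2_norm_eq_inner)
  then have "AE x in M. f x \<bullet> f x = 0"
    using assms(2) integral_nonneg_eq_0_iff_AE[of M "\<lambda>x. f x \<bullet> f x"] by (simp add: L2_inner_def)
  then have "AE x in M. f x \<bullet> g x = 0"
    by eventually_elim simp
  then show ?thesis
    unfolding L2_inner_def by (simp add: integral_eq_zero_AE)
qed

lemma L2_inner_nonneg: "L2_inner M f f \<ge> 0"
  by (simp add: L2_inner_def)

lemma gn_invertible_imp_metric_definite_on:
  assumes inv: "gn_invertible P w" and w: "w \<in> H_carrier P" and "residual_smooth P"
    and S: "S \<subseteq> H_carrier P"
  shows "metric_definite_on P w S"
  unfolding metric_definite_on_def
proof (intro ballI impI)
  fix v assume v: "v \<in> S" and 0: "metric P w v v = 0"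
  have "\<exists>A. has_frechet_deriv (H_space P) (Q_space P) (residual P) A w"
    using assms unfolding residual_smooth_def by blast
  then have "has_frechet_deriv (H_space P) (Q_space P) (residual P) (DR P w) w"
    unfolding DR_def frechet_deriv_def by (rule someI_ex)
  then have "DR P w v \<in> Q_carrier P"
    using v S by (auto simp: has_frechet_deriv_def bounded_linear_into_def H_space_def Q_space_def)
  moreover obtain a b c d where eq: "DR P w v = (a, b, c, d)"
    by (cases "DR P w v") auto
  ultimately have L: "a \<in> L2 (cylinder P)" "b \<in> L2 (cylinder P)" "c \<in> L2 (lateral P)"
      "d \<in> L2 (space_dom P)"
    by (auto simp: Q_carrier_def)
  have "L2_inner (cylinder P) a a = 0" "L2_inner (cylinder P) b b = 0"
      "L2_inner (lateral P) c c = 0" "L2_inner (space_dom P) d d = 0"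
    using 0 L2_inner_nonneg[of "cylinder P" a] L2_inner_nonneg[of "cylinder P" b]
      L2_inner_nonneg[of "lateral P" c] L2_inner_nonneg[of "space_dom P" d]
    by (simp_all add: metric_def eq Q_inner_def)
  then have "gn_operator P w v \<delta> = 0" for \<delta>
    using L by (cases "DR P w \<delta>") (simp add: gn_operator_def eq Q_inner_def L2_inner_eq_0)
  then show "H_norm P v = 0"
    using inv v S unfolding gn_invertible_def by blast
qed

section \<open>Parametrised models and the Gauss-Newton iteration\<close>

text \<open>Partial derivative with respect to the \<open>i\<close>-th parameter, as an element of the space \<open>Y\<close>.\<close>

definition param_deriv ::
    "'b::real_vector snspace \<Rightarrow> (real^'p \<Rightarrow> 'b) \<Rightarrow> 'p \<Rightarrow> real^'p \<Rightarrow> 'b" where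
  "param_deriv Y F i \<theta> = frechet_deriv normed_UNIV Y F \<theta> (axis i 1)"

definition velocity_tangent ::
    "('n::finite) ns_data \<Rightarrow> (real^'p \<Rightarrow> 'n velocity) \<Rightarrow> real^'p \<Rightarrow> 'p \<Rightarrow> 'n state" where
  "velocity_tangent P u \<theta> i = (param_deriv (velocity_space P) u i \<theta>, 0)"

definition pressure_tangent ::
    "('n::finite) ns_data \<Rightarrow> (real^'q \<Rightarrow> 'n pressure) \<Rightarrow> real^'q \<Rightarrow> 'q \<Rightarrow> 'n state" where
  "pressure_tangent P p \<psi> j = (0, param_deriv (pressure_space P) p j \<psi>)"

definition tangent_space ::
    "('n::finite) ns_data \<Rightarrow> (real^'p \<Rightarrow> 'n velocity) \<Rightarrow> (real^'q \<Rightarrow> 'n pressure) \<Rightarrow>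
     real^'p \<Rightarrow> real^'q \<Rightarrow> 'n state set" where
  "tangent_space P u p \<theta> \<psi> =
     span (range (velocity_tangent P u \<theta>) \<union> range (pressure_tangent P p \<psi>))"

definition orth_proj :: "('n::finite) ns_data \<Rightarrow> 'n state \<Rightarrow> 'n state set \<Rightarrow> 'n state \<Rightarrow> 'n state" where
  "orth_proj P w S d = (SOME v. v \<in> S \<and> (\<forall>s\<in>S. metric P w (d - v) s = 0))"

definition loss ::
    "('n::finite) ns_data \<Rightarrow> (real^'p \<Rightarrow> 'n velocity) \<Rightarrow> (real^'q \<Rightarrow> 'n pressure) \<Rightarrow>
     real^'p \<Rightarrow> real^'q \<Rightarrow> real" where
  "loss P u p \<theta> \<psi> = energy P (u \<theta>, p \<psi>)"

definition block_vec :: "real^'p \<Rightarrow> real^'q \<Rightarrow> real^('p + 'q)" where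
  "block_vec a b = (\<chi> r. case r of Inl i \<Rightarrow> a $ i | Inr j \<Rightarrow> b $ j)"

definition gradient :: "(real^'p \<Rightarrow> real) \<Rightarrow> real^'p \<Rightarrow> real^'p" where
  "gradient f x = (\<chi> i. frechet_derivative f (at x) (axis i 1))"

definition loss_gradient ::
    "('n::finite) ns_data \<Rightarrow> (real^'p \<Rightarrow> 'n velocity) \<Rightarrow> (real^'q \<Rightarrow> 'n pressure) \<Rightarrow>
     real^'p \<Rightarrow> real^'q \<Rightarrow> real^('p + 'q)" where
  "loss_gradient P u p \<theta> \<psi> =
     block_vec (gradient (\<lambda>\<theta>'. loss P u p \<theta>' \<psi>) \<theta>) (gradient (\<lambda>\<psi>'. loss P u p \<theta> \<psi>') \<psi>)"

definition gn_matrix ::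
    "('n::finite) ns_data \<Rightarrow> (real^'p \<Rightarrow> 'n velocity) \<Rightarrow> (real^'q \<Rightarrow> 'n pressure) \<Rightarrow>
     real^'p \<Rightarrow> real^'q \<Rightarrow> real^('p + 'q)^('p + 'q)" where
  "gn_matrix P u p \<theta> \<psi> =
    (let g = metric P (u \<theta>, p \<psi>); U = velocity_tangent P u \<theta>; V = pressure_tangent P p \<psi>;
         A = (\<lambda>i j. g (U i) (U j)); B = (\<lambda>i j. g (U i) (V j)); C = (\<lambda>i j. g (V i) (V j))
     in \<chi> r s. case (r, s) of
          (Inl i, Inl j) \<Rightarrow> A i j | (Inl i, Inr j) \<Rightarrow> B i j
        | (Inr i, Inl j) \<Rightarrow> B j i | (Inr i, Inr j) \<Rightarrow> C i j)"

text \<open>Moore-Penrose pseudoinverse, characterised by the four Penrose equations.\<close>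

definition pinv :: "real^'n^'m \<Rightarrow> real^'m^'n" where
  "pinv A = (THE X. A ** X ** A = A \<and> X ** A ** X = X \<and>
               transpose (A ** X) = A ** X \<and> transpose (X ** A) = X ** A)"

definition gn_step ::
    "('n::finite) ns_data \<Rightarrow> (real^'p \<Rightarrow> 'n velocity) \<Rightarrow> (real^'q \<Rightarrow> 'n pressure) \<Rightarrow>
     real^'p \<Rightarrow> real^'q \<Rightarrow> real^('p + 'q)" where
  "gn_step P u p \<theta> \<psi> = pinv (gn_matrix P u p \<theta> \<psi>) *v loss_gradient P u p \<theta> \<psi>"

definition gn_iteration ::
    "('n::finite) ns_data \<Rightarrow> (real^'p \<Rightarrow> 'n velocity) \<Rightarrow> (real^'q \<Rightarrow> 'n pressure) \<Rightarrow>
     (nat \<Rightarrow> real) \<Rightarrow> (nat \<Rightarrow> real^'p) \<Rightarrow> (nat \<Rightarrow> real^'q) \<Rightarrow> bool" where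
  "gn_iteration P u p \<eta> \<theta> \<psi> \<longleftrightarrow>
     (\<forall>k. \<eta> k > 0 \<and>
        block_vec (\<theta> (Suc k)) (\<psi> (Suc k)) =
          block_vec (\<theta> k) (\<psi> k) - \<eta> k *\<^sub>R gn_step P u p (\<theta> k) (\<psi> k))"

end

theory Submission
  imports Defs
begin

text \<open>
  The parameter step moves the model, to first order, along the tangent vector \<open>v\<close> whose
  coefficients are the components of the step \<open>G\<^sup>\<dagger>\<nabla>L\<close>. The theorem says two things: \<open>v\<close> is
  the \<open>g\<close>-orthogonal projection of the function-space direction \<open>d\<close>, and what the linearisation
  leaves over is quadratic in the step.

  Projection. By the chain rule the entries of \<open>\<nabla>L\<close> are \<open>DE(w)e\<^sub>r\<close>, where \<open>e\<^sub>r\<close> runs through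
  the tangent vectors, and these equal \<open>g(d, e\<^sub>r)\<close> because \<open>d\<close> solves \<open>DR(w)\<^sup>*DR(w)d = DE(w)\<close>.
  Hence \<open>G c = \<nabla>L\<close> is the system of normal equations for projecting \<open>d\<close> onto the span of the
  \<open>e\<^sub>r\<close>. The Gram matrix \<open>G\<close> may be singular, but the normal equations are solvable all the same: a
  coefficient vector in the kernel of \<open>G\<close> gives a tangent vector of \<open>g\<close>-length zero, which by
  Cauchy-Schwarz is \<open>g\<close>-orthogonal to \<open>d\<close>, so \<open>\<nabla>L\<close> is orthogonal to the kernel and lies in
  the range of the symmetric matrix \<open>G\<close>. The pseudoinverse therefore finds a solution
  (\<open>gram_projection\<close>). Two solutions of the projection problem differ by a tangent vector of
  \<open>g\<close>-length zero, and definiteness of \<open>g\<close> on the tangent space makes this difference negligible.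

  Remainder. Two applications of a mean value inequality along segments
  (\<open>seminorm_increment_bound\<close>) bound the remainder by the second derivatives of the model, and these
  are bounded on a ball that contains the compact closure of \<open>K\<close> (\<open>frechet_taylor_bound\<close>).

  Both halves use that the norms of the solution spaces satisfy the triangle inequality. They are
  built from representatives of weak derivatives selected by a choice operator, so they are
  seminorms only because weak derivatives are unique almost everywhere and depend linearly on the
  function. Uniqueness is the fundamental lemma of the calculus of variations. In time it has to be
  proved with a countable set of test functions, because the null set of points \<open>x\<close> at which the
  defining identity fails may depend on the test function (\<open>countable_separating_tests\<close>).
\<close>

section \<open>Seminormed spaces and Frechet derivatives\<close>

text \<open>Spaces whose seminorm may vanish on nonzero elements; the identities below therefore only ever hold
  up to elements of seminorm zero.\<close>

definition seminormed :: "'a::real_vector snspace \<Rightarrow> bool" where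
  "seminormed X \<longleftrightarrow> subspace (fst X) \<and>
     (\<forall>x\<in>fst X. \<forall>y\<in>fst X. snd X (x + y) \<le> snd X x + snd X y) \<and>
     (\<forall>x\<in>fst X. \<forall>c. snd X (c *\<^sub>R x) = \<bar>c\<bar> * snd X x)"

lemma seminormed_subspace: "seminormed X \<Longrightarrow> subspace (fst X)"
  and seminormed_triangle: "seminormed X \<Longrightarrow> x \<in> fst X \<Longrightarrow> y \<in> fst X \<Longrightarrow> snd X (x + y) \<le> snd X x + snd X y"
  and seminormed_scale: "seminormed X \<Longrightarrow> x \<in> fst X \<Longrightarrow> snd X (c *\<^sub>R x) = \<bar>c\<bar> * snd X x"
  by (auto simp: seminormed_def)

lemma seminormed_normed_UNIV: "seminormed normed_UNIV"
  by (auto simp: seminormed_def normed_UNIV_def norm_triangle_ineq)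

lemma seminormed_zero: "seminormed X \<Longrightarrow> snd X 0 = 0"
  using seminormed_scale[of X 0 0] subspace_0[OF seminormed_subspace[of X]] by auto

lemma seminormed_minus: "seminormed X \<Longrightarrow> x \<in> fst X \<Longrightarrow> snd X (- x) = snd X x"
  using seminormed_scale[of X x "-1"] by simp

lemma seminormed_diff:
  assumes "seminormed X" "x \<in> fst X" "y \<in> fst X"
  shows "snd X (x - y) \<le> snd X x + snd X y"
  using seminormed_triangle[OF assms(1,2), of "- y"] seminormed_minus[OF assms(1,3)]
    subspace_neg[OF seminormed_subspace[OF assms(1)] assms(3)] by simp

lemma seminormed_nonneg: "seminormed X \<Longrightarrow> x \<in> fst X \<Longrightarrow> 0 \<le> snd X x"
  using seminormed_diff[of X x x] seminormed_zero[of X] by simp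

lemma seminormed_le_add:
  assumes "seminormed X" "x \<in> fst X" "y \<in> fst X"
  shows "snd X x \<le> snd X y + snd X (x - y)"
  using seminormed_triangle[OF assms(1) assms(3), of "x - y"]
    subspace_diff[OF seminormed_subspace[OF assms(1)] assms(2,3)] by simp

lemma seminormed_commute:
  assumes "seminormed X" "x \<in> fst X" "y \<in> fst X"
  shows "snd X (x - y) = snd X (y - x)"
  using seminormed_minus[OF assms(1), of "x - y"]
    subspace_diff[OF seminormed_subspace[OF assms(1)] assms(2,3)] by simp

lemma seminormed_triangle_diff:
  assumes "seminormed X" "x \<in> fst X" "y \<in> fst X" "z \<in> fst X"
  shows "snd X (x - z) \<le> snd X (x - y) + snd X (y - z)"
  using seminormed_triangle[OF assms(1), of "x - y" "y - z"]
    subspace_diff[OF seminormed_subspace[OF assms(1)]] assms by simp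

lemma seminormed_sum:
  assumes "seminormed X" "finite I" "\<And>i. i \<in> I \<Longrightarrow> f i \<in> fst X"
  shows "snd X (sum f I) \<le> (\<Sum>i\<in>I. snd X (f i))"
  using assms(2,3)
proof (induction I rule: finite_induct)
  case empty
  then show ?case using seminormed_zero[OF assms(1)] by simp
next
  case (insert i I)
  have "sum f I \<in> fst X"
    by (rule subspace_sum[OF seminormed_subspace[OF assms(1)]]) (use insert in auto)
  with insert seminormed_triangle[OF assms(1), of "f i" "sum f I"] show ?case by force
qed

lemma bounded_linear_intoD:
  assumes "bounded_linear_into X Y A"
  shows "x \<in> fst X \<Longrightarrow> A x \<in> fst Y"
    and "x \<in> fst X \<Longrightarrow> y \<in> fst X \<Longrightarrow> snd Y (A (a *\<^sub>R x + b *\<^sub>R y) - (a *\<^sub>R A x + b *\<^sub>R A y)) = 0"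
  using assms by (auto simp: bounded_linear_into_def)

lemma bounded_linear_into_bound:
  assumes "seminormed X" "bounded_linear_into X Y A"
  obtains C where "C > 0" "\<And>x. x \<in> fst X \<Longrightarrow> snd Y (A x) \<le> C * snd X x"
proof -
  obtain C where C: "\<And>x. x \<in> fst X \<Longrightarrow> snd Y (A x) \<le> C * snd X x"
    using assms(2) unfolding bounded_linear_into_def by blast
  have "snd Y (A x) \<le> max C 1 * snd X x" if "x \<in> fst X" for x
    using C[OF that] mult_right_mono[OF max.cobounded1[of C 1] seminormed_nonneg[OF assms(1) that]]
    by linarith
  then show ?thesis using that[of "max C 1"] by auto
qed

lemma bounded_linear_into_scale:
  assumes "seminormed X" "bounded_linear_into X Y A" "x \<in> fst X"
  shows "snd Y (A (a *\<^sub>R x) - a *\<^sub>R A x) = 0"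
  using bounded_linear_intoD(2)[OF assms(2,3,3), of a 0] by simp

lemma bounded_linear_into_sum:
  assumes X: "seminormed X" and Y: "seminormed Y" and A: "bounded_linear_into X Y A"
    and "finite I" "\<And>i. i \<in> I \<Longrightarrow> x i \<in> fst X"
  shows "snd Y (A (\<Sum>i\<in>I. c i *\<^sub>R x i) - (\<Sum>i\<in>I. c i *\<^sub>R A (x i))) = 0"
  using assms(4,5)
proof (induction I rule: finite_induct)
  case empty
  then show ?case
    using bounded_linear_into_scale[OF X A, of 0 0] subspace_0[OF seminormed_subspace[OF X]] by simp
next
  case (insert i I)
  let ?s = "\<Sum>i\<in>I. c i *\<^sub>R x i" and ?t = "\<Sum>i\<in>I. c i *\<^sub>R A (x i)"
  have s: "?s \<in> fst X" and t: "?t \<in> fst Y"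
    using insert.prems bounded_linear_intoD(1)[OF A] seminormed_subspace[OF X] seminormed_subspace[OF Y]
    by (auto intro!: subspace_sum subspace_scale)
  have xi: "x i \<in> fst X" using insert by auto
  note Y' = subspace_add[OF seminormed_subspace[OF Y]] subspace_scale[OF seminormed_subspace[OF Y]]
    subspace_diff[OF seminormed_subspace[OF Y]] bounded_linear_intoD(1)[OF A]
    subspace_add[OF seminormed_subspace[OF X]] subspace_scale[OF seminormed_subspace[OF X]]
  have "snd Y (A (c i *\<^sub>R x i + ?s) - (c i *\<^sub>R A (x i) + ?t))
     \<le> snd Y (A (c i *\<^sub>R x i + ?s) - (c i *\<^sub>R A (x i) + A ?s))
       + snd Y ((c i *\<^sub>R A (x i) + A ?s) - (c i *\<^sub>R A (x i) + ?t))"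
    by (rule seminormed_triangle_diff[OF Y]) (use s t xi Y' in auto)
  also have "\<dots> = 0"
    using bounded_linear_intoD(2)[OF A xi s, of "c i" 1] insert by simp
  finally show ?case
    using insert seminormed_nonneg[OF Y, of "A (c i *\<^sub>R x i + ?s) - (c i *\<^sub>R A (x i) + ?t)"] s t xi Y'
    by simp
qed

lemma has_frechet_derivD:
  assumes "has_frechet_deriv X Y F A w"
  shows "bounded_linear_into X Y A"
    and "e > 0 \<Longrightarrow> \<exists>r>0. \<forall>h\<in>fst X. snd X h < r \<longrightarrow> snd Y (F (w + h) - F w - A h) \<le> e * snd X h"
  using assms by (auto simp: has_frechet_deriv_def)

lemma has_frechet_deriv_frechet_deriv:
  "has_frechet_deriv X Y F A w \<Longrightarrow> has_frechet_deriv X Y F (frechet_deriv X Y F w) w"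
  unfolding frechet_deriv_def by (rule someI[where P = "\<lambda>A. has_frechet_deriv X Y F A w"])

text \<open>Two derivatives differ by \<open>o(h)\<close>; evaluating at \<open>t h\<close> and letting \<open>t\<close> tend to 0 forces the
  homogeneous difference to have seminorm zero. This is what makes the choice in
  \<^const>\<open>frechet_deriv\<close> harmless.\<close>

lemma has_frechet_deriv_unique:
  assumes X: "seminormed X" and Y: "seminormed Y"
    and F: "\<And>x. x \<in> fst X \<Longrightarrow> F (w + x) \<in> fst Y"
    and A: "has_frechet_deriv X Y F A w" and B: "has_frechet_deriv X Y F B w"
    and h: "h \<in> fst X"
  shows "snd Y (A h - B h) = 0"
proof -
  note Ab = has_frechet_derivD(1)[OF A] and Bb = has_frechet_derivD(1)[OF B]
  note Y' = subspace_add[OF seminormed_subspace[OF Y]] subspace_scale[OF seminormed_subspace[OF Y]]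
    subspace_diff[OF seminormed_subspace[OF Y]] bounded_linear_intoD(1)[OF Ab]
    bounded_linear_intoD(1)[OF Bb] subspace_scale[OF seminormed_subspace[OF X]]
  have AB: "A h - B h \<in> fst Y" using Y' h by auto
  have Fw: "F w \<in> fst Y" using F[of 0] subspace_0[OF seminormed_subspace[OF X]] by simp
  have hn: "0 \<le> snd X h" by (rule seminormed_nonneg[OF X h])
  have "snd Y (A h - B h) \<le> e * (2 * snd X h)" if e: "e > 0" for e
  proof -
    obtain r1 where r1: "r1 > 0" "\<And>h. h\<in>fst X \<Longrightarrow> snd X h < r1 \<Longrightarrow> snd Y (F (w + h) - F w - A h) \<le> e * snd X h"
      using has_frechet_derivD(2)[OF A e] by auto
    obtain r2 where r2: "r2 > 0" "\<And>h. h\<in>fst X \<Longrightarrow> snd X h < r2 \<Longrightarrow> snd Y (F (w + h) - F w - B h) \<le> e * snd X h"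
      using has_frechet_derivD(2)[OF B e] by auto
    \<comment> \<open>The added 1 keeps the quotient meaningful when \<open>h\<close> has seminorm zero.\<close>
    define t where "t = min r1 r2 / (snd X h + 1)"
    have t: "t > 0" using r1 r2 hn by (simp add: t_def)
    have "t * snd X h < t * (snd X h + 1)" using t by simp
    moreover have "t * (snd X h + 1) = min r1 r2" using hn by (simp add: t_def)
    ultimately have tr: "snd X (t *\<^sub>R h) < r1" "snd X (t *\<^sub>R h) < r2"
      using seminormed_scale[OF X h, of t] t by auto
    have th: "t *\<^sub>R h \<in> fst X" using h Y' by auto
    let ?D = "F (w + t *\<^sub>R h) - F w"
    have D: "?D \<in> fst Y" using F[OF th] Fw Y' by auto
    have "t * snd Y (A h - B h) = snd Y (t *\<^sub>R A h - t *\<^sub>R B h)"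
      using seminormed_scale[OF Y AB, of t] t by (simp add: scaleR_diff_right)
    also have "\<dots> \<le> snd Y (t *\<^sub>R A h - A (t *\<^sub>R h)) + snd Y (A (t *\<^sub>R h) - t *\<^sub>R B h)"
      by (rule seminormed_triangle_diff[OF Y]) (use Y' h th in auto)
    also have "snd Y (A (t *\<^sub>R h) - t *\<^sub>R B h) \<le> snd Y (A (t *\<^sub>R h) - B (t *\<^sub>R h)) + snd Y (B (t *\<^sub>R h) - t *\<^sub>R B h)"
      by (rule seminormed_triangle_diff[OF Y]) (use Y' h th in auto)
    also have "snd Y (A (t *\<^sub>R h) - B (t *\<^sub>R h)) \<le> snd Y (A (t *\<^sub>R h) - ?D) + snd Y (?D - B (t *\<^sub>R h))"
      by (rule seminormed_triangle_diff[OF Y]) (use Y' h th D in auto)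
    also have "snd Y (t *\<^sub>R A h - A (t *\<^sub>R h)) = 0"
      using bounded_linear_into_scale[OF X Ab h, of t] seminormed_commute[OF Y] Y' h th by metis
    also have "snd Y (B (t *\<^sub>R h) - t *\<^sub>R B h) = 0"
      by (rule bounded_linear_into_scale[OF X Bb h])
    also have "snd Y (A (t *\<^sub>R h) - ?D) = snd Y (?D - A (t *\<^sub>R h))"
      by (rule seminormed_commute[OF Y]) (use Y' h th D in auto)
    also have "\<dots> \<le> e * snd X (t *\<^sub>R h)" by (rule r1(2)[OF th tr(1)])
    also have "snd Y (?D - B (t *\<^sub>R h)) \<le> e * snd X (t *\<^sub>R h)" by (rule r2(2)[OF th tr(2)])
    finally have "t * snd Y (A h - B h) \<le> t * (e * (2 * snd X h))"
      using seminormed_scale[OF X h, of t] t by (simp add: algebra_simps)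
    then show ?thesis using t by simp
  qed
  then have "snd Y (A h - B h) \<le> 0 * (2 * snd X h)"
    by (intro tendsto_lowerbound[where F="at_right (0::real)" and f="\<lambda>e. e * (2 * snd X h)"])
      (auto intro!: tendsto_mult_left_zero eventually_at_right_less[THEN eventually_mono])
  then show ?thesis using seminormed_nonneg[OF Y AB] by simp
qed

text \<open>The chain rule for real-valued outer functions. The outer derivative is then exactly linear and,
  being bounded, does not see elements of seminorm zero.\<close>

lemma has_frechet_deriv_chain_real:
  fixes F :: "'b::real_vector \<Rightarrow> real"
  assumes X: "seminormed X" and Y: "seminormed Y"
    and G: "\<And>h. h \<in> fst X \<Longrightarrow> G (x + h) \<in> fst Y"
    and A: "has_frechet_deriv X Y G A x" and B: "has_frechet_deriv Y normed_UNIV F B (G x)"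
  shows "has_frechet_deriv X normed_UNIV (\<lambda>z. F (G z)) (\<lambda>h. B (A h)) x"
proof -
  note Ab = has_frechet_derivD(1)[OF A] and Bb = has_frechet_derivD(1)[OF B]
  note Y' = subspace_add[OF seminormed_subspace[OF Y]] subspace_scale[OF seminormed_subspace[OF Y]]
    subspace_diff[OF seminormed_subspace[OF Y]] bounded_linear_intoD(1)[OF Ab]
    subspace_scale[OF seminormed_subspace[OF X]] subspace_add[OF seminormed_subspace[OF X]]
  have Blin: "B (a *\<^sub>R y + b *\<^sub>R z) = a * B y + b * B z" if "y \<in> fst Y" "z \<in> fst Y" for a b y z
    using bounded_linear_intoD(2)[OF Bb that, of a b] by (simp add: normed_UNIV_def)
  have Bdiff: "B (y - z) = B y - B z" if "y \<in> fst Y" "z \<in> fst Y" for y z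
    using Blin[OF that, of 1 "-1"] by simp
  obtain CA where CA: "CA > 0" "\<And>h. h \<in> fst X \<Longrightarrow> snd Y (A h) \<le> CA * snd X h"
    using bounded_linear_into_bound[OF X Ab] by blast
  obtain CB where CB: "CB > 0" "\<And>h. h \<in> fst Y \<Longrightarrow> \<bar>B h\<bar> \<le> CB * snd Y h"
    using bounded_linear_into_bound[OF Y Bb] by (auto simp: normed_UNIV_def)
  have B0: "B y = 0" if "y \<in> fst Y" "snd Y y = 0" for y
    using CB(2)[OF that(1)] that by simp
  have "bounded_linear_into X normed_UNIV (\<lambda>h. B (A h))"
    unfolding bounded_linear_into_def
  proof (intro conjI ballI allI exI[of _ "CB * CA"])
    fix h k a b assume h: "h \<in> fst X" and k: "k \<in> fst X"
    have "B (A (a *\<^sub>R h + b *\<^sub>R k) - (a *\<^sub>R A h + b *\<^sub>R A k)) = 0"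
      by (rule B0) (use Y' h k bounded_linear_intoD(2)[OF Ab h k] in auto)
    then show "snd normed_UNIV (B (A (a *\<^sub>R h + b *\<^sub>R k)) - (a *\<^sub>R B (A h) + b *\<^sub>R B (A k))) = 0"
      using Y' h k Bdiff Blin by (simp add: normed_UNIV_def)
  next
    fix h assume h: "h \<in> fst X"
    have "\<bar>B (A h)\<bar> \<le> CB * snd Y (A h)" using CB Y' h by auto
    also have "\<dots> \<le> CB * (CA * snd X h)" using CA(2)[OF h] CB(1) by simp
    finally show "snd normed_UNIV (B (A h)) \<le> CB * CA * snd X h" by (simp add: normed_UNIV_def mult.assoc)
  qed (simp add: normed_UNIV_def)
  moreover have "\<exists>r>0. \<forall>h\<in>fst X. snd X h < r \<longrightarrow>
      snd normed_UNIV (F (G (x + h)) - F (G x) - B (A h)) \<le> e * snd X h" if e: "e > 0" for e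
  proof -
    \<comment> \<open>The error \<open>e\<close> is shared equally: the inner remainder is magnified by at most \<open>CB\<close>, and the
      inner increment is at most \<open>CA + 1\<close> times the step as soon as the inner error is at most 1.\<close>
    define e1 where "e1 = min 1 (e / (2 * CB))"
    have e1: "e1 > 0" "e1 \<le> 1" "CB * e1 \<le> e/2" using e CB by (auto simp: e1_def min_def field_simps)
    define e2 where "e2 = e / (2 * (CA + 1))"
    have e2: "e2 > 0" "e2 * (CA + 1) = e/2" using e CA by (auto simp: e2_def field_simps)
    obtain r1 where r1: "r1 > 0" "\<And>h. h\<in>fst X \<Longrightarrow> snd X h < r1 \<Longrightarrow> snd Y (G (x + h) - G x - A h) \<le> e1 * snd X h"
      using has_frechet_derivD(2)[OF A e1(1)] by auto
    obtain r2 where r2: "r2 > 0" "\<And>k. k\<in>fst Y \<Longrightarrow> snd Y k < r2 \<Longrightarrow> \<bar>F (G x + k) - F (G x) - B k\<bar> \<le> e2 * snd Y k"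
      using has_frechet_derivD(2)[OF B e2(1)] by (auto simp: normed_UNIV_def)
    show ?thesis
    proof (intro exI[of _ "min r1 (r2 / (CA + 1))"] conjI ballI impI)
      show "min r1 (r2 / (CA + 1)) > 0" using r1 r2 CA by simp
      fix h assume h: "h \<in> fst X" and "snd X h < min r1 (r2 / (CA + 1))"
      then have hr: "snd X h < r1" "(CA + 1) * snd X h < r2" using CA by (auto simp: field_simps)
      define k where "k = G (x + h) - G x"
      have hn: "0 \<le> snd X h" by (rule seminormed_nonneg[OF X h])
      have k: "k \<in> fst Y" using G[OF h] G[of 0] subspace_0[OF seminormed_subspace[OF X]] Y' by (simp add: k_def)
      have kA: "snd Y (k - A h) \<le> e1 * snd X h" using r1(2)[OF h hr(1)] by (simp add: k_def)
      also have "\<dots> \<le> snd X h" using e1 hn by (simp add: mult_left_le_one_le)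
      finally have kn: "snd Y k \<le> (CA + 1) * snd X h"
        using seminormed_le_add[OF Y k, of "A h"] Y' h CA(2)[OF h] by (simp add: algebra_simps)
      have "\<bar>F (G x + k) - F (G x) - B k\<bar> \<le> e2 * snd Y k" by (rule r2(2)) (use k kn hr in auto)
      also have "\<dots> \<le> e2 * ((CA + 1) * snd X h)" using kn e2 by simp
      also have "\<dots> = e/2 * snd X h" using e2(2) by (metis mult.assoc)
      finally have 1: "\<bar>F (G (x + h)) - F (G x) - B k\<bar> \<le> e/2 * snd X h" by (simp add: k_def)
      have "\<bar>B k - B (A h)\<bar> = \<bar>B (k - A h)\<bar>" using Bdiff k Y' h by simp
      also have "\<dots> \<le> CB * snd Y (k - A h)" using CB(2) k Y' h by simp
      also have "\<dots> \<le> CB * (e1 * snd X h)" using kA CB by simp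
      also have "\<dots> \<le> e/2 * snd X h" using e1(3) hn by (metis mult.assoc mult_right_mono)
      finally show "snd normed_UNIV (F (G (x + h)) - F (G x) - B (A h)) \<le> e * snd X h"
        using 1 unfolding normed_UNIV_def snd_conv real_norm_def by linarith
    qed
  qed
  ultimately show ?thesis by (auto simp: has_frechet_deriv_def)
qed

lemma has_frechet_deriv_imp_has_derivative:
  fixes f :: "'a::real_normed_vector \<Rightarrow> 'b::real_normed_vector"
  assumes "has_frechet_deriv normed_UNIV normed_UNIV f A x"
  shows "(f has_derivative A) (at x)"
proof -
  have l: "bounded_linear_into normed_UNIV normed_UNIV A" by (rule has_frechet_derivD(1)[OF assms])
  have lin: "A (a *\<^sub>R y + b *\<^sub>R z) = a *\<^sub>R A y + b *\<^sub>R A z" for a b y z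
    using bounded_linear_intoD(2)[OF l, of y z a b] by (simp add: normed_UNIV_def)
  obtain C where C: "\<And>y. norm (A y) \<le> C * norm y"
    using bounded_linear_into_bound[OF seminormed_normed_UNIV l] by (auto simp: normed_UNIV_def)
  have bl: "bounded_linear A"
    by (rule bounded_linear_intro[of _ C])
      (use lin[of 1 _ 1] lin[of _ _ 0] C in \<open>auto simp: mult.commute\<close>)
  show ?thesis
    unfolding has_derivative_at_alt
  proof (intro conjI bl allI impI)
    fix e :: real assume "e > 0"
    from has_frechet_derivD(2)[OF assms this] obtain r where
      r: "r > 0" "\<And>h. norm h < r \<Longrightarrow> norm (f (x + h) - f x - A h) \<le> e * norm h"
      by (auto simp: normed_UNIV_def)
    show "\<exists>d>0. \<forall>y. norm (y - x) < d \<longrightarrow> norm (f y - f x - A (y - x)) \<le> e * norm (y - x)"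
      using r(1) r(2)[of "y - x" for y] by auto
  qed
qed

section \<open>A quadratic Taylor bound\<close>

text \<open>By differentiability, the bound with constant \<open>M + e\<close> holds on all short intervals around each
  point; it is additive under concatenation, and so extends to \<open>[0, 1]\<close> by bisection.\<close>

lemma seminorm_mean_value:
  fixes f f' :: "real \<Rightarrow> 'b::real_vector"
  assumes Y: "seminormed Y" and f: "\<And>t. t \<in> {0..1} \<Longrightarrow> f t \<in> fst Y" "\<And>t. t \<in> {0..1} \<Longrightarrow> f' t \<in> fst Y"
    and d: "\<And>t e. t \<in> {0..1} \<Longrightarrow> e > 0 \<Longrightarrow>
        \<exists>r>0. \<forall>s\<in>{0..1}. \<bar>s - t\<bar> < r \<longrightarrow> snd Y (f s - f t - (s - t) *\<^sub>R f' t) \<le> e * \<bar>s - t\<bar>"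
    and M: "\<And>t. t \<in> {0..1} \<Longrightarrow> snd Y (f' t) \<le> M"
  shows "snd Y (f 1 - f 0) \<le> M"
proof -
  note Y' = subspace_add[OF seminormed_subspace[OF Y]] subspace_scale[OF seminormed_subspace[OF Y]]
    subspace_diff[OF seminormed_subspace[OF Y]] f
  have "snd Y (f 1 - f 0) \<le> M + e" if e: "e > 0" for e
  proof -
    let ?P = "\<lambda>a b. 0 \<le> a \<longrightarrow> a \<le> b \<longrightarrow> b \<le> 1 \<longrightarrow> snd Y (f b - f a) \<le> (M + e) * (b - a)"
    have "?P 0 1"
    proof (rule Bolzano[of 0 1 ?P])
      fix a b c :: real
      assume 1: "?P a b" "?P b c" "a \<le> b" "b \<le> c"
      show "?P a c"
      proof (intro impI)
        assume a: "0 \<le> a" "a \<le> c" "c \<le> 1"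
        have "snd Y (f c - f a) \<le> snd Y (f c - f b) + snd Y (f b - f a)"
          by (rule seminormed_triangle_diff[OF Y]) (use f 1 a in auto)
        also have "\<dots> \<le> (M + e) * (c - b) + (M + e) * (b - a)" using 1 a by force
        finally show "snd Y (f c - f a) \<le> (M + e) * (c - a)" by (simp add: algebra_simps)
      qed
    next
      fix x :: real assume "0 \<le> x" "x \<le> 1"
      then have x: "x \<in> {0..1}" by auto
      obtain r where r: "r > 0" "\<And>s. s\<in>{0..1} \<Longrightarrow> \<bar>s - x\<bar> < r \<Longrightarrow> snd Y (f s - f x - (s - x) *\<^sub>R f' x) \<le> e * \<bar>s - x\<bar>"
        using d[OF x e] by auto
      have one: "snd Y (f s - f x) \<le> (M + e) * \<bar>s - x\<bar>" if s: "s \<in> {0..1}" "\<bar>s - x\<bar> < r" for s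
      proof -
        have "snd Y (f s - f x) \<le> snd Y ((s - x) *\<^sub>R f' x) + snd Y (f s - f x - (s - x) *\<^sub>R f' x)"
          by (rule seminormed_le_add[OF Y]) (use Y' x s in auto)
        also have "snd Y ((s - x) *\<^sub>R f' x) = \<bar>s - x\<bar> * snd Y (f' x)"
          by (rule seminormed_scale[OF Y]) (use f x in auto)
        also have "\<dots> \<le> \<bar>s - x\<bar> * M" using M[OF x] by (simp add: mult_left_mono)
        finally show ?thesis using r(2)[OF s] by (simp add: algebra_simps)
      qed
      show "\<exists>d>0. \<forall>a b. a \<le> x \<and> x \<le> b \<and> b - a < d \<longrightarrow> ?P a b"
      proof (intro exI[of _ r] conjI r allI impI)
        fix a b assume ab: "a \<le> x \<and> x \<le> b \<and> b - a < r" and b: "0 \<le> a" "a \<le> b" "b \<le> 1"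
        have "snd Y (f b - f a) \<le> snd Y (f b - f x) + snd Y (f x - f a)"
          by (rule seminormed_triangle_diff[OF Y]) (use f ab b in auto)
        also have "snd Y (f x - f a) = snd Y (f a - f x)"
          by (rule seminormed_commute[OF Y]) (use f ab b in auto)
        also have "snd Y (f b - f x) \<le> (M + e) * \<bar>b - x\<bar>" by (rule one) (use ab b in auto)
        also have "snd Y (f a - f x) \<le> (M + e) * \<bar>a - x\<bar>" by (rule one) (use ab b in auto)
        finally show "snd Y (f b - f a) \<le> (M + e) * (b - a)" using ab by (simp add: algebra_simps)
      qed
    qed simp
    then show ?thesis by simp
  qed
  then show ?thesis by (rule field_le_epsilon)
qed

lemma Ck_into_has_deriv:
  assumes "Ck_into (Suc k) Y F"
  shows "F x \<in> fst Y" "has_frechet_deriv normed_UNIV Y F (frechet_deriv normed_UNIV Y F x) x"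
  using assms by (auto intro: has_frechet_deriv_frechet_deriv)

lemma continuous_on_seminorm_Ck_into:
  fixes F :: "'a::real_normed_vector \<Rightarrow> 'b::real_vector"
  assumes Y: "seminormed Y" and F: "Ck_into 0 Y F"
  shows "continuous_on S (\<lambda>x. snd Y (F x))"
proof (rule continuous_at_imp_continuous_on, intro ballI)
  fix x
  have FY: "F z \<in> fst Y" for z using F by simp
  have lim: "((\<lambda>z. snd Y (F z - F x)) \<longlongrightarrow> 0) (at x)" using F by simp
  have "norm (snd Y (F z) - snd Y (F x)) \<le> snd Y (F z - F x)" for z
    using seminormed_le_add[OF Y FY FY, of z x] seminormed_le_add[OF Y FY FY, of x z]
      seminormed_commute[OF Y FY FY, of x z] by (simp add: abs_le_iff)
  then have "((\<lambda>z. snd Y (F z) - snd Y (F x)) \<longlongrightarrow> 0) (at x)"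
    by (intro Lim_null_comparison[OF _ lim]) auto
  then show "isCont (\<lambda>z. snd Y (F z)) x"
    unfolding isCont_def by (rule LIM_zero_cancel)
qed

lemma has_frechet_deriv_segment:
  assumes Y: "seminormed Y" and F: "\<And>z. F z \<in> fst Y"
    and D: "has_frechet_deriv normed_UNIV Y F A (x + t *\<^sub>R v)"
    and "e > 0"
  shows "\<exists>r>0. \<forall>s. \<bar>s - t\<bar> < r \<longrightarrow> snd Y (F (x + s *\<^sub>R v) - F (x + t *\<^sub>R v) - (s - t) *\<^sub>R A v) \<le> e * \<bar>s - t\<bar>"
proof -
  define e' where "e' = e / (norm v + 1)"
  have nv: "norm v + 1 > 0" by (simp add: add_nonneg_pos)
  have e': "e' > 0" "e' * norm v \<le> e" using \<open>e > 0\<close> nv by (auto simp: e'_def field_simps)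
  obtain r where r: "r > 0"
    "\<And>h. norm h < r \<Longrightarrow> snd Y (F (x + t *\<^sub>R v + h) - F (x + t *\<^sub>R v) - A h) \<le> e' * norm h"
    using has_frechet_derivD(2)[OF D e'(1)] by (auto simp: normed_UNIV_def)
  note Ab = has_frechet_derivD(1)[OF D]
  have AY: "A h \<in> fst Y" for h using bounded_linear_intoD(1)[OF Ab] by (simp add: normed_UNIV_def)
  note Y' = subspace_scale[OF seminormed_subspace[OF Y]] subspace_diff[OF seminormed_subspace[OF Y]]
  show ?thesis
  proof (intro exI[of _ "r / (norm v + 1)"] conjI allI impI)
    show "r / (norm v + 1) > 0" using r(1) nv by simp
    fix s assume "\<bar>s - t\<bar> < r / (norm v + 1)"
    then have "\<bar>s - t\<bar> * (norm v + 1) < r" using nv by (simp add: field_simps)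
    then have small: "norm ((s - t) *\<^sub>R v) < r" unfolding norm_scaleR by (simp add: algebra_simps)
    have eq: "x + t *\<^sub>R v + (s - t) *\<^sub>R v = x + s *\<^sub>R v" by (simp add: algebra_simps)
    have "snd Y (F (x + s *\<^sub>R v) - F (x + t *\<^sub>R v) - (s - t) *\<^sub>R A v)
       \<le> snd Y (F (x + s *\<^sub>R v) - F (x + t *\<^sub>R v) - A ((s - t) *\<^sub>R v))
         + snd Y (A ((s - t) *\<^sub>R v) - (s - t) *\<^sub>R A v)"
      by (rule seminormed_triangle_diff[OF Y]) (use F AY Y' in auto)
    also have "snd Y (A ((s - t) *\<^sub>R v) - (s - t) *\<^sub>R A v) = 0"
      by (rule bounded_linear_into_scale[OF seminormed_normed_UNIV Ab]) (simp add: normed_UNIV_def)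
    also have "snd Y (F (x + s *\<^sub>R v) - F (x + t *\<^sub>R v) - A ((s - t) *\<^sub>R v)) \<le> e' * norm ((s - t) *\<^sub>R v)"
      using r(2)[OF small] by (simp add: eq)
    also have "e' * norm ((s - t) *\<^sub>R v) = \<bar>s - t\<bar> * (e' * norm v)" by simp
    also have "\<dots> \<le> \<bar>s - t\<bar> * e" using e'(2) by (rule mult_left_mono) simp
    finally show "snd Y (F (x + s *\<^sub>R v) - F (x + t *\<^sub>R v) - (s - t) *\<^sub>R A v) \<le> e * \<bar>s - t\<bar>"
      by (simp add: mult.commute)
  qed
qed

text \<open>Subtracting the constant direction \<open>g\<close> is what lets the same inequality serve for Lipschitz
  bounds (\<open>g = 0\<close>) and for Taylor remainders (\<open>g\<close> the derivative at \<open>x\<close>).\<close>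

lemma seminorm_increment_bound:
  assumes Y: "seminormed Y" and F: "\<And>z. F z \<in> fst Y" and g: "g \<in> fst Y"
    and D: "\<And>z. has_frechet_deriv normed_UNIV Y F (A z) z"
    and M: "\<And>t. t \<in> {0..1} \<Longrightarrow> snd Y (A (x + t *\<^sub>R v) v - g) \<le> M"
  shows "snd Y (F (x + v) - F x - g) \<le> M"
proof -
  have AY: "A z h \<in> fst Y" for z h
    using bounded_linear_intoD(1)[OF has_frechet_derivD(1)[OF D]] by (simp add: normed_UNIV_def)
  note Y' = subspace_scale[OF seminormed_subspace[OF Y]] subspace_diff[OF seminormed_subspace[OF Y]]
  have "snd Y ((\<lambda>t. F (x + t *\<^sub>R v) - t *\<^sub>R g) 1 - (\<lambda>t. F (x + t *\<^sub>R v) - t *\<^sub>R g) 0) \<le> M"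
  proof (rule seminorm_mean_value[OF Y, where f' = "\<lambda>t. A (x + t *\<^sub>R v) v - g"])
    fix t e :: real assume "e > 0"
    from has_frechet_deriv_segment[OF Y F D this, where x = x and t = t and v = v] obtain r where r: "r > 0"
      "\<And>s. \<bar>s - t\<bar> < r \<Longrightarrow> snd Y (F (x + s *\<^sub>R v) - F (x + t *\<^sub>R v) - (s - t) *\<^sub>R A (x + t *\<^sub>R v) v) \<le> e * \<bar>s - t\<bar>"
      by blast
    have eq: "F (x + s *\<^sub>R v) - s *\<^sub>R g - (F (x + t *\<^sub>R v) - t *\<^sub>R g) - (s - t) *\<^sub>R (A (x + t *\<^sub>R v) v - g)
       = F (x + s *\<^sub>R v) - F (x + t *\<^sub>R v) - (s - t) *\<^sub>R A (x + t *\<^sub>R v) v" for s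
      by (simp add: algebra_simps)
    show "\<exists>r>0. \<forall>s\<in>{0..1}. \<bar>s - t\<bar> < r \<longrightarrow>
       snd Y (F (x + s *\<^sub>R v) - s *\<^sub>R g - (F (x + t *\<^sub>R v) - t *\<^sub>R g) - (s - t) *\<^sub>R (A (x + t *\<^sub>R v) v - g)) \<le> e * \<bar>s - t\<bar>"
      unfolding eq using r by blast
  qed (use F AY g Y' M in auto)
  then show ?thesis by (simp add: algebra_simps)
qed

text \<open>Only finitely many second derivatives matter, those in pairs of coordinate directions; each has a
  continuous seminorm and is thus bounded on the ball. They bound the increments of the first partial
  derivatives, and these in turn bound the remainder. The linear part is written
  with \<^const>\<open>param_deriv\<close>, since those vectors span the tangent space.\<close>

lemma frechet_taylor_bound:
  fixes F :: "real^'p \<Rightarrow> 'b::real_vector"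
  assumes Y: "seminormed Y" and F2: "Ck_into 2 Y F" 
  obtains C where "C \<ge> 0"
    "\<And>x y. norm x \<le> R \<Longrightarrow> norm y \<le> R \<Longrightarrow>
       snd Y (F y - F x - (\<Sum>i\<in>UNIV. (y - x) $ i *\<^sub>R param_deriv Y F i x)) \<le> C * (norm (y - x))\<^sup>2"
proof -
  note Y' = subspace_scale[OF seminormed_subspace[OF Y]] subspace_diff[OF seminormed_subspace[OF Y]]
    subspace_sum[OF seminormed_subspace[OF Y]] subspace_add[OF seminormed_subspace[OF Y]]
  have F: "F z \<in> fst Y" for z using F2 by (simp add: numeral_2_eq_2)
  obtain A where A: "\<And>z. has_frechet_deriv normed_UNIV Y F (A z) z"
    and C1: "\<And>v. Ck_into (Suc 0) Y (\<lambda>z. A z v)"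
    using F2 by (auto simp: numeral_2_eq_2)
  have "\<exists>B. (\<forall>z. has_frechet_deriv normed_UNIV Y (\<lambda>z. A z v) (B z) z) \<and> (\<forall>w. Ck_into 0 Y (\<lambda>z. B z w))" for v
    using C1[of v] unfolding Ck_into.simps(2) by blast
  then obtain B where B: "\<And>v z. has_frechet_deriv normed_UNIV Y (\<lambda>z. A z v) (B v z) z"
    and C0: "\<And>v w. Ck_into 0 Y (\<lambda>z. B v z w)"
    by metis
  have AY: "A z h \<in> fst Y" for z h
    using bounded_linear_intoD(1)[OF has_frechet_derivD(1)[OF A]] by (simp add: normed_UNIV_def)
  have BY: "B v z h \<in> fst Y" for v z h
    using bounded_linear_intoD(1)[OF has_frechet_derivD(1)[OF B]] by (simp add: normed_UNIV_def)
  have "\<exists>M\<ge>0. \<forall>z\<in>cball (0::real^'p) R. snd Y (B v z w) \<le> M" for v w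
  proof -
    have "compact ((\<lambda>z. snd Y (B v z w)) ` cball 0 R)"
      by (intro compact_continuous_image continuous_on_seminorm_Ck_into[OF Y C0] compact_cball)
    then have "bdd_above ((\<lambda>z. snd Y (B v z w)) ` cball 0 R)"
      by (intro bounded_imp_bdd_above compact_imp_bounded)
    then obtain M where "\<And>z. z \<in> cball 0 R \<Longrightarrow> snd Y (B v z w) \<le> M"
      unfolding bdd_above_def by blast
    then show ?thesis by (intro exI[of _ "max M 0"]) force
  qed
  then obtain M where M0: "\<And>v w. M v w \<ge> 0" and M: "\<And>v w z. norm z \<le> R \<Longrightarrow> snd Y (B v z w) \<le> M v w"
    by (metis mem_cball_0)
  have segment: "norm (x + t *\<^sub>R (y - x)) \<le> R"
    if "norm x \<le> R" "norm y \<le> R" "t \<in> {0..1}" for x y :: "real^'p" and t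
  proof -
    have "x + t *\<^sub>R (y - x) = (1 - t) *\<^sub>R x + t *\<^sub>R y" by (simp add: algebra_simps)
    then have "x + t *\<^sub>R (y - x) \<in> cball 0 R"
      using convexD[OF convex_cball, of x 0 R y "1 - t" t] that by auto
    then show ?thesis by simp
  qed
  \<comment> \<open>Derivatives are linear only up to seminorm zero, so expansion in coordinates is an identity of
    that kind.\<close>
  have expand: "snd Y (L h - (\<Sum>i\<in>UNIV. h $ i *\<^sub>R L (axis i 1))) = 0"
    if "bounded_linear_into normed_UNIV Y L" for L :: "real^'p \<Rightarrow> 'b" and h
    using bounded_linear_into_sum[OF seminormed_normed_UNIV Y that, of UNIV "\<lambda>i. axis i 1" "\<lambda>i. h $ i"]
    by (simp add: normed_UNIV_def basis_expansion scalar_mult_eq_scaleR[symmetric])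
  let ?e = "\<lambda>i. axis i (1::real) :: real^'p"
  define MM where "MM = (\<Sum>i\<in>UNIV. \<Sum>j\<in>UNIV. M (?e i) (?e j))"
  have lip: "snd Y (A y (?e i) - A x (?e i)) \<le> (\<Sum>j\<in>UNIV. M (?e i) (?e j)) * norm (y - x)"
    if xy: "norm x \<le> R" "norm y \<le> R" for x y i
  proof -
    have "snd Y (A (x + (y - x)) (?e i) - A x (?e i) - 0) \<le> (\<Sum>j\<in>UNIV. M (?e i) (?e j)) * norm (y - x)"
    proof (rule seminorm_increment_bound[OF Y, where F = "\<lambda>z. A z (?e i)" and A = "B (?e i)"])
      fix t :: real assume t: "t \<in> {0..1}"
      let ?z = "x + t *\<^sub>R (y - x)"
      have z: "norm ?z \<le> R" by (rule segment[OF xy t])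
      let ?s = "\<Sum>j\<in>UNIV. (y - x) $ j *\<^sub>R B (?e i) ?z (?e j)"
      have sY: "?s \<in> fst Y" by (intro Y'(3) Y'(1) BY)
      have "snd Y (B (?e i) ?z (y - x)) \<le> snd Y ?s + snd Y (B (?e i) ?z (y - x) - ?s)"
        by (rule seminormed_le_add[OF Y BY sY])
      also have "snd Y (B (?e i) ?z (y - x) - ?s) = 0"
        by (rule expand[OF has_frechet_derivD(1)[OF B]])
      also have "snd Y ?s \<le> (\<Sum>j\<in>UNIV. snd Y ((y - x) $ j *\<^sub>R B (?e i) ?z (?e j)))"
        by (rule seminormed_sum[OF Y]) (use BY Y' in auto)
      also have "\<dots> \<le> (\<Sum>j\<in>UNIV. norm (y - x) * M (?e i) (?e j))"
      proof (rule sum_mono)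
        fix j
        have "snd Y ((y - x) $ j *\<^sub>R B (?e i) ?z (?e j)) = \<bar>(y - x) $ j\<bar> * snd Y (B (?e i) ?z (?e j))"
          by (rule seminormed_scale[OF Y BY])
        also have "\<dots> \<le> norm (y - x) * M (?e i) (?e j)"
          by (intro mult_mono component_le_norm_cart M[OF z] seminormed_nonneg[OF Y BY]) auto
        finally show "snd Y ((y - x) $ j *\<^sub>R B (?e i) ?z (?e j)) \<le> norm (y - x) * M (?e i) (?e j)" .
      qed
      finally show "snd Y (B (?e i) ?z (y - x) - 0) \<le> (\<Sum>j\<in>UNIV. M (?e i) (?e j)) * norm (y - x)"
        by (simp add: sum_distrib_left sum_distrib_right mult.commute)
    qed (use AY B subspace_0[OF seminormed_subspace[OF Y]] in auto)
    then show ?thesis by simp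
  qed
  show ?thesis
  proof (rule that[of MM])
    show "MM \<ge> 0" unfolding MM_def by (intro sum_nonneg M0)
    fix x y :: "real^'p" assume xy: "norm x \<le> R" "norm y \<le> R"
    let ?D = "\<lambda>i. param_deriv Y F i x"
    have PD: "has_frechet_deriv normed_UNIV Y F (frechet_deriv normed_UNIV Y F x) x"
      by (rule has_frechet_deriv_frechet_deriv[OF A])
    have DY: "?D i \<in> fst Y" for i
      using bounded_linear_intoD(1)[OF has_frechet_derivD(1)[OF PD]] by (simp add: normed_UNIV_def param_deriv_def)
    have AD: "snd Y (A x (?e i) - ?D i) = 0" for i
      unfolding param_deriv_def
      by (rule has_frechet_deriv_unique[OF seminormed_normed_UNIV Y _ A PD]) (auto simp: F normed_UNIV_def)
    let ?g = "\<Sum>i\<in>UNIV. (y - x) $ i *\<^sub>R ?D i"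
    have gY: "?g \<in> fst Y" by (intro Y'(3) Y'(1) DY)
    have "snd Y (F (x + (y - x)) - F x - ?g) \<le> MM * (norm (y - x))\<^sup>2"
    proof (rule seminorm_increment_bound[OF Y F gY A])
      fix t :: real assume t: "t \<in> {0..1}"
      let ?z = "x + t *\<^sub>R (y - x)"
      have z: "norm ?z \<le> R" by (rule segment[OF xy t])
      let ?s = "\<Sum>i\<in>UNIV. (y - x) $ i *\<^sub>R A ?z (?e i)"
      have sY: "?s \<in> fst Y" by (intro Y'(3) Y'(1) AY)
      have "snd Y (A ?z (y - x) - ?g) \<le> snd Y (A ?z (y - x) - ?s) + snd Y (?s - ?g)"
        by (rule seminormed_triangle_diff[OF Y AY sY gY])
      also have "snd Y (A ?z (y - x) - ?s) = 0"
        by (rule expand[OF has_frechet_derivD(1)[OF A]])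
      also have "?s - ?g = (\<Sum>i\<in>UNIV. (y - x) $ i *\<^sub>R (A ?z (?e i) - ?D i))"
        by (simp add: sum_subtractf scaleR_diff_right)
      also have "snd Y \<dots> \<le> (\<Sum>i\<in>UNIV. snd Y ((y - x) $ i *\<^sub>R (A ?z (?e i) - ?D i)))"
        by (rule seminormed_sum[OF Y]) (use AY DY Y' in auto)
      also have "\<dots> \<le> (\<Sum>i\<in>UNIV. norm (y - x) * ((\<Sum>j\<in>UNIV. M (?e i) (?e j)) * norm (y - x)))"
      proof (rule sum_mono)
        fix i
        have "snd Y (A ?z (?e i) - ?D i) \<le> snd Y (A ?z (?e i) - A x (?e i)) + snd Y (A x (?e i) - ?D i)"
          by (rule seminormed_triangle_diff[OF Y AY AY DY])
        also have "\<dots> \<le> (\<Sum>j\<in>UNIV. M (?e i) (?e j)) * norm (?z - x)"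
          using lip[OF xy(1) z, of i] AD by simp
        also have "\<dots> \<le> (\<Sum>j\<in>UNIV. M (?e i) (?e j)) * norm (y - x)"
          by (rule mult_left_mono) (use t in \<open>auto intro!: sum_nonneg M0 mult_left_le_one_le\<close>)
        finally have le: "snd Y (A ?z (?e i) - ?D i) \<le> (\<Sum>j\<in>UNIV. M (?e i) (?e j)) * norm (y - x)" .
        have "snd Y ((y - x) $ i *\<^sub>R (A ?z (?e i) - ?D i)) = \<bar>(y - x) $ i\<bar> * snd Y (A ?z (?e i) - ?D i)"
          by (rule seminormed_scale[OF Y Y'(2)[OF AY DY]])
        also have "\<dots> \<le> norm (y - x) * ((\<Sum>j\<in>UNIV. M (?e i) (?e j)) * norm (y - x))"
          by (intro mult_mono component_le_norm_cart le seminormed_nonneg[OF Y Y'(2)[OF AY DY]] norm_ge_zero)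
        finally show "snd Y ((y - x) $ i *\<^sub>R (A ?z (?e i) - ?D i)) \<le> norm (y - x) * ((\<Sum>j\<in>UNIV. M (?e i) (?e j)) * norm (y - x))" .
      qed
      finally show "snd Y (A ?z (y - x) - ?g) \<le> MM * (norm (y - x))\<^sup>2"
        by (simp add: MM_def sum_distrib_left sum_distrib_right power2_eq_square mult_ac)
    qed
    then show "snd Y (F y - F x - ?g) \<le> MM * (norm (y - x))\<^sup>2" by simp
  qed
qed

section \<open>Semi-inner products\<close>

text \<open>Positive semidefinite symmetric bilinear forms. The norms of the solution spaces, the inner product
  of the residual space and the Riemannian metric are all of this kind.\<close>

definition semi_inner :: "'a::real_vector set \<Rightarrow> ('a \<Rightarrow> 'a \<Rightarrow> real) \<Rightarrow> bool" where
  "semi_inner S B \<longleftrightarrow> subspace S \<and>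
     (\<forall>x\<in>S. \<forall>y\<in>S. B x y = B y x) \<and>
     (\<forall>x\<in>S. \<forall>y\<in>S. \<forall>z\<in>S. B (x + y) z = B x z + B y z) \<and>
     (\<forall>x\<in>S. \<forall>z\<in>S. \<forall>c. B (c *\<^sub>R x) z = c * B x z) \<and>
     (\<forall>x\<in>S. 0 \<le> B x x)"

lemma semi_innerD:
  assumes "semi_inner S B"
  shows "subspace S"
    and "x \<in> S \<Longrightarrow> y \<in> S \<Longrightarrow> B x y = B y x"
    and "x \<in> S \<Longrightarrow> y \<in> S \<Longrightarrow> z \<in> S \<Longrightarrow> B (x + y) z = B x z + B y z"
    and "x \<in> S \<Longrightarrow> y \<in> S \<Longrightarrow> z \<in> S \<Longrightarrow> B z (x + y) = B z x + B z y"
    and "x \<in> S \<Longrightarrow> z \<in> S \<Longrightarrow> B (c *\<^sub>R x) z = c * B x z"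
    and "x \<in> S \<Longrightarrow> z \<in> S \<Longrightarrow> B z (c *\<^sub>R x) = c * B z x"
    and "x \<in> S \<Longrightarrow> 0 \<le> B x x"
    and "x \<in> S \<Longrightarrow> y \<in> S \<Longrightarrow> z \<in> S \<Longrightarrow> B (x - y) z = B x z - B y z"
    and "x \<in> S \<Longrightarrow> y \<in> S \<Longrightarrow> z \<in> S \<Longrightarrow> B z (x - y) = B z x - B z y"
proof -
  show S: "subspace S" and sym: "x \<in> S \<Longrightarrow> y \<in> S \<Longrightarrow> B x y = B y x"
    and add: "x \<in> S \<Longrightarrow> y \<in> S \<Longrightarrow> z \<in> S \<Longrightarrow> B (x + y) z = B x z + B y z"
    and sc: "x \<in> S \<Longrightarrow> z \<in> S \<Longrightarrow> B (c *\<^sub>R x) z = c * B x z"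
    and "x \<in> S \<Longrightarrow> 0 \<le> B x x" for x y z c
    using assms unfolding semi_inner_def by blast+
  show add': "x \<in> S \<Longrightarrow> y \<in> S \<Longrightarrow> z \<in> S \<Longrightarrow> B z (x + y) = B z x + B z y"
    using add sym subspace_add[OF S] by metis
  show "x \<in> S \<Longrightarrow> z \<in> S \<Longrightarrow> B z (c *\<^sub>R x) = c * B z x"
    using sc sym subspace_scale[OF S] by metis
  show diff: "x \<in> S \<Longrightarrow> y \<in> S \<Longrightarrow> z \<in> S \<Longrightarrow> B (x - y) z = B x z - B y z" for x y z
    using add[of x "(-1) *\<^sub>R y" z] sc[of y z "-1"] subspace_scale[OF S, of y "-1"] by simp
  show "x \<in> S \<Longrightarrow> y \<in> S \<Longrightarrow> z \<in> S \<Longrightarrow> B z (x - y) = B z x - B z y"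
    using diff sym subspace_diff[OF S] by metis
qed

lemma semi_inner_sum:
  assumes "semi_inner S B" "finite I" "\<And>i. i \<in> I \<Longrightarrow> x i \<in> S" "z \<in> S"
  shows "B (\<Sum>i\<in>I. c i *\<^sub>R x i) z = (\<Sum>i\<in>I. c i * B (x i) z)"
  using assms(2,3)
proof (induction I rule: finite_induct)
  case empty
  show ?case using semi_innerD(5)[OF assms(1) _ assms(4), of 0 0] subspace_0[OF semi_innerD(1)[OF assms(1)]] by simp
next
  case (insert i I)
  have "(\<Sum>i\<in>I. c i *\<^sub>R x i) \<in> S"
    using insert semi_innerD(1)[OF assms(1)] by (auto intro!: subspace_sum subspace_scale)
  moreover have "c i *\<^sub>R x i \<in> S" using insert semi_innerD(1)[OF assms(1)] by (auto intro!: subspace_scale)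
  ultimately show ?case
    using insert semi_innerD(3,5)[OF assms(1)] assms(4) by simp
qed

text \<open>The form may be degenerate: where \<open>B y y = 0\<close>, the quadratic in \<open>t\<close> becomes
  affine and can only stay nonnegative if its slope vanishes.\<close>

lemma semi_inner_Cauchy_Schwarz:
  assumes B: "semi_inner S B" and x: "x \<in> S" and y: "y \<in> S"
  shows "(B x y)\<^sup>2 \<le> B x x * B y y"
proof -
  note B' = semi_innerD[OF B]
  have *: "0 \<le> B x x - 2 * t * B x y + t\<^sup>2 * B y y" for t
  proof -
    have ty: "t *\<^sub>R y \<in> S" using y B'(1) by (simp add: subspace_scale)
    have "0 \<le> B (x - t *\<^sub>R y) (x - t *\<^sub>R y)" using B'(7) x ty B'(1) by (simp add: subspace_diff)
    also have "\<dots> = B x x - 2 * t * B x y + t\<^sup>2 * B y y"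
      using x y ty B'(1) B'(2)[of y x]
      by (simp add: B'(5,6,8,9) subspace_diff power2_eq_square algebra_simps)
    finally show ?thesis .
  qed
  show ?thesis
  proof (cases "B y y = 0")
    case True
    have "B x y = 0"
    proof (rule ccontr)
      assume n: "B x y \<noteq> 0"
      show False using *[of "(B x x + 1) / (2 * B x y)"] n True by (simp add: field_simps)
    qed
    then show ?thesis using True by simp
  next
    case False
    then have "B y y > 0" using B'(7)[OF y] by simp
    then show ?thesis using *[of "B x y / B y y"] by (simp add: field_simps power2_eq_square)
  qed
qed

lemma semi_inner_null:
  assumes B: "semi_inner S B" and x: "x \<in> S" and y: "y \<in> S" and "B x x = 0"
  shows "B x y = 0" "B y x = 0"
  using semi_inner_Cauchy_Schwarz[OF B x y] assms(4) semi_innerD(2)[OF B x y] by auto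

lemma semi_inner_imp_seminormed:
  assumes B: "semi_inner S B"
  shows "seminormed (S, \<lambda>x. sqrt (B x x))"
  unfolding seminormed_def fst_conv snd_conv
proof (intro conjI ballI allI)
  note B' = semi_innerD[OF B]
  show "subspace S" by fact
  fix x assume x: "x \<in> S"
  show "sqrt (B (c *\<^sub>R x) (c *\<^sub>R x)) = \<bar>c\<bar> * sqrt (B x x)" for c
    using x B'(1) by (simp add: B'(5,6) subspace_scale real_sqrt_mult flip: mult.assoc)
  fix y assume y: "y \<in> S"
  have "B x y \<le> sqrt (B x x) * sqrt (B y y)"
    using real_sqrt_le_mono[OF semi_inner_Cauchy_Schwarz[OF B x y]] by (simp add: real_sqrt_mult)
  then have "B (x + y) (x + y) \<le> (sqrt (B x x) + sqrt (B y y))\<^sup>2"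
    using x y B'(1) B'(7)[OF x] B'(7)[OF y] B'(2)[OF x y] by (simp add: B'(3,4) subspace_add power2_sum)
  then show "sqrt (B (x + y) (x + y)) \<le> sqrt (B x x) + sqrt (B y y)"
    using B'(7)[OF x] B'(7)[OF y] by (simp add: real_le_lsqrt)
qed

text \<open>A map that is linear up to null vectors pulls the form back to an exactly bilinear one, since null
  vectors are orthogonal to everything. It is applied to weak differentiation, linear only almost
  everywhere, and to the derivative of the residual, linear only up to seminorm zero.\<close>

lemma semi_inner_pullback:
  assumes B: "semi_inner S B" and S': "subspace S'" and T: "\<And>x. x \<in> S' \<Longrightarrow> T x \<in> S"
    and lin: "\<And>x y a b. x \<in> S' \<Longrightarrow> y \<in> S' \<Longrightarrow>
       B (T (a *\<^sub>R x + b *\<^sub>R y) - (a *\<^sub>R T x + b *\<^sub>R T y)) (T (a *\<^sub>R x + b *\<^sub>R y) - (a *\<^sub>R T x + b *\<^sub>R T y)) = 0"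
  shows "semi_inner S' (\<lambda>x y. B (T x) (T y))"
proof -
  note B' = semi_innerD[OF B]
  note sub = subspace_add[OF S'] subspace_scale[OF S'] T
    subspace_add[OF B'(1)] subspace_scale[OF B'(1)] subspace_diff[OF B'(1)]
  have main: "B (T (a *\<^sub>R x + b *\<^sub>R y)) (T z) = a * B (T x) (T z) + b * B (T y) (T z)"
    if xyz: "x \<in> S'" "y \<in> S'" "z \<in> S'" for x y z a b
  proof -
    have "B (T (a *\<^sub>R x + b *\<^sub>R y) - (a *\<^sub>R T x + b *\<^sub>R T y)) (T z) = 0"
      by (rule semi_inner_null(1)[OF B _ _ lin]) (use xyz sub in auto)
    then show ?thesis
      using xyz sub by (simp add: B'(3,5,8))
  qed
  show ?thesis
    unfolding semi_inner_def
    using main[of _ _ _ 1 1] main[of _ _ _ _ 0] S' T B'(2,7) by auto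
qed

lemma semi_inner_add:
  assumes "semi_inner S B" "semi_inner S C"
  shows "semi_inner S (\<lambda>x y. B x y + C x y)"
  using assms unfolding semi_inner_def by (auto simp: algebra_simps)

lemma semi_inner_sum_forms:
  assumes "finite I" "subspace S" "\<And>i. i \<in> I \<Longrightarrow> semi_inner S (B i)"
  shows "semi_inner S (\<lambda>x y. \<Sum>i\<in>I. B i x y)"
  using assms
proof (induction I rule: finite_induct)
  case empty then show ?case by (simp add: semi_inner_def)
next
  case (insert i I) then show ?case using semi_inner_add by auto
qed

text \<open>The remainder of half the square is half the square of the increment, hence superlinear.\<close>

lemma has_frechet_deriv_half_square:
  assumes B: "semi_inner S B"
    and y: "y \<in> S"
  shows "has_frechet_deriv (S, \<lambda>k. sqrt (B k k)) normed_UNIV (\<lambda>y. 1/2 * B y y) (B y) y"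
  unfolding has_frechet_deriv_def bounded_linear_into_def fst_conv snd_conv
proof (intro conjI ballI allI impI exI)
  note B' = semi_innerD[OF B]
  show "B y k \<in> fst normed_UNIV" for k by (simp add: normed_UNIV_def)
  show "snd normed_UNIV (B y (a *\<^sub>R k + b *\<^sub>R l) - (a *\<^sub>R B y k + b *\<^sub>R B y l)) = 0"
    if "k \<in> S" "l \<in> S" for k l a b
    using that y B'(1) by (simp add: normed_UNIV_def B'(4,6) subspace_scale)
  show "snd normed_UNIV (B y k) \<le> sqrt (B y y) * sqrt (B k k)" if "k \<in> S" for k
    using real_sqrt_le_mono[OF semi_inner_Cauchy_Schwarz[OF B y that]] by (simp add: normed_UNIV_def real_sqrt_mult)
  fix e :: real assume e: "e > 0"
  then show "2 * e > 0" by simp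
  fix k assume k: "k \<in> S" and small: "sqrt (B k k) < 2 * e"
  have "1/2 * B (y + k) (y + k) - 1/2 * B y y - B y k = 1/2 * B k k"
    using k y B'(1) B'(2)[OF y k] by (simp add: B'(3,4) subspace_add field_simps)
  moreover have "B k k = sqrt (B k k) * sqrt (B k k)" using B'(7)[OF k] by simp
  moreover have "sqrt (B k k) * sqrt (B k k) \<le> (2 * e) * sqrt (B k k)"
    using small B'(7)[OF k] by (intro mult_right_mono) auto
  ultimately show "snd normed_UNIV (1/2 * B (y + k) (y + k) - 1/2 * B y y - B y k) \<le> e * sqrt (B k k)"
    using B'(7)[OF k] by (simp add: normed_UNIV_def)
qed

section \<open>The pseudoinverse and projection by Gram matrices\<close>

text \<open>If \<open>Q\<close> projects onto the orthogonal complement of the range of \<open>G\<close>, which for symmetric \<open>G\<close> is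
  its kernel, then \<open>G + Q\<close> is invertible and \<open>(G + Q)\<^sup>-\<^sup>1 - Q\<close> inverts \<open>G\<close> on its range.\<close>

lemma exists_penrose_inverse_symmetric:
  fixes G :: "real^'n^'n"
  assumes sym: "transpose G = G"
  shows "\<exists>X. G ** X ** G = G \<and> X ** G ** X = X \<and> transpose (G ** X) = G ** X \<and> transpose (X ** G) = X ** G"
proof -
  have self: "(G *v x) \<bullet> y = x \<bullet> (G *v y)" for x y
    by (metis dot_lmul_matrix sym transpose_matrix_vector)
  define S where "S = range (\<lambda>x. G *v x)"
  have S: "subspace S" unfolding S_def
    by (rule linear_subspace_image[OF matrix_vector_mul_linear subspace_UNIV])
  obtain B where B: "B \<subseteq> S" "pairwise orthogonal B" "\<And>x. x \<in> B \<Longrightarrow> norm x = 1" "independent B" "span B = S"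
    using orthonormal_basis_subspace[OF S] by metis
  have finB: "finite B" using B(4) by (rule independent_imp_finite)
  define p where "p x = (\<Sum>b\<in>B. (x \<bullet> b) *\<^sub>R b)" for x
  have linp: "linear p"
    by (rule linearI) (auto simp: p_def inner_add_left scaleR_add_left sum.distrib scaleR_sum_right)
  have pS: "p x \<in> S" for x
    unfolding p_def by (intro subspace_sum subspace_scale S) (use B(1) in auto)
  have pb: "p b = b" if "b \<in> B" for b
  proof -
    have "p b = (\<Sum>c\<in>B. if c = b then b else 0)"
      unfolding p_def
    proof (rule sum.cong[OF refl])
      fix c assume c: "c \<in> B"
      show "(b \<bullet> c) *\<^sub>R c = (if c = b then b else 0)"
        using B(2)[unfolded pairwise_def orthogonal_def] B(3)[OF that] that c by (auto simp: norm_eq_1)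
    qed
    then show ?thesis using finB that by simp
  qed
  have pid: "p x = x" if "x \<in> S" for x
    using that unfolding B(5)[symmetric]
    by (induction rule: span_induct_alt) (auto simp: linear_0[OF linp] linear_add[OF linp] linear_cmul[OF linp] pb)
  have pself: "p x \<bullet> y = x \<bullet> p y" for x y
    by (simp add: p_def inner_sum_left inner_sum_right mult.commute inner_commute)
  define Pm where "Pm = matrix p"
  have Pv: "Pm *v x = p x" for x unfolding Pm_def by (rule matrix_works) (use linp in \<open>simp add: linear_matrix_vector_mul_eq\<close>)
  have PG: "Pm ** G = G"
    unfolding matrix_eq by (simp add: Pv S_def pid flip: matrix_vector_mul_assoc)
  have eqI: "A = C" if "\<And>x y. (A *v x) \<bullet> y = (C *v x) \<bullet> y" for A C :: "real^'n^'n"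
    unfolding matrix_eq using that by (metis vector_eq_rdot)
  have GP: "G ** Pm = G"
  proof (rule eqI)
    fix x y
    have "(G ** Pm *v x) \<bullet> y = p x \<bullet> (G *v y)" by (simp add: Pv self flip: matrix_vector_mul_assoc)
    also have "\<dots> = x \<bullet> (G *v y)" unfolding pself by (subst pid) (auto simp: S_def)
    finally show "(G ** Pm *v x) \<bullet> y = (G *v x) \<bullet> y" by (simp add: self)
  qed
  have PP: "Pm ** Pm = Pm"
    unfolding matrix_eq by (simp add: Pv pid pS flip: matrix_vector_mul_assoc)
  have Psym: "transpose Pm = Pm"
  proof (rule eqI)
    fix x y show "(transpose Pm *v x) \<bullet> y = (Pm *v x) \<bullet> y"
      by (metis Pv dot_lmul_matrix pself transpose_matrix_vector inner_commute)
  qed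
  define Q where "Q = mat 1 - Pm"
  have dl: "(A - C) ** D = A ** D - C ** D" and dr: "D ** (A - C) = D ** A - D ** C"
    and al: "(A + C) ** D = A ** D + C ** D" and ar: "D ** (A + C) = D ** A + D ** C" for A C D :: "real^'n^'n"
    by (auto simp: matrix_matrix_mult_def vec_eq_iff algebra_simps sum.distrib sum_subtractf)
  have Q: "Q ** Q = Q" "Q ** G = 0" "G ** Q = 0"
    by (simp_all add: Q_def dl dr PP PG GP)
  \<comment> \<open>A kernel vector of \<open>M\<close> is killed by \<open>Q\<close>, hence in the range of \<open>G\<close>, and killed by \<open>G\<close>, hence
    orthogonal to that range.\<close>
  define M where "M = G + Q"
  have "x = 0" if x: "M *v x = 0" for x
  proof -
    have "Q *v (M *v x) = 0" using x by simp
    then have Qx: "Q *v x = 0" by (simp add: matrix_vector_mul_assoc M_def ar Q)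
    then have px: "p x = x" by (simp add: Q_def matrix_vector_mult_diff_rdistrib Pv)
    have "G *v x = 0" using x Qx by (simp add: M_def matrix_vector_mult_add_rdistrib)
    then have "x \<bullet> (G *v y) = 0" for y by (simp add: self[symmetric])
    then have "x \<bullet> s = 0" if "s \<in> S" for s using that by (auto simp: S_def)
    then show "x = 0" using pS[of x] px by force
  qed
  then obtain N where N: "N ** M = mat 1"
    using matrix_left_invertible_ker[of M] by auto
  then have N': "M ** N = mat 1" by (simp add: matrix_left_right_inverse)
  have "N ** (M ** Q) = Q" by (simp add: matrix_mul_assoc N)
  then have NQ: "N ** Q = Q" by (simp add: M_def al Q)
  have "(Q ** M) ** N = Q" by (simp add: N' flip: matrix_mul_assoc)
  then have QN: "Q ** N = Q" by (simp add: M_def ar Q)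
  have "(M - Q) ** N = mat 1 - Q" "N ** (M - Q) = mat 1 - Q" by (simp_all add: dl dr N N' NQ QN)
  then have GN: "G ** N = Pm" and NG: "N ** G = Pm" by (simp_all add: M_def Q_def)
  have PN: "Pm ** N = N - Q" using QN by (simp add: Q_def dl algebra_simps)
  have PQ: "Pm ** Q = 0" by (simp add: Q_def dr PP)
  show ?thesis
    by (rule exI[of _ "N - Q"]) (simp add: dl dr GN NG Q PG PN PQ Psym)
qed

lemma penrose_unique:
  fixes A :: "real^'n^'m"
  assumes "A ** X ** A = A" "X ** A ** X = X" "transpose (A ** X) = A ** X" "transpose (X ** A) = X ** A"
    and "A ** Y ** A = A" "Y ** A ** Y = Y" "transpose (A ** Y) = A ** Y" "transpose (Y ** A) = Y ** A"
  shows "X = Y"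
proof -
  have "A ** X = (A ** Y) ** (A ** X)" using assms(5) by (simp add: matrix_mul_assoc)
  also have "\<dots> = transpose (A ** Y) ** transpose (A ** X)" by (simp add: assms)
  also have "\<dots> = transpose (A ** X ** A ** Y)" by (simp add: matrix_transpose_mul matrix_mul_assoc)
  also have "\<dots> = A ** Y" using assms by (simp add: matrix_mul_assoc)
  finally have 1: "A ** X = A ** Y" .
  have "X ** A = (X ** A) ** (Y ** A)" using assms(5) by (simp add: matrix_mul_assoc[symmetric])
  also have "\<dots> = transpose (X ** A) ** transpose (Y ** A)" by (simp add: assms)
  also have "\<dots> = transpose (Y ** (A ** X ** A))" by (simp add: matrix_transpose_mul matrix_mul_assoc)
  also have "\<dots> = Y ** A" using assms by simp
  finally have 2: "X ** A = Y ** A" .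
  have "X = X ** A ** X" using assms(2) by simp
  also have "\<dots> = Y ** (A ** X)" using 2 by (simp add: matrix_mul_assoc)
  also have "\<dots> = Y" using 1 assms(6) by (simp add: matrix_mul_assoc)
  finally show ?thesis .
qed

lemma symmetric_mult_pinv_mult:
  fixes G :: "real^'n^'n"
  assumes "transpose G = G"
  shows "G ** pinv G ** G = G"
proof -
  have "\<exists>!X. G ** X ** G = G \<and> X ** G ** X = X \<and> transpose (G ** X) = G ** X \<and> transpose (X ** G) = X ** G"
    using exists_penrose_inverse_symmetric[OF assms] penrose_unique[of G] by metis
  from theI'[OF this] show ?thesis unfolding pinv_def by blast
qed

text \<open>A right-hand side orthogonal to the kernel of a symmetric matrix lies in its range, and there
  \<open>G G\<^sup>\<dagger>\<close> acts as the identity.\<close>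

lemma pinv_solves_if_orthogonal_to_kernel:
  fixes G :: "real^'n^'n"
  assumes sym: "transpose G = G" and b: "\<And>c. G *v c = 0 \<Longrightarrow> c \<bullet> b = 0"
  shows "G *v (pinv G *v b) = b"
proof -
  have self: "(G *v x) \<bullet> y = x \<bullet> (G *v y)" for x y
    by (metis dot_lmul_matrix sym transpose_matrix_vector)
  obtain y z where y: "y \<in> span (range (\<lambda>x. G *v x))" and z: "\<And>w. w \<in> span (range (\<lambda>x. G *v x)) \<Longrightarrow> orthogonal z w"
    and eq: "b = y + z"
    using orthogonal_subspace_decomp_exists by blast
  have sp: "span (range (\<lambda>x. G *v x)) = range (\<lambda>x. G *v x)"
    by (simp add: span_eq_iff linear_subspace_image[OF matrix_vector_mul_linear subspace_UNIV])
  have "(G *v z) \<bullet> x = 0" for x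
    using z[of "G *v x"] by (simp add: sp self orthogonal_def)
  then have "G *v z = 0" by (metis inner_eq_zero_iff)
  then have "z \<bullet> b = 0" by (rule b)
  moreover have "z \<bullet> y = 0" using z[OF y] by (simp add: orthogonal_def)
  ultimately have "z = 0" by (simp add: eq inner_add_right)
  then obtain c where "b = G *v c" using y eq sp by auto
  then show ?thesis using symmetric_mult_pinv_mult[OF sym] by (simp add: matrix_vector_mul_assoc matrix_mul_assoc)
qed

text \<open>The orthogonality relations for \<open>d - v\<close> are the normal equations \<open>G c = b\<close>. The vectors \<open>e r\<close> may be
  linearly dependent or null, so \<open>G\<close> need not be invertible; but \<open>b\<close> is orthogonal to its kernel by
  Cauchy-Schwarz.\<close>

lemma gram_projection:
  fixes e :: "'r::finite \<Rightarrow> 'a::real_vector"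
  assumes B: "semi_inner S B" and e: "\<And>r. e r \<in> S" and d: "d \<in> S"
    and "G = (\<chi> r s. B (e r) (e s))" and b: "b = (\<chi> r. B d (e r))"
    and v: "v = (\<Sum>r\<in>UNIV. (pinv G *v b) $ r *\<^sub>R e r)"
  shows "v \<in> span (range e)" and "s \<in> span (range e) \<Longrightarrow> B (d - v) s = 0"
proof -
  note B' = semi_innerD[OF B]
  have G: "G $ r $ s = B (e r) (e s)" for r s by (simp add: assms)
  have lin: "(\<Sum>r\<in>UNIV. c $ r *\<^sub>R e r) \<in> S" for c :: "real^'r"
    using e B'(1) by (intro subspace_sum subspace_scale)
  have Gc: "(G *v c) $ r = B (\<Sum>s\<in>UNIV. c $ s *\<^sub>R e s) (e r)" for c r
    using e by (simp add: semi_inner_sum[OF B] matrix_vector_mult_def G B'(2)[OF e e, of r] mult.commute)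
  have sym: "transpose G = G"
    by (simp add: transpose_def vec_eq_iff G B'(2)[OF e e])
  have "c \<bullet> b = 0" if c: "G *v c = 0" for c
  proof -
    let ?x = "\<Sum>r\<in>UNIV. c $ r *\<^sub>R e r"
    have "B ?x ?x = (\<Sum>r\<in>UNIV. c $ r * B (e r) ?x)"
      using e lin by (intro semi_inner_sum[OF B]) auto
    also have "\<dots> = (\<Sum>r\<in>UNIV. c $ r * (G *v c) $ r)"
      by (simp add: Gc B'(2)[OF e lin])
    finally have "B ?x ?x = 0" using c by simp
    then have "B ?x d = 0" by (rule semi_inner_null(1)[OF B lin d])
    moreover have "B ?x d = (\<Sum>r\<in>UNIV. c $ r * B (e r) d)"
      using e d by (intro semi_inner_sum[OF B]) auto
    ultimately show ?thesis by (simp add: inner_vec_def b B'(2)[OF d e])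
  qed
  from pinv_solves_if_orthogonal_to_kernel[OF sym this] have "G *v (pinv G *v b) = b" .
  then have "B v (e r) = B d (e r)" for r
    using Gc[of "pinv G *v b" r] by (simp add: v b)
  then have orth: "B (d - v) (e r) = 0" for r
    using B'(8)[OF d _ e, of v] lin v by simp
  show "v \<in> span (range e)"
    unfolding v by (intro span_sum span_scale span_base) auto
  have dv: "d - v \<in> S" using d lin v B'(1) by (auto intro: subspace_diff)
  assume "s \<in> span (range e)"
  then have "s \<in> S \<and> B (d - v) s = 0"
  proof (induction rule: span_induct_alt)
    case base
    show ?case using B'(6)[OF _ dv, of 0 0] subspace_0[OF B'(1)] by simp
  next
    case (step c x y)
    then obtain r where "x = e r" by auto
    then show ?case using step e dv orth B'(1) by (simp add: B'(4,6) subspace_add subspace_scale)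
  qed
  then show "B (d - v) s = 0" by simp
qed

section \<open>Slices of Lebesgue measurable functions\<close>

lemma borel_Times:
  fixes A :: "'a::euclidean_space set" and B :: "'b::euclidean_space set"
  assumes "A \<in> sets borel" "B \<in> sets borel"
  shows "A \<times> B \<in> sets borel"
  using pair_measureI[OF assms] unfolding borel_prod .

lemma AE_lebesgue_on_iff:
  assumes "S \<in> sets borel"
  shows "(AE x in lebesgue_on S. Q x) \<longleftrightarrow> (AE x in lborel. x \<in> S \<longrightarrow> Q x)"
  using assms by (subst AE_restrict_space_iff) (auto simp: AE_completion_iff)

text \<open>Fubini for null sets: the exceptional set is enlarged to a Borel null set, for which both iterated
  statements are available.\<close>

lemma AE_lborel_slices:
  fixes Q :: "'a::euclidean_space \<times> 'b::euclidean_space \<Rightarrow> bool"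
  assumes "AE z in lborel. Q z"
  shows "AE x in lborel. AE y in lborel. Q (x, y)" and "AE y in lborel. AE x in lborel. Q (x, y)"
proof -
  obtain N where N: "{z. \<not> Q z} \<subseteq> N" "N \<in> null_sets lborel"
    using assms by (auto elim!: AE_E simp: null_sets_def)
  have "- N \<in> sets lborel"
    using sets.compl_sets[OF null_setsD2[OF N(2)]] by (simp add: Compl_eq_Diff_UNIV)
  then have Nm: "{z \<in> space (lborel \<Otimes>\<^sub>M lborel). (fst z, snd z) \<notin> N} \<in> sets (lborel \<Otimes>\<^sub>M lborel)"
    unfolding lborel_prod by (simp add: Compl_eq)
  have "AE z in lborel \<Otimes>\<^sub>M lborel. z \<notin> N"
    unfolding lborel_prod using AE_not_in[OF N(2)] .
  then have 1: "AE x in lborel. AE y in lborel. (x, y) \<notin> N"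
    by (rule lborel_pair.AE_pair)
  then have 2: "AE y in lborel. AE x in lborel. (x, y) \<notin> N"
    using lborel_pair.AE_commute[OF Nm] by simp
  show "AE x in lborel. AE y in lborel. Q (x, y)"
    using 1 N(1) by (auto elim!: eventually_mono)
  show "AE y in lborel. AE x in lborel. Q (x, y)"
    using 2 N(1) by (auto elim!: eventually_mono)
qed

lemma AE_lebesgue_on_slices:
  fixes A :: "'a::euclidean_space set" and B :: "'b::euclidean_space set"
  assumes A: "A \<in> sets borel" and B: "B \<in> sets borel" and Q: "AE z in lebesgue_on (A \<times> B). Q z"
  shows "AE x in lebesgue_on A. AE y in lebesgue_on B. Q (x, y)"
    and "AE y in lebesgue_on B. AE x in lebesgue_on A. Q (x, y)"
proof -
  have "AE z in lborel. z \<in> A \<times> B \<longrightarrow> Q z"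
    using Q by (simp add: AE_lebesgue_on_iff borel_Times A B)
  note * = AE_lborel_slices[OF this]
  show "AE x in lebesgue_on A. AE y in lebesgue_on B. Q (x, y)"
    using *(1) by (auto simp: AE_lebesgue_on_iff A B elim!: eventually_mono)
  show "AE y in lebesgue_on B. AE x in lebesgue_on A. Q (x, y)"
    using *(2) by (auto simp: AE_lebesgue_on_iff A B elim!: eventually_mono)
qed

text \<open>Product measure theory is about Borel functions, while slices of a Lebesgue measurable function are
  measurable only for almost every parameter; passing to a Borel version bridges the two.\<close>

lemma lebesgue_borel_version:
  fixes f :: "'a::euclidean_space \<Rightarrow> 'b::euclidean_space"
  assumes "f \<in> borel_measurable lebesgue"
  obtains g where "g \<in> borel_measurable borel" "AE x in lborel. f x = g x"
proof -
  have "\<forall>b. \<exists>g'\<in>borel_measurable lborel. AE x in lborel. f x \<bullet> b = g' x"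
    using assms by (intro allI completion_ex_borel_measurable_real) simp
  then obtain g' where g': "\<And>b. g' b \<in> borel_measurable lborel" "\<And>b. AE x in lborel. f x \<bullet> b = g' b x"
    by metis
  have m: "g' b \<in> borel_measurable borel" for b using g'(1)[of b] by simp
  show ?thesis
  proof (rule that)
    show "(\<lambda>x. \<Sum>b\<in>Basis. g' b x *\<^sub>R b) \<in> borel_measurable borel"
      using m by measurable
    have "AE x in lborel. \<forall>b\<in>Basis. f x \<bullet> b = g' b x"
      using g'(2) by (intro AE_finite_allI) auto
    then show "AE x in lborel. f x = (\<Sum>b\<in>Basis. g' b x *\<^sub>R b)"
    proof eventually_elim
      case (elim x)
      have "f x = (\<Sum>b\<in>Basis. (f x \<bullet> b) *\<^sub>R b)" by (simp add: euclidean_representation)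
      also have "\<dots> = (\<Sum>b\<in>Basis. g' b x *\<^sub>R b)" using elim by simp
      finally show ?case .
    qed
  qed
qed

lemma integrable_lebesgue_AE_iff:
  fixes f :: "'a::euclidean_space \<Rightarrow> 'b::euclidean_space"
  assumes "g \<in> borel_measurable borel" "AE x in lborel. f x = g x"
  shows "integrable lebesgue f \<longleftrightarrow> integrable lborel g"
    and "integral\<^sup>L lebesgue f = integral\<^sup>L lborel g"
proof -
  have gm: "g \<in> borel_measurable lborel" using assms(1) by simp
  have g: "g \<in> borel_measurable lebesgue" using gm by (rule measurable_completion)
  have ae: "AE x in lebesgue. g x = f x"
    using assms(2) unfolding AE_completion_iff by (auto elim!: eventually_mono)
  have f: "f \<in> borel_measurable lebesgue" by (rule borel_measurable_AE[OF g ae])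
  show "integrable lebesgue f \<longleftrightarrow> integrable lborel g"
    using integrable_cong_AE[OF g f ae] integrable_completion[OF gm] by simp
  show "integral\<^sup>L lebesgue f = integral\<^sup>L lborel g"
    using integral_cong_AE[OF g f ae] integral_completion[OF gm] by simp
qed

lemma integrable_lebesgue_on_slices:
  fixes f :: "'a::euclidean_space \<times> 'b::euclidean_space \<Rightarrow> 'c::euclidean_space"
  assumes A: "A \<in> sets borel" and B: "B \<in> sets borel" and f: "integrable (lebesgue_on (A \<times> B)) f"
  shows "AE x in lebesgue_on A. integrable (lebesgue_on B) (\<lambda>y. f (x, y))"
    and "AE y in lebesgue_on B. integrable (lebesgue_on A) (\<lambda>x. f (x, y))"
proof -
  let ?F = "\<lambda>z. indicator (A \<times> B) z *\<^sub>R f z"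
  have AB: "A \<times> B \<in> sets lebesgue" "A \<in> sets lebesgue" "B \<in> sets lebesgue"
    using borel_Times[OF A B] A B by auto
  have F: "integrable lebesgue ?F" using f AB by (subst (asm) integrable_restrict_space) auto
  obtain g where g: "g \<in> borel_measurable borel" "AE x in lborel. ?F x = g x"
    using lebesgue_borel_version[OF borel_measurable_integrable[OF F]] by blast
  have gi: "integrable (lborel \<Otimes>\<^sub>M lborel) g"
    using integrable_lebesgue_AE_iff(1)[OF g] F by (simp add: lborel_prod)
  have gs: "(\<lambda>y. g (x, y)) \<in> borel_measurable borel" "(\<lambda>x. g (x, y)) \<in> borel_measurable borel" for x y
    using g(1) by measurable
  have "AE x in lborel. integrable lborel (\<lambda>y. g (x, y))"
    by (rule lborel_pair.AE_integrable_fst'[OF gi])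
  with AE_lborel_slices(1)[OF g(2)] have "AE x in lborel. x \<in> A \<longrightarrow> integrable (lebesgue_on B) (\<lambda>y. f (x, y))"
  proof eventually_elim
    case (elim x)
    have "integrable lebesgue (\<lambda>y. ?F (x, y))"
      using integrable_lebesgue_AE_iff(1)[OF gs(1), of "\<lambda>y. ?F (x, y)" x] elim by simp
    moreover have "(\<lambda>y. ?F (x, y)) = (\<lambda>y. indicator B y *\<^sub>R f (x, y))" if "x \<in> A"
      using that by (auto simp: indicator_def)
    ultimately show ?case by (intro impI, subst integrable_restrict_space) (use AB in auto)
  qed
  then show "AE x in lebesgue_on A. integrable (lebesgue_on B) (\<lambda>y. f (x, y))"
    by (simp add: AE_lebesgue_on_iff A)
  have "AE y in lborel. integrable lborel (\<lambda>x. g (x, y))"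
    by (rule lborel_pair.AE_integrable_snd) (use gi in simp)
  with AE_lborel_slices(2)[OF g(2)] have "AE y in lborel. y \<in> B \<longrightarrow> integrable (lebesgue_on A) (\<lambda>x. f (x, y))"
  proof eventually_elim
    case (elim y)
    have "integrable lebesgue (\<lambda>x. ?F (x, y))"
      using integrable_lebesgue_AE_iff(1)[OF gs(2), of "\<lambda>x. ?F (x, y)" y] elim by simp
    moreover have "(\<lambda>x. ?F (x, y)) = (\<lambda>x. indicator A x *\<^sub>R f (x, y))" if "y \<in> B"
      using that by (auto simp: indicator_def)
    ultimately show ?case by (intro impI, subst integrable_restrict_space) (use AB in auto)
  qed
  then show "AE y in lebesgue_on B. integrable (lebesgue_on A) (\<lambda>x. f (x, y))"
    by (simp add: AE_lebesgue_on_iff B)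
qed

text \<open>A set whose slices are null need not be measurable; joint measurability of \<open>f\<close> is what permits the
  return from slices to the product.\<close>

lemma lebesgue_on_zero_from_slices:
  fixes f :: "'a::euclidean_space \<times> 'b::euclidean_space \<Rightarrow> 'c::euclidean_space"
  assumes A: "A \<in> sets borel" and B: "B \<in> sets borel" and f: "f \<in> borel_measurable (lebesgue_on (A \<times> B))"
    and ae: "(AE x in lebesgue_on A. AE y in lebesgue_on B. f (x, y) = 0) \<or>
             (AE y in lebesgue_on B. AE x in lebesgue_on A. f (x, y) = 0)"
  shows "AE z in lebesgue_on (A \<times> B). f z = 0"
proof -
  let ?F = "\<lambda>z. indicator (A \<times> B) z *\<^sub>R f z"
  have AB: "A \<times> B \<in> sets borel" "A \<times> B \<in> sets lebesgue"
    using borel_Times[OF A B] by auto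
  have F: "?F \<in> borel_measurable lebesgue"
    using borel_measurable_if_I[OF f AB(2)] unfolding indicator_scaleR_eq_if .
  obtain g where g: "g \<in> borel_measurable borel" "AE x in lborel. ?F x = g x"
    using lebesgue_borel_version[OF F] by blast
  have gm: "{z\<in>space (lborel \<Otimes>\<^sub>M lborel). g z = 0} \<in> sets (lborel \<Otimes>\<^sub>M lborel)"
    using g(1) unfolding lborel_prod by measurable
  have "AE x in lborel. AE y in lborel. g (x, y) = 0"
    using ae
  proof
    assume "AE x in lebesgue_on A. AE y in lebesgue_on B. f (x, y) = 0"
    then have "AE x in lborel. x \<in> A \<longrightarrow> (AE y in lborel. y \<in> B \<longrightarrow> f (x, y) = 0)"
      by (simp add: AE_lebesgue_on_iff A B)
    with AE_lborel_slices(1)[OF g(2)] show ?thesis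
    proof eventually_elim
      case (elim x)
      have "AE y in lborel. x \<in> A \<longrightarrow> y \<in> B \<longrightarrow> f (x, y) = 0"
        using elim(2) by (cases "x \<in> A") auto
      with elim(1) show ?case by eventually_elim (auto simp: indicator_def split: if_splits)
    qed
  next
    assume "AE y in lebesgue_on B. AE x in lebesgue_on A. f (x, y) = 0"
    then have "AE y in lborel. y \<in> B \<longrightarrow> (AE x in lborel. x \<in> A \<longrightarrow> f (x, y) = 0)"
      by (simp add: AE_lebesgue_on_iff A B)
    with AE_lborel_slices(2)[OF g(2)] have "AE y in lborel. AE x in lborel. g (x, y) = 0"
    proof eventually_elim
      case (elim y)
      have "AE x in lborel. y \<in> B \<longrightarrow> x \<in> A \<longrightarrow> f (x, y) = 0"
        using elim(2) by (cases "y \<in> B") auto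
      with elim(1) show ?case by eventually_elim (auto simp: indicator_def split: if_splits)
    qed
    then show ?thesis using lborel_pair.AE_commute[of "\<lambda>x y. g (x, y) = 0"] gm by simp
  qed
  then have "AE z in lborel \<Otimes>\<^sub>M lborel. g z = 0"
    by (rule lborel_pair.AE_pair_measure[OF gm])
  then have "AE z in lborel. g z = 0" unfolding lborel_prod .
  with g(2) have "AE z in lborel. z \<in> A \<times> B \<longrightarrow> f z = 0"
    by eventually_elim auto
  then show ?thesis by (simp add: AE_lebesgue_on_iff AB)
qed

section \<open>Test functions and the fundamental lemma\<close>

lemma C1_compose:
  assumes "C1 \<phi>" and g: "\<And>x. (g has_real_derivative g' (\<phi> x)) (at (\<phi> x))"
    and c: "continuous_on UNIV (\<lambda>x. g' (\<phi> x))"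
  shows "C1 (\<lambda>x. g (\<phi> x))"
proof -
  obtain \<phi>' where d: "\<And>x. (\<phi> has_derivative \<phi>' x) (at x)" "\<And>v. continuous_on UNIV (\<lambda>x. \<phi>' x v)"
    using assms(1) by (auto simp: C1_def)
  show ?thesis
    unfolding C1_def
  proof (intro exI[of _ "\<lambda>x v. \<phi>' x v *\<^sub>R g' (\<phi> x)"] conjI allI)
    fix x
    have "(g has_derivative (\<lambda>h. h * g' (\<phi> x))) (at (\<phi> x))"
      using g[of x] unfolding has_field_derivative_def by (simp only: mult_commute_abs)
    from has_derivative_compose[OF d(1) this]
    show "((\<lambda>x. g (\<phi> x)) has_derivative (\<lambda>v. \<phi>' x v *\<^sub>R g' (\<phi> x))) (at x)" by simp
    show "continuous_on UNIV (\<lambda>x. \<phi>' x v *\<^sub>R g' (\<phi> x))" for v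
      by (intro continuous_intros d c)
  qed
qed

lemma C1_add:
  assumes "C1 f" "C1 g" shows "C1 (\<lambda>x. f x + g x)"
proof -
  obtain f' g' where "\<And>x. (f has_derivative f' x) (at x)" "\<And>v. continuous_on UNIV (\<lambda>x. f' x v)"
    "\<And>x. (g has_derivative g' x) (at x)" "\<And>v. continuous_on UNIV (\<lambda>x. g' x v)"
    using assms by (auto simp: C1_def)
  then show ?thesis
    unfolding C1_def
    by (intro exI[of _ "\<lambda>x v. f' x v + g' x v"] conjI allI has_derivative_add continuous_intros) auto
qed

lemma C1_imp_continuous: "C1 f \<Longrightarrow> continuous_on S f"
  unfolding C1_def by (meson continuous_at_imp_continuous_on has_derivative_continuous)

text \<open>Squaring the positive part removes its kink at 0, which gives continuously differentiable bumps.\<close>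

lemma pos_part_square_deriv:
  "((\<lambda>s::real. (max 0 s)\<^sup>2) has_real_derivative 2 * max 0 s) (at s)"
proof -
  consider "s > 0" | "s < 0" | "s = 0" by linarith
  then show ?thesis
  proof cases
    case 1
    have "((\<lambda>s::real. s\<^sup>2) has_real_derivative 2 * max 0 s) (at s)"
      using 1 by (auto intro!: derivative_eq_intros)
    then show ?thesis
      by (rule has_field_derivative_transform_within_open[where S = "{0<..}"]) (use 1 in auto)
  next
    case 2
    have "((\<lambda>s::real. 0) has_real_derivative 2 * max 0 s) (at s)"
      using 2 by simp
    then show ?thesis
      by (rule has_field_derivative_transform_within_open[where S = "{..<0}"]) (use 2 in auto)
  next
    case 3
    have "((\<lambda>h. (max 0 h)\<^sup>2 / h) \<longlongrightarrow> 0) (at (0::real))"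
    proof (rule Lim_null_comparison)
      show "((\<lambda>h. \<bar>h\<bar>) \<longlongrightarrow> 0) (at (0::real))" by (auto intro!: tendsto_eq_intros)
      show "\<forall>\<^sub>F h in at (0::real). norm ((max 0 h)\<^sup>2 / h) \<le> \<bar>h\<bar>"
        by (auto simp: eventually_at_filter max_def power2_eq_square)
    qed
    then show ?thesis using 3 by (simp add: DERIV_def)
  qed
qed

text \<open>For positive radii, positive exactly on the union of the open balls in the list. Lists of balls are used so that
  countably many balls yield countably many bumps.\<close>

definition ball_bump :: "('a::euclidean_space \<times> real) list \<Rightarrow> 'a \<Rightarrow> real" where
  "ball_bump L x = (\<Sum>(c, r)\<leftarrow>L. (max 0 (r\<^sup>2 - (norm (x - c))\<^sup>2))\<^sup>2)"

text \<open>The map \<open>s \<mapsto> n s / (1 + n s)\<close> sends 0 to 0 and pushes positive values towards 1, so that for large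
  \<open>n\<close> these functions approximate the indicator of the union of the balls.\<close>

definition ball_cutoff :: "('a::euclidean_space \<times> real) list \<Rightarrow> nat \<Rightarrow> 'a \<Rightarrow> real" where
  "ball_cutoff L n x = n * ball_bump L x / (1 + n * ball_bump L x)"

lemma ball_bump_nonneg: "ball_bump L x \<ge> 0"
  unfolding ball_bump_def by (rule sum_list_nonneg) auto

lemma C1_ball_bump: "C1 (ball_bump L)"
proof (induction L)
  case Nil
  have "ball_bump [] = (\<lambda>x::'a. 0)" by (simp add: ball_bump_def fun_eq_iff)
  then show ?case unfolding C1_def by (auto intro!: exI[of _ "\<lambda>x v. 0"])
next
  case (Cons a L)
  obtain c r where a: "a = (c, r)" by force
  have "C1 (\<lambda>x::'a. r\<^sup>2 - (norm (x - c))\<^sup>2)"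
    unfolding C1_def power2_norm_eq_inner
    by (intro exI[of _ "\<lambda>x v. - (2 * ((x - c) \<bullet> v))"])
      (auto intro!: derivative_eq_intros continuous_intros simp: inner_commute)
  then have "C1 (\<lambda>x::'a. (max 0 (r\<^sup>2 - (norm (x - c))\<^sup>2))\<^sup>2)"
    by (rule C1_compose[where g = "\<lambda>s. (max 0 s)\<^sup>2" and g' = "\<lambda>s. 2 * max 0 s"])
      (auto intro!: pos_part_square_deriv continuous_intros)
  moreover have "ball_bump (a # L) = (\<lambda>x. (max 0 (r\<^sup>2 - (norm (x - c))\<^sup>2))\<^sup>2 + ball_bump L x)"
    by (simp add: ball_bump_def fun_eq_iff a)
  ultimately show ?case using C1_add[OF _ Cons] by simp
qed

lemma C1_ball_cutoff: "C1 (ball_cutoff L n)"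
proof -
  have pos: "1 + real n * ball_bump L x > 0" for x
    using ball_bump_nonneg[of L x] by (simp add: add_pos_nonneg)
  have nz: "1 + real n * ball_bump L x \<noteq> 0" for x using pos[of x] by linarith
  have "C1 (\<lambda>x. (\<lambda>s. real n * s / (1 + real n * s)) (ball_bump L x))"
  proof (rule C1_compose[OF C1_ball_bump, where g' = "\<lambda>s. real n / (1 + real n * s)\<^sup>2"])
    fix x :: 'a
    show "((\<lambda>s. real n * s / (1 + real n * s)) has_real_derivative real n / (1 + real n * ball_bump L x)\<^sup>2) (at (ball_bump L x))"
      by (rule derivative_eq_intros refl nz)+ (use nz in \<open>simp add: field_simps power2_eq_square\<close>)
  qed (intro continuous_intros C1_imp_continuous[OF C1_ball_bump], use nz in auto)
  then show ?thesis by (simp add: ball_cutoff_def[abs_def])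
qed

lemma ball_cutoff_range: "0 \<le> ball_cutoff L n x" "ball_cutoff L n x \<le> 1"
  using mult_nonneg_nonneg[OF of_nat_0_le_iff[of n] ball_bump_nonneg[of L x]]
  by (simp_all add: ball_cutoff_def divide_simps)

lemma ball_bump_pos:
  assumes "(c, r) \<in> set L" "x \<in> ball c r"
  shows "ball_bump L x \<ge> (max 0 (r\<^sup>2 - (norm (x - c))\<^sup>2))\<^sup>2" "(max 0 (r\<^sup>2 - (norm (x - c))\<^sup>2))\<^sup>2 > 0"
proof -
  have "(\<lambda>(c, r). (max 0 (r\<^sup>2 - (norm (x - c))\<^sup>2))\<^sup>2) (c, r) \<in> set (map (\<lambda>(c, r). (max 0 (r\<^sup>2 - (norm (x - c))\<^sup>2))\<^sup>2) L)"
    unfolding set_map by (rule imageI[OF assms(1)])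
  then show "ball_bump L x \<ge> (max 0 (r\<^sup>2 - (norm (x - c))\<^sup>2))\<^sup>2"
    unfolding ball_bump_def by (intro order_trans[OF _ member_le_sum_list]) auto
  have "norm (x - c) < r" using assms(2) by (simp add: dist_norm norm_minus_commute)
  then have "(norm (x - c))\<^sup>2 < r\<^sup>2" by (intro power_strict_mono) auto
  then show "(max 0 (r\<^sup>2 - (norm (x - c))\<^sup>2))\<^sup>2 > 0" by simp
qed

lemma ball_bump_zero:
  assumes "\<And>c r. (c, r) \<in> set L \<Longrightarrow> 0 < r \<and> x \<notin> ball c r"
  shows "ball_bump L x = 0"
proof -
  have "map (\<lambda>(c, r). (max 0 (r\<^sup>2 - (norm (x - c))\<^sup>2))\<^sup>2) L = map (\<lambda>_. 0) L"
  proof (rule map_cong[OF refl], clarify)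
    fix c r assume "(c, r) \<in> set L"
    then have "0 < r" "r \<le> norm (x - c)" using assms by (force simp: dist_norm norm_minus_commute)+
    then have "r\<^sup>2 \<le> (norm (x - c))\<^sup>2" by (intro power_mono) auto
    then show "(max 0 (r\<^sup>2 - (norm (x - c))\<^sup>2))\<^sup>2 = 0" by simp
  qed
  then show ?thesis unfolding ball_bump_def by (simp only: sum_list_0)
qed

lemma ball_cutoff_C1c:
  assumes "\<And>c r. (c, r) \<in> set L \<Longrightarrow> 0 < r \<and> cball c r \<subseteq> S"
  shows "ball_cutoff L n \<in> C1c S"
proof -
  let ?K = "\<Union>(c, r)\<in>set L. cball c r"
  have K: "compact ?K" by (intro compact_UN) auto
  have "{x. ball_cutoff L n x \<noteq> 0} \<subseteq> ?K"
  proof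
    fix x assume "x \<in> {x. ball_cutoff L n x \<noteq> 0}"
    then have "ball_bump L x \<noteq> 0" by (auto simp: ball_cutoff_def)
    then obtain c r where "(c, r) \<in> set L" "x \<in> ball c r" using ball_bump_zero assms by metis
    then show "x \<in> ?K" using ball_subset_cball by blast
  qed
  then have cl: "closure {x. ball_cutoff L n x \<noteq> 0} \<subseteq> ?K"
    by (intro closure_minimal compact_imp_closed K)
  then have "compact (closure {x. ball_cutoff L n x \<noteq> 0})"
    using K by (metis closed_Int_compact closed_closure inf.absorb1)
  moreover have "?K \<subseteq> S" using assms by auto
  ultimately show ?thesis using C1_ball_cutoff[of L n] cl by (auto simp: C1c_def)
qed

text \<open>The property of a set of test functions that the fundamental lemma uses: the indicators of all open
  subsets are bounded pointwise limits of members.\<close>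

definition separating_tests :: "'a::euclidean_space set \<Rightarrow> ('a \<Rightarrow> real) set \<Rightarrow> bool" where
  "separating_tests S \<Phi> \<longleftrightarrow> \<Phi> \<subseteq> C1c S \<and>
     (\<forall>U. open U \<longrightarrow> U \<subseteq> S \<longrightarrow> (\<exists>\<phi>::nat \<Rightarrow> 'a \<Rightarrow> real. (\<forall>n. \<phi> n \<in> \<Phi>) \<and>
        (\<forall>n x. 0 \<le> \<phi> n x \<and> \<phi> n x \<le> 1) \<and> (\<forall>x. (\<lambda>n. \<phi> n x) \<longlonglongrightarrow> indicator U x)))"

text \<open>An open set is the union of the countably many balls in it that have centres in a countable dense set
  and rational radii. Cutoffs for the first \<open>n\<close> of these balls, sharpened with the same \<open>n\<close>,
  converge to its indicator.\<close>

lemma countable_separating_tests: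
  fixes S :: "'a::euclidean_space set"
  shows "\<exists>\<Phi>. countable \<Phi> \<and> separating_tests S \<Phi>"
proof -
  obtain X :: "'a set" where X: "countable X" "\<And>U. open U \<Longrightarrow> U \<noteq> {} \<Longrightarrow> \<exists>d\<in>X. d \<in> U"
    using countable_dense_exists by metis
  define D where "D V = {(c, r). c \<in> X \<and> r \<in> \<rat> \<and> 0 < r \<and> cball c r \<subseteq> V}" for V :: "'a set"
  have D: "countable (D V)" for V
    by (rule countable_subset[of _ "X \<times> \<rat>"]) (use X(1) countable_rat in \<open>auto simp: D_def\<close>)
  define \<Phi> where "\<Phi> = (\<lambda>(L, n). ball_cutoff L n) ` (lists (D S) \<times> UNIV)"
  show ?thesis
    unfolding separating_tests_def
  proof (intro exI[of _ \<Phi>] conjI allI impI)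
    show "countable \<Phi>" unfolding \<Phi>_def using D by (intro countable_image countable_SIGMA countable_lists) auto
    show "\<Phi> \<subseteq> C1c S" by (auto simp: \<Phi>_def D_def intro!: ball_cutoff_C1c)
    fix U :: "'a set" assume U: "open U" "U \<subseteq> S"
    have cover: "\<exists>c r. (c, r) \<in> D U \<and> x \<in> ball c r" if x: "x \<in> U" for x
    proof -
      obtain e where e: "e > 0" "ball x e \<subseteq> U" using U(1) x open_contains_ball by blast
      obtain r where r: "r \<in> \<rat>" "0 < r" "r < e / 2" using Rats_dense_in_real[of 0 "e/2"] e by auto
      obtain c where c: "c \<in> X" "c \<in> ball x r" using X(2)[of "ball x r"] r by auto
      have "cball c r \<subseteq> ball x e"
      proof
        fix y assume "y \<in> cball c r"
        then show "y \<in> ball x e" using c(2) r dist_triangle[of x y c] by auto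
      qed
      then show ?thesis using c r e by (auto simp: D_def dist_commute)
    qed
    show "\<exists>\<phi>::nat \<Rightarrow> 'a \<Rightarrow> real. (\<forall>n. \<phi> n \<in> \<Phi>) \<and>
        (\<forall>n x. 0 \<le> \<phi> n x \<and> \<phi> n x \<le> 1) \<and> (\<forall>x. (\<lambda>n. \<phi> n x) \<longlonglongrightarrow> indicator U x)"
    proof (cases "D U = {}")
      case True
      then have "U = {}" using cover by blast
      then show ?thesis
        by (intro exI[of _ "\<lambda>n. ball_cutoff [] n"] conjI)
          (auto simp: \<Phi>_def ball_cutoff_range ball_cutoff_def ball_bump_def intro!: image_eqI[of _ _ "([], _)"])
    next
      case False
      define L where "L n = map (from_nat_into (D U)) [0..<n]" for n
      have LD: "set (L n) \<subseteq> D U" for n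
        using from_nat_into[OF False] by (auto simp: L_def)
      have DS: "D U \<subseteq> D S" using U(2) by (auto simp: D_def)
      show ?thesis
      proof (intro exI[of _ "\<lambda>n. ball_cutoff (L n) n"] conjI allI)
        show "ball_cutoff (L n) n \<in> \<Phi>" for n
          unfolding \<Phi>_def by (rule image_eqI[of _ _ "(L n, n)"]) (use LD[of n] DS in auto)
        fix x
        show "(\<lambda>n. ball_cutoff (L n) n x) \<longlonglongrightarrow> indicator U x"
        proof (cases "x \<in> U")
          case False
          have "ball_bump (L n) x = 0" for n
          proof (rule ball_bump_zero)
            fix c r assume "(c, r) \<in> set (L n)"
            then have "(c, r) \<in> D U" using LD by blast
            then have "cball c r \<subseteq> U" "0 < r" by (auto simp: D_def)
            then show "0 < r \<and> x \<notin> ball c r" using False ball_subset_cball by blast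
          qed
          then show ?thesis using False by (simp add: ball_cutoff_def)
        next
          case True
          obtain c r where cr: "(c, r) \<in> D U" "x \<in> ball c r" using cover[OF True] by blast
          obtain i where i: "from_nat_into (D U) i = (c, r)" using from_nat_into_surj[OF D cr(1)] by blast
          define d where "d = (max 0 (r\<^sup>2 - (norm (x - c))\<^sup>2))\<^sup>2"
          have inL: "(c, r) \<in> set (L n)" if "n > i" for n
            using that i by (auto simp: L_def intro!: image_eqI[of _ _ i])
          have d: "d > 0" using ball_bump_pos(2)[OF inL cr(2)] by (auto simp: d_def)
          have low: "1 - 1 / (1 + real n * d) \<le> ball_cutoff (L n) n x" if "n > i" for n
          proof -
            have b: "ball_bump (L n) x \<ge> d" using ball_bump_pos(1)[OF inL[OF that] cr(2)] by (simp add: d_def)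
            have "real n * d \<le> real n * ball_bump (L n) x" using b by (simp add: mult_left_mono)
            moreover have p: "0 \<le> real n * d" using d by simp
            ultimately have "1 / (1 + real n * ball_bump (L n) x) \<le> 1 / (1 + real n * d)"
              by (intro divide_left_mono) auto
            moreover have "ball_cutoff (L n) n x = 1 - 1 / (1 + real n * ball_bump (L n) x)"
              using p \<open>real n * d \<le> real n * ball_bump (L n) x\<close> by (simp add: ball_cutoff_def field_simps)
            ultimately show ?thesis by simp
          qed
          have "(\<lambda>n. 1 - 1 / (1 + real n * d)) \<longlonglongrightarrow> 1 - 0"
          proof (intro tendsto_intros)
            have "filterlim (\<lambda>n. real n * d) at_top sequentially"
              using d filterlim_tendsto_pos_mult_at_top[OF tendsto_const d filterlim_real_sequentially]
              by (simp add: mult.commute)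
            then have "filterlim (\<lambda>n. 1 + real n * d) at_top sequentially"
              by (intro filterlim_tendsto_add_at_top[OF tendsto_const])
            then show "(\<lambda>n. 1 / (1 + real n * d)) \<longlonglongrightarrow> 0"
              by (intro tendsto_divide_0[OF tendsto_const] filterlim_at_top_imp_at_infinity)
          qed
          then have "(\<lambda>n. 1 - 1 / (1 + real n * d)) \<longlonglongrightarrow> 1" by simp
          then have "(\<lambda>n. ball_cutoff (L n) n x) \<longlonglongrightarrow> 1"
          proof (rule tendsto_sandwich[rotated 2])
            show "\<forall>\<^sub>F n in sequentially. 1 - 1 / (1 + real n * d) \<le> ball_cutoff (L n) n x"
              using low by (auto simp: eventually_sequentially intro!: exI[of _ "Suc i"])
            show "\<forall>\<^sub>F n in sequentially. ball_cutoff (L n) n x \<le> 1"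
              by (simp add: ball_cutoff_range)
          qed auto
          then show ?thesis using True by simp
        qed
      qed (simp_all add: ball_cutoff_range)
    qed
  qed
qed

text \<open>The open sets form an intersection-stable generator of the Borel sets, so the vanishing of the
  integral passes from open to Borel sets, and then a density argument applies.\<close>

lemma borel_integral_zero_if_open_zero:
  fixes f :: "'a::euclidean_space \<Rightarrow> real"
  assumes f: "integrable lborel f" and U: "\<And>U. open U \<Longrightarrow> (\<integral>x. indicator U x *\<^sub>R f x \<partial>lborel) = 0"
  shows "AE x in lborel. f x = 0"
proof -
  have fi: "set_integrable lborel A f" if "A \<in> sets borel" for A
    using that f unfolding set_integrable_def by (intro integrable_mult_indicator) auto
  have all: "set_lebesgue_integral lborel A f = 0" if "A \<in> sets borel" for A
  proof -
    have A: "A \<in> sigma_sets UNIV {S::'a set. open S}" using that by (simp add: borel_def sets_measure_of)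
    have meas: "B \<in> sets borel" if "B \<in> sigma_sets UNIV {S::'a set. open S}" for B
      using that by (simp add: borel_def sets_measure_of)
    have "Int_stable {S::'a set. open S}" by (auto simp: Int_stable_def)
    moreover have "{S::'a set. open S} \<subseteq> Pow UNIV" by simp
    ultimately show ?thesis using A
    proof (induction rule: sigma_sets_induct_disjoint)
      case (basic A) then show ?case using U by (simp add: set_lebesgue_integral_def)
    next
      case empty show ?case by (simp add: set_lebesgue_integral_def)
    next
      case (compl A)
      have "set_lebesgue_integral lborel (A \<union> (UNIV - A)) f
          = set_lebesgue_integral lborel A f + set_lebesgue_integral lborel (UNIV - A) f"
        using meas[OF compl(1)] by (intro set_integral_Un fi) auto
      moreover have "A \<union> (UNIV - A) = UNIV" by auto
      ultimately show ?case using U[of UNIV] compl by (simp add: set_lebesgue_integral_def)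
    next
      case (union A)
      have "set_lebesgue_integral lborel (\<Union>i. A i) f = (\<Sum>i. set_lebesgue_integral lborel (A i) f)"
        using meas union(2) by (intro lebesgue_integral_countable_add fi)
          (auto dest: union(1)[unfolded disjoint_family_on_def, rule_format, rotated 2])
      then show ?case using union by simp
    qed
  qed
  show ?thesis
    by (rule density_unique_real[OF f, of "\<lambda>x. 0"]) (use all in \<open>simp_all add: set_lebesgue_integral_def\<close>)
qed

text \<open>The fundamental lemma of the calculus of variations. The test functions live on the open set \<open>S\<close>
  while the integrals are over a set \<open>S'\<close> that may be larger by a null set: in time these are the open
  interval and its closure.\<close>

lemma AE_zero_if_test_integrals_zero_real:
  fixes g :: "'a::euclidean_space \<Rightarrow> real"
  assumes S: "open S" and S': "S' \<in> sets borel" "S \<subseteq> S'" and N: "S' - S \<in> null_sets lborel"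
    and g: "integrable (lebesgue_on S') g"
    and tests: "separating_tests S \<Phi>"
    and zero: "\<And>\<phi>. \<phi> \<in> \<Phi> \<Longrightarrow> (\<integral>x. \<phi> x *\<^sub>R g x \<partial>lebesgue_on S') = 0"
  shows "AE x in lebesgue_on S'. g x = 0"
proof -
  have \<Phi>: "\<Phi> \<subseteq> C1c S" using tests by (simp add: separating_tests_def)
  let ?F = "\<lambda>x. indicator S' x *\<^sub>R g x"
  have leb: "S' \<inter> space lebesgue \<in> sets lebesgue" using S' by auto
  have F: "integrable lebesgue ?F" using g leb by (simp add: integrable_restrict_space)
  obtain h where h: "h \<in> borel_measurable borel" "AE x in lborel. ?F x = h x"
    using lebesgue_borel_version[OF borel_measurable_integrable[OF F]] by blast
  have hi: "integrable lborel h" using integrable_lebesgue_AE_iff(1)[OF h] F by simp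
  have hS: "AE x in lborel. x \<notin> S \<longrightarrow> h x = 0"
    using h(2) AE_not_in[OF N] by eventually_elim (auto simp: indicator_def split: if_splits)
  have test: "(\<integral>x. \<phi> x *\<^sub>R h x \<partial>lborel) = 0" if "\<phi> \<in> \<Phi>" for \<phi>
  proof -
    have "C1 \<phi>" using that \<Phi> by (auto simp: C1c_def)
    then have m: "\<phi> \<in> borel_measurable borel"
      by (intro borel_measurable_continuous_onI C1_imp_continuous)
    have "(\<integral>x. \<phi> x *\<^sub>R h x \<partial>lborel) = (\<integral>x. \<phi> x *\<^sub>R ?F x \<partial>lebesgue)"
      by (rule integrable_lebesgue_AE_iff(2)[symmetric]) (use m h in \<open>auto elim!: eventually_mono\<close>)
    also have "\<dots> = (\<integral>x. \<phi> x *\<^sub>R g x \<partial>lebesgue_on S')"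
      by (subst integral_restrict_space[OF leb]) (auto intro!: Bochner_Integration.integral_cong simp: mult_ac)
    finally show ?thesis using zero[OF that] by simp
  qed
  have op: "(\<integral>x. indicator U x *\<^sub>R h x \<partial>lborel) = 0" if U: "open U" for U
  proof -
    have US: "open (U \<inter> S)" using U S by auto
    obtain \<phi> where phi: "\<And>n. \<phi> n \<in> \<Phi>" "\<And>n x. 0 \<le> \<phi> n x \<and> \<phi> n x \<le> 1"
      "\<And>x. (\<lambda>n. \<phi> n x) \<longlonglongrightarrow> indicator (U \<inter> S) x"
      using tests[unfolded separating_tests_def, THEN conjunct2, rule_format, OF US Int_lower2] by auto
    have m: "\<phi> n \<in> borel_measurable borel" for n
      using phi(1)[of n] \<Phi> by (intro borel_measurable_continuous_onI C1_imp_continuous) (auto simp: C1c_def)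
    have "(\<lambda>n. \<integral>x. \<phi> n x *\<^sub>R h x \<partial>lborel) \<longlonglongrightarrow> (\<integral>x. indicator (U \<inter> S) x *\<^sub>R h x \<partial>lborel)"
    proof (rule integral_dominated_convergence[where w = "\<lambda>x. norm (h x)"])
      show "(\<lambda>x. indicat_real (U \<inter> S) x *\<^sub>R h x) \<in> borel_measurable lborel"
        using h(1) US by (intro borel_measurable_scaleR borel_measurable_indicator) simp_all
      show "(\<lambda>x. \<phi> n x *\<^sub>R h x) \<in> borel_measurable lborel" for n
        using h(1) m by (intro borel_measurable_scaleR) simp_all
      show "integrable lborel (\<lambda>x. norm (h x))" using hi by simp
      show "AE x in lborel. (\<lambda>n. \<phi> n x *\<^sub>R h x) \<longlonglongrightarrow> indicat_real (U \<inter> S) x *\<^sub>R h x"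
        by (intro AE_I2 tendsto_intros phi(3))
      show "AE x in lborel. norm (\<phi> n x *\<^sub>R h x) \<le> norm (h x)" for n
        using phi(2) by (intro AE_I2) (simp add: abs_mult mult_left_le_one_le)
    qed
    then have "(\<integral>x. indicator (U \<inter> S) x *\<^sub>R h x \<partial>lborel) = 0"
      unfolding test[OF phi(1)] by (simp add: LIMSEQ_const_iff)
    moreover have "(\<integral>x. indicator (U \<inter> S) x *\<^sub>R h x \<partial>lborel) = (\<integral>x. indicator U x *\<^sub>R h x \<partial>lborel)"
    proof (rule integral_cong_AE)
      show "AE x in lborel. indicat_real (U \<inter> S) x *\<^sub>R h x = indicat_real U x *\<^sub>R h x"
        using hS by eventually_elim (auto simp: indicator_def)
    qed (use h(1) U US in \<open>auto intro!: borel_measurable_times borel_measurable_indicator\<close>)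
    ultimately show ?thesis by simp
  qed
  have "AE x in lborel. h x = 0" by (rule borel_integral_zero_if_open_zero[OF hi op])
  with h(2) have "AE x in lborel. x \<in> S' \<longrightarrow> g x = 0" by eventually_elim auto
  then show ?thesis by (simp add: AE_lebesgue_on_iff S')
qed

lemma compact_support_deriv_zero:
  assumes "C1 \<phi>" "x \<notin> closure {x. \<phi> x \<noteq> 0}"
  shows "frechet_derivative \<phi> (at x) e = 0"
proof -
  have "((\<lambda>_. 0) has_derivative (\<lambda>_. 0)) (at x)" by simp
  then have "(\<phi> has_derivative (\<lambda>_. 0)) (at x)"
  proof (rule has_derivative_transform_within_open)
    show "open (- closure {x. \<phi> x \<noteq> 0})" by auto
    show "x \<in> - closure {x. \<phi> x \<noteq> 0}" using assms by simp
    fix y assume "y \<in> - closure {x. \<phi> x \<noteq> 0}"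
    then show "0 = \<phi> y" using closure_subset[of "{x. \<phi> x \<noteq> 0}"] by auto
  qed
  from frechet_derivative_at[OF this] show ?thesis by metis
qed

text \<open>Both functions are continuous and vanish off a compact set, so they may multiply any integrable
  function.\<close>

lemma C1c_bounded_measurable:
  assumes "\<phi> \<in> C1c S"
  shows "\<phi> \<in> borel_measurable borel" "(\<lambda>x. frechet_derivative \<phi> (at x) e) \<in> borel_measurable borel"
    "\<exists>M. \<forall>x. \<bar>\<phi> x\<bar> \<le> M" "\<exists>M. \<forall>x. \<bar>frechet_derivative \<phi> (at x) e\<bar> \<le> M"
proof -
  have C1: "C1 \<phi>" and K: "compact (closure {x. \<phi> x \<noteq> 0})" using assms by (auto simp: C1c_def)
  obtain \<phi>' where d: "\<And>x. (\<phi> has_derivative \<phi>' x) (at x)" "\<And>v. continuous_on UNIV (\<lambda>x. \<phi>' x v)"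
    using C1 by (auto simp: C1_def)
  have eq: "frechet_derivative \<phi> (at x) = \<phi>' x" for x using frechet_derivative_at[OF d(1)[of x]] by simp
  have c1: "continuous_on UNIV \<phi>" by (rule C1_imp_continuous[OF C1])
  have c2: "continuous_on UNIV (\<lambda>x. frechet_derivative \<phi> (at x) e)" unfolding eq by (rule d)
  show "\<phi> \<in> borel_measurable borel" "(\<lambda>x. frechet_derivative \<phi> (at x) e) \<in> borel_measurable borel"
    using c1 c2 by (auto intro: borel_measurable_continuous_onI)
  have bd: "\<exists>M. \<forall>x. \<bar>f x\<bar> \<le> M" if c: "continuous_on UNIV f" and z: "\<And>x. x \<notin> closure {x. \<phi> x \<noteq> 0} \<Longrightarrow> f x = 0" for f :: "'a \<Rightarrow> real"
  proof -
    have "compact (f ` closure {x. \<phi> x \<noteq> 0})"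
      using K c by (intro compact_continuous_image) (auto intro: continuous_on_subset)
    then have "bounded (f ` closure {x. \<phi> x \<noteq> 0})" by (rule compact_imp_bounded)
    then obtain M where M: "\<And>x. x \<in> closure {x. \<phi> x \<noteq> 0} \<Longrightarrow> \<bar>f x\<bar> \<le> M"
      unfolding bounded_iff by auto
    have "\<bar>f x\<bar> \<le> max M 0" for x using M[of x] z[of x] by (cases "x \<in> closure {x. \<phi> x \<noteq> 0}") auto
    then show ?thesis by blast
  qed
  show "\<exists>M. \<forall>x. \<bar>\<phi> x\<bar> \<le> M"
    by (rule bd[OF c1]) (use closure_subset[of "{x. \<phi> x \<noteq> 0}"] in auto)
  show "\<exists>M. \<forall>x. \<bar>frechet_derivative \<phi> (at x) e\<bar> \<le> M"
    by (rule bd[OF c2 compact_support_deriv_zero[OF C1]])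
qed

lemma integrable_bounded_scaleR:
  fixes g :: "'a::euclidean_space \<Rightarrow> 'b::euclidean_space"
  assumes g: "integrable (lebesgue_on S) g" and f: "f \<in> borel_measurable borel" "\<exists>M. \<forall>x. \<bar>f x\<bar> \<le> M"
  shows "integrable (lebesgue_on S) (\<lambda>x. f x *\<^sub>R g x)"
proof -
  obtain M where M: "\<And>x. \<bar>f x\<bar> \<le> M" using f(2) by blast
  have "f \<in> borel_measurable lborel" using f(1) by simp
  then have "f \<in> borel_measurable (lebesgue_on S)" by (intro measurable_restrict_space1 measurable_completion)
  then have m: "(\<lambda>x. f x *\<^sub>R g x) \<in> borel_measurable (lebesgue_on S)" using g by measurable
  have "integrable (lebesgue_on S) (\<lambda>x. M *\<^sub>R g x)" using g by simp
  then show ?thesis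
  proof (rule Bochner_Integration.integrable_bound[OF _ m], intro AE_I2)
    fix x show "norm (f x *\<^sub>R g x) \<le> norm (M *\<^sub>R g x)"
      using M[of x] by (simp add: mult_right_mono)
  qed
qed

lemma integrable_test:
  fixes g :: "'a::euclidean_space \<Rightarrow> 'b::euclidean_space"
  assumes "integrable (lebesgue_on S') g" "\<phi> \<in> C1c S"
  shows "integrable (lebesgue_on S') (\<lambda>x. \<phi> x *\<^sub>R g x)"
    and "integrable (lebesgue_on S') (\<lambda>x. frechet_derivative \<phi> (at x) e *\<^sub>R g x)"
  by (rule integrable_bounded_scaleR[OF assms(1)], rule C1c_bounded_measurable[OF assms(2)],
      rule C1c_bounded_measurable[OF assms(2)])+

lemma AE_zero_if_test_integrals_zero:
  fixes g :: "'a::euclidean_space \<Rightarrow> 'b::euclidean_space"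
  assumes S: "open S" and S': "S' \<in> sets borel" "S \<subseteq> S'" and N: "S' - S \<in> null_sets lborel"
    and g: "integrable (lebesgue_on S') g"
    and \<Phi>: "separating_tests S \<Phi>"
    and zero: "\<And>\<phi>. \<phi> \<in> \<Phi> \<Longrightarrow> (\<integral>x. \<phi> x *\<^sub>R g x \<partial>lebesgue_on S') = 0"
  shows "AE x in lebesgue_on S'. g x = 0"
proof -
  have "AE x in lebesgue_on S'. g x \<bullet> b = 0" for b
  proof (rule AE_zero_if_test_integrals_zero_real[OF S S' N _ \<Phi>])
    show "integrable (lebesgue_on S') (\<lambda>x. g x \<bullet> b)" using g by simp
    fix \<phi> assume p: "\<phi> \<in> \<Phi>"
    have "(\<integral>x. \<phi> x *\<^sub>R (g x \<bullet> b) \<partial>lebesgue_on S') = (\<integral>x. (\<phi> x *\<^sub>R g x) \<bullet> b \<partial>lebesgue_on S')" by simp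
    also have "\<dots> = (\<integral>x. \<phi> x *\<^sub>R g x \<partial>lebesgue_on S') \<bullet> b"
      using integrable_test(1)[OF g, of \<phi>] p \<Phi> by (intro integral_inner_left) (auto simp: separating_tests_def)
    finally show "(\<integral>x. \<phi> x *\<^sub>R (g x \<bullet> b) \<partial>lebesgue_on S') = 0" using zero[OF p] by simp
  qed
  then have "AE x in lebesgue_on S'. \<forall>b\<in>Basis. g x \<bullet> b = 0" by (intro AE_finite_allI) auto
  then show ?thesis by eventually_elim (simp add: euclidean_eq_iff[of "g _"])
qed

section \<open>Weak derivatives\<close>

lemma has_weak_deriv_linear:
  assumes "integrable (lebesgue_on S) f" "integrable (lebesgue_on S) f'"
    "integrable (lebesgue_on S) g" "integrable (lebesgue_on S) g'"
    and "has_weak_deriv S e f g" "has_weak_deriv S e f' g'"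
  shows "has_weak_deriv S e (\<lambda>x. a *\<^sub>R f x + b *\<^sub>R f' x) (\<lambda>x. a *\<^sub>R g x + b *\<^sub>R g' x)"
  unfolding has_weak_deriv_def
proof
  fix \<phi> assume p: "\<phi> \<in> C1c S"
  let ?D = "\<lambda>x. frechet_derivative \<phi> (at x) e"
  have "(\<integral>x. ?D x *\<^sub>R (a *\<^sub>R f x + b *\<^sub>R f' x) \<partial>lebesgue_on S)
     = (\<integral>x. a *\<^sub>R (?D x *\<^sub>R f x) + b *\<^sub>R (?D x *\<^sub>R f' x) \<partial>lebesgue_on S)"
    by (simp add: scaleR_add_right mult.commute)
  also have "\<dots> = a *\<^sub>R (\<integral>x. ?D x *\<^sub>R f x \<partial>lebesgue_on S) + b *\<^sub>R (\<integral>x. ?D x *\<^sub>R f' x \<partial>lebesgue_on S)"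
    using integrable_test(2)[OF assms(1) p, of e] integrable_test(2)[OF assms(2) p, of e]
    by (subst Bochner_Integration.integral_add) (simp_all del: scaleR_scaleR)
  also have "\<dots> = - (a *\<^sub>R (\<integral>x. \<phi> x *\<^sub>R g x \<partial>lebesgue_on S) + b *\<^sub>R (\<integral>x. \<phi> x *\<^sub>R g' x \<partial>lebesgue_on S))"
    using assms(5,6) p by (simp add: has_weak_deriv_def)
  also have "\<dots> = - (\<integral>x. a *\<^sub>R (\<phi> x *\<^sub>R g x) + b *\<^sub>R (\<phi> x *\<^sub>R g' x) \<partial>lebesgue_on S)"
    using integrable_test(1)[OF assms(3) p] integrable_test(1)[OF assms(4) p]
    by (subst Bochner_Integration.integral_add) (simp_all del: scaleR_scaleR)
  also have "\<dots> = - (\<integral>x. \<phi> x *\<^sub>R (a *\<^sub>R g x + b *\<^sub>R g' x) \<partial>lebesgue_on S)"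
    by (simp add: scaleR_add_right mult.commute)
  finally show "(\<integral>x. ?D x *\<^sub>R (a *\<^sub>R f x + b *\<^sub>R f' x) \<partial>lebesgue_on S)
     = - (\<integral>x. \<phi> x *\<^sub>R (a *\<^sub>R g x + b *\<^sub>R g' x) \<partial>lebesgue_on S)" .
qed

lemma has_weak_deriv_unique:
  fixes g g' :: "'a::euclidean_space \<Rightarrow> 'b::euclidean_space"
  assumes S: "open S" and g: "integrable (lebesgue_on S) g" "integrable (lebesgue_on S) g'"
    and w: "has_weak_deriv S e f g" "has_weak_deriv S e f g'"
  shows "AE x in lebesgue_on S. g x = g' x"
proof -
  obtain \<Phi> where \<Phi>: "separating_tests S \<Phi>" using countable_separating_tests by blast
  have "AE x in lebesgue_on S. g x - g' x = 0"
  proof (rule AE_zero_if_test_integrals_zero[OF S _ _ _ _ \<Phi>])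
    fix \<phi> assume "\<phi> \<in> \<Phi>"
    then have p: "\<phi> \<in> C1c S" using \<Phi> by (auto simp: separating_tests_def)
    have "(\<integral>x. \<phi> x *\<^sub>R (g x - g' x) \<partial>lebesgue_on S) = (\<integral>x. \<phi> x *\<^sub>R g x - \<phi> x *\<^sub>R g' x \<partial>lebesgue_on S)"
      by (simp add: scaleR_diff_right)
    also have "\<dots> = 0"
      using integrable_test(1)[OF g(1) p] integrable_test(1)[OF g(2) p] w p
      by (simp add: has_weak_deriv_def)
    finally show "(\<integral>x. \<phi> x *\<^sub>R (g x - g' x) \<partial>lebesgue_on S) = 0" .
  qed (use S g in auto)
  then show ?thesis by simp
qed

lemma has_weak_deriv_cong_AE:
  assumes "integrable (lebesgue_on S) f" "integrable (lebesgue_on S) f'" "AE x in lebesgue_on S. f x = f' x"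
    and w: "has_weak_deriv S e f g"
  shows "has_weak_deriv S e f' g"
  unfolding has_weak_deriv_def
proof
  fix \<phi> assume p: "\<phi> \<in> C1c S"
  let ?D = "\<lambda>x. frechet_derivative \<phi> (at x) e"
  have "(\<integral>x. ?D x *\<^sub>R f x \<partial>lebesgue_on S) = (\<integral>x. ?D x *\<^sub>R f' x \<partial>lebesgue_on S)"
    using integrable_test(2)[OF assms(1) p, of e] integrable_test(2)[OF assms(2) p, of e] assms(3)
    by (intro integral_cong_AE) auto
  then show "(\<integral>x. ?D x *\<^sub>R f' x \<partial>lebesgue_on S) = - (\<integral>x. \<phi> x *\<^sub>R g x \<partial>lebesgue_on S)"
    using w p by (simp add: has_weak_deriv_def)
qed

section \<open>Square integrable functions\<close>

lemma L2D: "f \<in> L2 M \<Longrightarrow> f \<in> borel_measurable M" "f \<in> L2 M \<Longrightarrow> integrable M (\<lambda>x. (norm (f x))\<^sup>2)"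
  by (auto simp: L2_def)

text \<open>Pointwise \<open>2 \<bar>f \<bullet> g\<bar> \<le> \<bar>f\<bar>\<^sup>2 + \<bar>g\<bar>\<^sup>2\<close>.\<close>

lemma integrable_L2_inner:
  assumes "f \<in> L2 M" "g \<in> L2 M"
  shows "integrable M (\<lambda>x. f x \<bullet> g x)"
proof (rule Bochner_Integration.integrable_bound)
  show "integrable M (\<lambda>x. (norm (f x))\<^sup>2 + (norm (g x))\<^sup>2)" using assms by (simp add: L2_def)
  show "(\<lambda>x. f x \<bullet> g x) \<in> borel_measurable M" using assms[THEN L2D(1)] by measurable
  show "AE x in M. norm (f x \<bullet> g x) \<le> norm ((norm (f x))\<^sup>2 + (norm (g x))\<^sup>2)"
  proof (rule AE_I2)
    fix x
    have "\<bar>f x \<bullet> g x\<bar> \<le> norm (f x) * norm (g x)" by (rule Cauchy_Schwarz_ineq2)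
    moreover have "2 * (norm (f x) * norm (g x)) \<le> (norm (f x))\<^sup>2 + (norm (g x))\<^sup>2"
      using sum_squares_bound[of "norm (f x)" "norm (g x)"] by (simp add: mult.assoc)
    moreover have "0 \<le> norm (f x) * norm (g x)" by simp
    ultimately show "norm (f x \<bullet> g x) \<le> norm ((norm (f x))\<^sup>2 + (norm (g x))\<^sup>2)"
      unfolding real_norm_def by linarith
  qed
qed

lemma subspace_L2: "subspace (L2 M)"
proof (rule subspaceI)
  show "0 \<in> L2 M" by (simp add: L2_def zero_fun_def)
  show "c *\<^sub>R f \<in> L2 M" if f: "f \<in> L2 M" for c and f :: "'a \<Rightarrow> 'b"
  proof -
    have "(\<lambda>x. c *\<^sub>R f x) \<in> borel_measurable M" using L2D(1)[OF f] by measurable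
    moreover have "integrable M (\<lambda>x. c\<^sup>2 * (norm (f x))\<^sup>2)" using L2D(2)[OF f] by simp
    ultimately show ?thesis by (simp add: L2_def scaleR_fun_def power_mult_distrib)
  qed
  show "f + g \<in> L2 M" if f: "f \<in> L2 M" and g: "g \<in> L2 M" for f g :: "'a \<Rightarrow> 'b"
  proof -
    have "(\<lambda>x. f x + g x) \<in> borel_measurable M" using L2D(1)[OF f] L2D(1)[OF g] by measurable
    moreover have "integrable M (\<lambda>x. (norm (f x))\<^sup>2 + 2 * (f x \<bullet> g x) + (norm (g x))\<^sup>2)"
      using L2D(2)[OF f] L2D(2)[OF g] integrable_L2_inner[OF f g] by simp
    moreover have "(norm (f x + g x))\<^sup>2 = (norm (f x))\<^sup>2 + 2 * (f x \<bullet> g x) + (norm (g x))\<^sup>2" for x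
      by (simp add: power2_norm_eq_inner inner_add_left inner_add_right inner_commute)
    ultimately show ?thesis by (simp add: L2_def plus_fun_def)
  qed
qed

lemma semi_inner_L2: "semi_inner (L2 M) (L2_inner M)"
  unfolding semi_inner_def L2_inner_def
  by (auto simp: subspace_L2 inner_commute inner_add_left inner_add_right scaleR_fun_def integrable_L2_inner)

lemma L2_inner_zero_AE:
  assumes "AE x in M. f x = 0"
  shows "L2_inner M f f = 0"
  unfolding L2_inner_def by (rule integral_eq_zero_AE) (use assms in eventually_elim, simp)

lemma L2_norm_square: "(L2_norm M f)\<^sup>2 = L2_inner M f f"
  by (simp add: L2_norm_def L2_inner_nonneg)

lemma L2_imp_integrable:
  assumes "finite_measure M" "f \<in> L2 M"
  shows "integrable M f"
proof (rule Bochner_Integration.integrable_bound)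
  show "integrable M (\<lambda>x. 1 + (norm (f x))\<^sup>2)"
    using finite_measure.integrable_const[OF assms(1), of "1::real"] L2D(2)[OF assms(2)] by simp
  show "f \<in> borel_measurable M" by (rule L2D(1)[OF assms(2)])
  show "AE x in M. norm (f x) \<le> norm (1 + (norm (f x))\<^sup>2)"
  proof (rule AE_I2)
    fix x
    have "2 * norm (f x) \<le> 1 + (norm (f x))\<^sup>2" using sum_squares_bound[of 1 "norm (f x)"] by simp
    then show "norm (f x) \<le> norm (1 + (norm (f x))\<^sup>2)"
      using norm_ge_zero[of "f x"] unfolding real_norm_def by linarith
  qed
qed

section \<open>The solution spaces are seminormed\<close>

lemma ns_settingD:
  assumes "ns_setting P"
  shows "horizon P > 0" "{0..horizon P} \<in> sets borel" "domain P \<in> sets borel" "open (domain P)"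
    "finite_measure (cylinder P)"
proof -
  show "horizon P > 0" "open (domain P)" using assms by (auto simp: ns_setting_def)
  then show 1: "{0..horizon P} \<in> sets borel" "domain P \<in> sets borel" by auto
  have b: "bounded ({0..horizon P} \<times> domain P)" using assms by (intro bounded_Times) (auto simp: ns_setting_def)
  have m: "{0..horizon P} \<times> domain P \<in> sets lebesgue" using borel_Times[OF 1] by auto
  have "{0..horizon P} \<times> domain P \<in> lmeasurable"
    using b m by (rule bounded_set_imp_lmeasurable)
  then show "finite_measure (cylinder P)" unfolding cylinder_def by (rule finite_measure_lebesgue_on)
qed

text \<open>The cylinder has finite measure, so square integrable functions are integrable and Fubini applies.
  Linearity of the integrals in the definition of weak derivatives rests on this.\<close>

lemma cylinder_slices:
  assumes P: "ns_setting P" and f: "f \<in> L2 (cylinder P)"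
  shows "AE t in interval P. integrable (space_dom P) (\<lambda>x. f (t, x))"
    and "AE x in space_dom P. integrable (interval P) (\<lambda>t. f (t, x))"
  using integrable_lebesgue_on_slices[OF ns_settingD(2,3)[OF P]]
    L2_imp_integrable[OF ns_settingD(5)[OF P] f]
  unfolding cylinder_def interval_def space_dom_def by blast+

lemma cylinder_AE_slices:
  assumes P: "ns_setting P" and f: "AE z in cylinder P. Q z"
  shows "AE t in interval P. AE x in space_dom P. Q (t, x)"
    and "AE x in space_dom P. AE t in interval P. Q (t, x)"
  using AE_lebesgue_on_slices[OF ns_settingD(2,3)[OF P], of Q] f
  unfolding cylinder_def interval_def space_dom_def by blast+

lemma cylinder_eq_from_slices:
  assumes P: "ns_setting P" and f: "f \<in> L2 (cylinder P)" "g \<in> L2 (cylinder P)"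
    and "(AE t in interval P. AE x in space_dom P. f (t, x) = g (t, x)) \<or>
         (AE x in space_dom P. AE t in interval P. f (t, x) = g (t, x))"
  shows "AE z in cylinder P. f z = g z"
proof -
  have "(\<lambda>z. f z - g z) \<in> borel_measurable (cylinder P)" using f[THEN L2D(1)] by measurable
  then have "AE z in cylinder P. f z - g z = 0"
    using lebesgue_on_zero_from_slices[OF ns_settingD(2,3)[OF P], of "\<lambda>z. f z - g z"] assms(4)
    unfolding cylinder_def interval_def space_dom_def by simp
  then show ?thesis by simp
qed

lemma L2_lincomb:
  assumes "f \<in> L2 M" "g \<in> L2 M"
  shows "a *\<^sub>R f + b *\<^sub>R g \<in> L2 M"
  using assms by (intro subspace_add subspace_scale subspace_L2)

lemma has_space_deriv_linear:
  assumes P: "ns_setting P" and u: "u \<in> L2 (cylinder P)" "u' \<in> L2 (cylinder P)"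
    and d: "has_space_deriv P k u v" "has_space_deriv P k u' v'"
  shows "has_space_deriv P k (a *\<^sub>R u + b *\<^sub>R u') (a *\<^sub>R v + b *\<^sub>R v')"
proof -
  have v: "v \<in> L2 (cylinder P)" "v' \<in> L2 (cylinder P)"
    and dv: "AE t in interval P. has_weak_deriv (domain P) (axis k 1) (\<lambda>x. u (t, x)) (\<lambda>x. v (t, x))"
      "AE t in interval P. has_weak_deriv (domain P) (axis k 1) (\<lambda>x. u' (t, x)) (\<lambda>x. v' (t, x))"
    using d by (auto simp: has_space_deriv_def)
  have "AE t in interval P. has_weak_deriv (domain P) (axis k 1)
      (\<lambda>x. (a *\<^sub>R u + b *\<^sub>R u') (t, x)) (\<lambda>x. (a *\<^sub>R v + b *\<^sub>R v') (t, x))"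
    using dv cylinder_slices(1)[OF P u(1)] cylinder_slices(1)[OF P u(2)]
      cylinder_slices(1)[OF P v(1)] cylinder_slices(1)[OF P v(2)]
    by eventually_elim (simp add: scaleR_fun_def space_dom_def has_weak_deriv_linear)
  then show ?thesis using L2_lincomb[OF v] by (simp add: has_space_deriv_def)
qed

lemma has_space_deriv_unique:
  assumes P: "ns_setting P" and d: "has_space_deriv P k u v" "has_space_deriv P k u v'"
  shows "AE z in cylinder P. v z = v' z"
proof (rule cylinder_eq_from_slices[OF P _ _ disjI1])
  show v: "v \<in> L2 (cylinder P)" "v' \<in> L2 (cylinder P)" using d by (auto simp: has_space_deriv_def)
  have dv: "AE t in interval P. has_weak_deriv (domain P) (axis k 1) (\<lambda>x. u (t, x)) (\<lambda>x. v (t, x))"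
      "AE t in interval P. has_weak_deriv (domain P) (axis k 1) (\<lambda>x. u (t, x)) (\<lambda>x. v' (t, x))"
    using d by (auto simp: has_space_deriv_def)
  show "AE t in interval P. AE x in space_dom P. v (t, x) = v' (t, x)"
    using dv cylinder_slices(1)[OF P v(1)] cylinder_slices(1)[OF P v(2)]
  proof eventually_elim
    case (elim t)
    then show ?case
      unfolding space_dom_def by (intro has_weak_deriv_unique[OF ns_settingD(4)[OF P]])
  qed
qed

lemma has_space_deriv_cong:
  assumes P: "ns_setting P" and u: "u \<in> L2 (cylinder P)" "u' \<in> L2 (cylinder P)"
    and ae: "AE z in cylinder P. u z = u' z" and d: "has_space_deriv P k u v"
  shows "has_space_deriv P k u' v"
proof -
  have v: "v \<in> L2 (cylinder P)"
    and dv: "AE t in interval P. has_weak_deriv (domain P) (axis k 1) (\<lambda>x. u (t, x)) (\<lambda>x. v (t, x))"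
    using d by (auto simp: has_space_deriv_def)
  have "AE t in interval P. has_weak_deriv (domain P) (axis k 1) (\<lambda>x. u' (t, x)) (\<lambda>x. v (t, x))"
    using dv cylinder_slices(1)[OF P u(1)] cylinder_slices(1)[OF P u(2)] cylinder_AE_slices(1)[OF P ae]
    unfolding space_dom_def by eventually_elim (rule has_weak_deriv_cong_AE)
  then show ?thesis using v by (simp add: has_space_deriv_def)
qed

lemma has_time_deriv_linear:
  assumes P: "ns_setting P" and u: "u \<in> L2 (cylinder P)" "u' \<in> L2 (cylinder P)"
    and d: "has_time_deriv P u v" "has_time_deriv P u' v'"
  shows "has_time_deriv P (a *\<^sub>R u + b *\<^sub>R u') (a *\<^sub>R v + b *\<^sub>R v')"
proof -
  have v: "v \<in> L2 (cylinder P)" "v' \<in> L2 (cylinder P)" using d by (auto simp: has_time_deriv_def)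
  show ?thesis
    unfolding has_time_deriv_def
  proof (intro conjI ballI)
    show "a *\<^sub>R v + b *\<^sub>R v' \<in> L2 (cylinder P)" by (rule L2_lincomb[OF v])
    fix \<phi> assume p: "\<phi> \<in> C1c {0<..<horizon P}"
    let ?D = "\<lambda>t. frechet_derivative \<phi> (at t) 1"
    have dv: "AE x in space_dom P. (\<integral>t. ?D t *\<^sub>R u (t, x) \<partial>interval P) = - (\<integral>t. \<phi> t *\<^sub>R v (t, x) \<partial>interval P)"
      "AE x in space_dom P. (\<integral>t. ?D t *\<^sub>R u' (t, x) \<partial>interval P) = - (\<integral>t. \<phi> t *\<^sub>R v' (t, x) \<partial>interval P)"
      using d p by (auto simp: has_time_deriv_def)
    show "AE x in space_dom P. (\<integral>t. ?D t *\<^sub>R (a *\<^sub>R u + b *\<^sub>R u') (t, x) \<partial>interval P)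
        = - (\<integral>t. \<phi> t *\<^sub>R (a *\<^sub>R v + b *\<^sub>R v') (t, x) \<partial>interval P)"
      using dv cylinder_slices(2)[OF P u(1)] cylinder_slices(2)[OF P u(2)]
        cylinder_slices(2)[OF P v(1)] cylinder_slices(2)[OF P v(2)]
    proof eventually_elim
      case (elim x)
      note i = elim(3-6)[unfolded interval_def]
      have "(\<integral>t. ?D t *\<^sub>R (a *\<^sub>R u + b *\<^sub>R u') (t, x) \<partial>interval P)
         = (\<integral>t. a *\<^sub>R (?D t *\<^sub>R u (t, x)) + b *\<^sub>R (?D t *\<^sub>R u' (t, x)) \<partial>interval P)"
        by (simp add: scaleR_add_right mult.commute scaleR_fun_def)
      also have "\<dots> = a *\<^sub>R (\<integral>t. ?D t *\<^sub>R u (t, x) \<partial>interval P) + b *\<^sub>R (\<integral>t. ?D t *\<^sub>R u' (t, x) \<partial>interval P)"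
        using integrable_test(2)[OF i(1) p, of 1] integrable_test(2)[OF i(2) p, of 1] unfolding interval_def
        by (subst Bochner_Integration.integral_add) (simp_all del: scaleR_scaleR)
      also have "\<dots> = - (a *\<^sub>R (\<integral>t. \<phi> t *\<^sub>R v (t, x) \<partial>interval P) + b *\<^sub>R (\<integral>t. \<phi> t *\<^sub>R v' (t, x) \<partial>interval P))"
        using elim(1,2) by simp
      also have "\<dots> = - (\<integral>t. a *\<^sub>R (\<phi> t *\<^sub>R v (t, x)) + b *\<^sub>R (\<phi> t *\<^sub>R v' (t, x)) \<partial>interval P)"
        using integrable_test(1)[OF i(3) p] integrable_test(1)[OF i(4) p] unfolding interval_def
        by (subst Bochner_Integration.integral_add) (simp_all del: scaleR_scaleR)
      also have "\<dots> = - (\<integral>t. \<phi> t *\<^sub>R (a *\<^sub>R v + b *\<^sub>R v') (t, x) \<partial>interval P)"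
        by (simp add: scaleR_add_right mult.commute scaleR_fun_def)
      finally show ?case .
    qed
  qed
qed

text \<open>For a single test function the defining identity holds outside a null set of points \<open>x\<close>. A countable
  separating family needs one null set for all its members, and outside of it the fundamental
  lemma applies to the function of time at \<open>x\<close>.\<close>

lemma has_time_deriv_unique:
  assumes P: "ns_setting P" and d: "has_time_deriv P u v" "has_time_deriv P u v'"
  shows "AE z in cylinder P. v z = v' z"
proof (rule cylinder_eq_from_slices[OF P _ _ disjI2])
  show v: "v \<in> L2 (cylinder P)" "v' \<in> L2 (cylinder P)" using d by (auto simp: has_time_deriv_def)
  let ?T = "{0<..<horizon P}"
  obtain \<Phi> where \<Phi>: "countable \<Phi>" "separating_tests ?T \<Phi>" using countable_separating_tests by blast
  have sub: "\<Phi> \<subseteq> C1c ?T" using \<Phi>(2) by (simp add: separating_tests_def)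
  have "AE x in space_dom P. \<forall>\<phi>\<in>\<Phi>. (\<integral>t. \<phi> t *\<^sub>R v (t, x) \<partial>interval P) = (\<integral>t. \<phi> t *\<^sub>R v' (t, x) \<partial>interval P)"
  proof (rule AE_ball_countable'[OF _ \<Phi>(1)])
    fix \<phi> assume "\<phi> \<in> \<Phi>"
    then have p: "\<phi> \<in> C1c ?T" using sub by auto
    let ?D = "\<lambda>t. frechet_derivative \<phi> (at t) 1"
    have "AE x in space_dom P. (\<integral>t. ?D t *\<^sub>R u (t, x) \<partial>interval P) = - (\<integral>t. \<phi> t *\<^sub>R v (t, x) \<partial>interval P)"
      "AE x in space_dom P. (\<integral>t. ?D t *\<^sub>R u (t, x) \<partial>interval P) = - (\<integral>t. \<phi> t *\<^sub>R v' (t, x) \<partial>interval P)"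
      using d p by (auto simp: has_time_deriv_def)
    then show "AE x in space_dom P. (\<integral>t. \<phi> t *\<^sub>R v (t, x) \<partial>interval P) = (\<integral>t. \<phi> t *\<^sub>R v' (t, x) \<partial>interval P)"
      by eventually_elim simp
  qed
  then show "AE x in space_dom P. AE t in interval P. v (t, x) = v' (t, x)"
    using cylinder_slices(2)[OF P v(1)] cylinder_slices(2)[OF P v(2)]
  proof eventually_elim
    case (elim x)
    note i = elim(2,3)[unfolded interval_def]
    have "AE t in lebesgue_on {0..horizon P}. v (t, x) - v' (t, x) = 0"
    proof (rule AE_zero_if_test_integrals_zero[OF _ _ _ _ _ \<Phi>(2)])
      have "{0..horizon P} - ?T = {0, horizon P}" using ns_settingD(1)[OF P] by auto
      then show "{0..horizon P} - ?T \<in> null_sets lborel" by (simp add: finite_imp_null_set_lborel)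
      show "integrable (lebesgue_on {0..horizon P}) (\<lambda>t. v (t, x) - v' (t, x))" using i by simp
      fix \<phi> assume m: "\<phi> \<in> \<Phi>"
      then have p: "\<phi> \<in> C1c ?T" using sub by auto
      have "(\<integral>t. \<phi> t *\<^sub>R (v (t, x) - v' (t, x)) \<partial>lebesgue_on {0..horizon P})
          = (\<integral>t. \<phi> t *\<^sub>R v (t, x) - \<phi> t *\<^sub>R v' (t, x) \<partial>lebesgue_on {0..horizon P})"
        by (simp add: scaleR_diff_right)
      also have "\<dots> = 0"
        using integrable_test(1)[OF i(1) p] integrable_test(1)[OF i(2) p] elim(1) m by (simp add: interval_def)
      finally show "(\<integral>t. \<phi> t *\<^sub>R (v (t, x) - v' (t, x)) \<partial>lebesgue_on {0..horizon P}) = 0" .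
    qed auto
    then show ?case unfolding interval_def by simp
  qed
qed

lemma has_time_deriv_dt: "u \<in> H1_L2 P \<Longrightarrow> has_time_deriv P u (dt P u)"
  unfolding H1_L2_def dt_def by (auto intro: someI[where P = "has_time_deriv P u"])

lemma has_space_deriv_dx: "u \<in> L2_H1 P \<Longrightarrow> has_space_deriv P k u (dx P k u)"
  unfolding L2_H1_def dx_def by (auto intro: someI_ex[where P = "has_space_deriv P k u"])

lemma has_space_deriv_zero: "ns_setting P \<Longrightarrow> has_space_deriv P k 0 0"
  by (auto simp: has_space_deriv_def has_weak_deriv_def subspace_0[OF subspace_L2])

lemma subspace_lincombI:
  assumes "0 \<in> S" "\<And>x y a b. x \<in> S \<Longrightarrow> y \<in> S \<Longrightarrow> a *\<^sub>R x + b *\<^sub>R y \<in> S"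
  shows "subspace S"
  using assms(1) assms(2)[of _ _ 1 1] assms(2)[of _ _ _ 0] by (intro subspaceI) auto

lemma subspace_L2_H1:
  assumes P: "ns_setting P" shows "subspace (L2_H1 P)"
proof (rule subspace_lincombI)
  show "0 \<in> L2_H1 P"
    using has_space_deriv_zero[OF P] subspace_0[OF subspace_L2] by (auto simp: L2_H1_def)
  show "a *\<^sub>R x + b *\<^sub>R y \<in> L2_H1 P" if x: "x \<in> L2_H1 P" and y: "y \<in> L2_H1 P" for x y a b
    using has_space_deriv_linear[OF P _ _ has_space_deriv_dx[OF x] has_space_deriv_dx[OF y]] x y
    by (auto simp: L2_H1_def L2_lincomb)
qed

lemma L2_H1_cong:
  assumes P: "ns_setting P" and u: "u \<in> L2_H1 P" and u': "u' \<in> L2 (cylinder P)" and ae: "AE z in cylinder P. u z = u' z"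
  shows "u' \<in> L2_H1 P"
proof -
  have uL: "u \<in> L2 (cylinder P)" using u by (simp add: L2_H1_def)
  show ?thesis
    using has_space_deriv_cong[OF P uL u' ae has_space_deriv_dx[OF u]] u' by (auto simp: L2_H1_def)
qed

lemma dx_in_L2: "u \<in> L2_H1 P \<Longrightarrow> dx P k u \<in> L2 (cylinder P)"
  using has_space_deriv_dx by (auto simp: has_space_deriv_def)

text \<open>Membership in \<^const>\<open>L2_H2\<close> provides some derivative that is itself differentiable; the one selected
  by \<^const>\<open>dx\<close> agrees with it almost everywhere, and differentiability does not depend on the
  representative.\<close>

lemma dx_in_L2_H1:
  assumes P: "ns_setting P" and u: "u \<in> L2_H2 P"
  shows "dx P k u \<in> L2_H1 P"
proof -
  have u1: "u \<in> L2_H1 P" using u by (simp add: L2_H2_def)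
  obtain v where v: "v \<in> L2_H1 P" "has_space_deriv P k u v" using u by (auto simp: L2_H2_def)
  show ?thesis
    by (rule L2_H1_cong[OF P v(1) dx_in_L2[OF u1] has_space_deriv_unique[OF P v(2) has_space_deriv_dx[OF u1]]])
qed

lemma dx_linear_AE:
  assumes P: "ns_setting P" and u: "u \<in> L2_H1 P" "u' \<in> L2_H1 P"
  shows "AE z in cylinder P. dx P k (a *\<^sub>R u + b *\<^sub>R u') z = (a *\<^sub>R dx P k u + b *\<^sub>R dx P k u') z"
proof (rule has_space_deriv_unique[OF P])
  have "a *\<^sub>R u + b *\<^sub>R u' \<in> L2_H1 P"
    using u by (intro subspace_add subspace_scale subspace_L2_H1[OF P])
  then show "has_space_deriv P k (a *\<^sub>R u + b *\<^sub>R u') (dx P k (a *\<^sub>R u + b *\<^sub>R u'))"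
    by (rule has_space_deriv_dx)
  show "has_space_deriv P k (a *\<^sub>R u + b *\<^sub>R u') (a *\<^sub>R dx P k u + b *\<^sub>R dx P k u')"
    using u by (intro has_space_deriv_linear[OF P] has_space_deriv_dx) (auto simp: L2_H1_def)
qed

lemma subspace_L2_H2:
  assumes P: "ns_setting P" shows "subspace (L2_H2 P)"
proof (rule subspace_lincombI)
  note S = subspace_L2_H1[OF P]
  show "0 \<in> L2_H2 P"
    using has_space_deriv_zero[OF P] subspace_0[OF S] by (auto simp: L2_H2_def)
  show "a *\<^sub>R x + b *\<^sub>R y \<in> L2_H2 P" if x: "x \<in> L2_H2 P" and y: "y \<in> L2_H2 P" for x y a b
  proof -
    have 1: "x \<in> L2_H1 P" "y \<in> L2_H1 P" "x \<in> L2 (cylinder P)" "y \<in> L2 (cylinder P)"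
      using x y by (auto simp: L2_H2_def L2_H1_def)
    have "has_space_deriv P k (a *\<^sub>R x + b *\<^sub>R y) (a *\<^sub>R dx P k x + b *\<^sub>R dx P k y)" for k
      by (intro has_space_deriv_linear[OF P] has_space_deriv_dx 1)
    moreover have "a *\<^sub>R dx P k x + b *\<^sub>R dx P k y \<in> L2_H1 P" for k
      by (intro subspace_add[OF S] subspace_scale[OF S] dx_in_L2_H1[OF P] x y)
    moreover have "a *\<^sub>R x + b *\<^sub>R y \<in> L2_H1 P"
      by (intro subspace_add[OF S] subspace_scale[OF S] 1)
    ultimately show ?thesis by (auto simp: L2_H2_def)
  qed
qed

lemma dx_dx_linear_AE:
  assumes P: "ns_setting P" and u: "u \<in> L2_H2 P" "u' \<in> L2_H2 P"
  shows "AE z in cylinder P. dx P l (dx P k (a *\<^sub>R u + b *\<^sub>R u')) z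
     = (a *\<^sub>R dx P l (dx P k u) + b *\<^sub>R dx P l (dx P k u')) z"
proof (rule has_space_deriv_unique[OF P])
  note S = subspace_L2_H1[OF P] and S2 = subspace_L2_H2[OF P]
  have s: "a *\<^sub>R u + b *\<^sub>R u' \<in> L2_H2 P" by (intro subspace_add[OF S2] subspace_scale[OF S2] u)
  then have s1: "dx P k (a *\<^sub>R u + b *\<^sub>R u') \<in> L2_H1 P" by (rule dx_in_L2_H1[OF P])
  then show "has_space_deriv P l (dx P k (a *\<^sub>R u + b *\<^sub>R u')) (dx P l (dx P k (a *\<^sub>R u + b *\<^sub>R u')))"
    by (rule has_space_deriv_dx)
  have d: "dx P k u \<in> L2_H1 P" "dx P k u' \<in> L2_H1 P" using u by (auto intro: dx_in_L2_H1[OF P])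
  then have dL: "dx P k u \<in> L2 (cylinder P)" "dx P k u' \<in> L2 (cylinder P)" by (auto simp: L2_H1_def)
  have 1: "has_space_deriv P l (a *\<^sub>R dx P k u + b *\<^sub>R dx P k u') (a *\<^sub>R dx P l (dx P k u) + b *\<^sub>R dx P l (dx P k u'))"
    by (intro has_space_deriv_linear[OF P] has_space_deriv_dx d dL)
  have u1: "u \<in> L2_H1 P" "u' \<in> L2_H1 P" using u by (auto simp: L2_H2_def)
  have ae: "AE z in cylinder P. (a *\<^sub>R dx P k u + b *\<^sub>R dx P k u') z = dx P k (a *\<^sub>R u + b *\<^sub>R u') z"
    using dx_linear_AE[OF P u1, of k a b] by eventually_elim simp
  show "has_space_deriv P l (dx P k (a *\<^sub>R u + b *\<^sub>R u')) (a *\<^sub>R dx P l (dx P k u) + b *\<^sub>R dx P l (dx P k u'))"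
    by (rule has_space_deriv_cong[OF P L2_lincomb[OF dL] _ ae 1]) (use s1 in \<open>simp add: L2_H1_def\<close>)
qed

lemma subspace_H1_L2:
  assumes P: "ns_setting P" shows "subspace (H1_L2 P)"
proof (rule subspace_lincombI)
  have "has_time_deriv P 0 0"
    by (auto simp: has_time_deriv_def subspace_0[OF subspace_L2])
  then show "0 \<in> H1_L2 P" using subspace_0[OF subspace_L2] by (auto simp: H1_L2_def)
  show "a *\<^sub>R x + b *\<^sub>R y \<in> H1_L2 P" if x: "x \<in> H1_L2 P" and y: "y \<in> H1_L2 P" for x y a b
    using has_time_deriv_linear[OF P _ _ has_time_deriv_dt[OF x] has_time_deriv_dt[OF y]] x y
    by (auto simp: H1_L2_def L2_lincomb)
qed

lemma dt_linear_AE: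
  assumes P: "ns_setting P" and u: "u \<in> H1_L2 P" "u' \<in> H1_L2 P"
  shows "AE z in cylinder P. dt P (a *\<^sub>R u + b *\<^sub>R u') z = (a *\<^sub>R dt P u + b *\<^sub>R dt P u') z"
proof (rule has_time_deriv_unique[OF P])
  have "a *\<^sub>R u + b *\<^sub>R u' \<in> H1_L2 P"
    using u by (intro subspace_add subspace_scale subspace_H1_L2[OF P])
  then show "has_time_deriv P (a *\<^sub>R u + b *\<^sub>R u') (dt P (a *\<^sub>R u + b *\<^sub>R u'))"
    by (rule has_time_deriv_dt)
  show "has_time_deriv P (a *\<^sub>R u + b *\<^sub>R u') (a *\<^sub>R dt P u + b *\<^sub>R dt P u')"
    using u by (intro has_time_deriv_linear[OF P] has_time_deriv_dt) (auto simp: H1_L2_def)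
qed

lemma semi_inner_L2_pullback:
  assumes S: "subspace S" and T: "\<And>u. u \<in> S \<Longrightarrow> T u \<in> L2 M"
    and lin: "\<And>u u' a b. u \<in> S \<Longrightarrow> u' \<in> S \<Longrightarrow> AE z in M. T (a *\<^sub>R u + b *\<^sub>R u') z = (a *\<^sub>R T u + b *\<^sub>R T u') z"
  shows "semi_inner S (\<lambda>u u'. L2_inner M (T u) (T u'))"
proof (rule semi_inner_pullback[OF semi_inner_L2 S T])
  fix x y a b assume xy: "x \<in> S" "y \<in> S"
  have "AE z in M. (T (a *\<^sub>R x + b *\<^sub>R y) - (a *\<^sub>R T x + b *\<^sub>R T y)) z = 0"
    using lin[OF xy, of a b] by eventually_elim simp
  then show "L2_inner M (T (a *\<^sub>R x + b *\<^sub>R y) - (a *\<^sub>R T x + b *\<^sub>R T y)) (T (a *\<^sub>R x + b *\<^sub>R y) - (a *\<^sub>R T x + b *\<^sub>R T y)) = 0"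
    by (rule L2_inner_zero_AE)
qed

text \<open>The form whose square root is \<^const>\<open>pressure_norm\<close>.\<close>

definition pressure_inner :: "('n::finite) ns_data \<Rightarrow> 'n pressure \<Rightarrow> 'n pressure \<Rightarrow> real" where
  "pressure_inner P p p' = L2_inner (cylinder P) p p' +
     (\<Sum>k\<in>UNIV. L2_inner (cylinder P) (dx P k p) (dx P k p'))"

text \<open>The form whose square root is \<^const>\<open>velocity_norm\<close>; the term without derivatives occurs twice, once
  for each of the two Bochner spaces.\<close>

definition velocity_inner :: "('n::finite) ns_data \<Rightarrow> 'n velocity \<Rightarrow> 'n velocity \<Rightarrow> real" where
  "velocity_inner P u u' =
     (L2_inner (cylinder P) u u' + L2_inner (cylinder P) (dt P u) (dt P u')) +
     (L2_inner (cylinder P) u u' + (\<Sum>k\<in>UNIV. L2_inner (cylinder P) (dx P k u) (dx P k u')) +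
      (\<Sum>k\<in>UNIV. \<Sum>l\<in>UNIV. L2_inner (cylinder P) (dx P l (dx P k u)) (dx P l (dx P k u'))))"

lemma semi_inner_pressure:
  assumes P: "ns_setting P"
  shows "semi_inner (fst (pressure_space P)) (pressure_inner P)"
proof -
  note S = subspace_L2_H1[OF P]
  show ?thesis
    unfolding pressure_inner_def[abs_def] pressure_space_def fst_conv
    by (intro semi_inner_add semi_inner_sum_forms S finite semi_inner_L2_pullback dx_in_L2 dx_linear_AE[OF P]
        semi_inner_L2_pullback[where T = "\<lambda>u. u"])
      (auto simp: L2_H1_def)
qed

lemma semi_inner_velocity:
  assumes P: "ns_setting P"
  shows "semi_inner (fst (velocity_space P)) (velocity_inner P)"
proof -
  have S: "subspace (H1_L2 P \<inter> L2_H2 P)"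
    by (intro subspace_inter subspace_H1_L2[OF P] subspace_L2_H2[OF P])
  have mem: "u \<in> H1_L2 P" "u \<in> L2_H2 P" "u \<in> L2_H1 P" "u \<in> L2 (cylinder P)" if "u \<in> H1_L2 P \<inter> L2_H2 P" for u
    using that by (auto simp: L2_H2_def L2_H1_def)
  have dtL: "dt P u \<in> L2 (cylinder P)" if "u \<in> H1_L2 P" for u
    using has_time_deriv_dt[OF that] by (simp add: has_time_deriv_def)
  show ?thesis
    unfolding velocity_inner_def[abs_def] velocity_space_def fst_conv
    by (intro semi_inner_add semi_inner_sum_forms S finite semi_inner_L2_pullback[OF S]
        semi_inner_L2_pullback[OF S, where T = "\<lambda>u. u"] dx_dx_linear_AE[OF P] dx_linear_AE[OF P] dt_linear_AE[OF P]
        dx_in_L2 dx_in_L2_H1[OF P] dtL mem AE_I2 refl)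
qed

lemma pressure_norm_eq: "pressure_norm P = (\<lambda>p. sqrt (pressure_inner P p p))"
  by (simp add: fun_eq_iff pressure_norm_def pressure_inner_def L2_norm_square)

lemma velocity_norm_eq: "velocity_norm P = (\<lambda>u. sqrt (velocity_inner P u u))"
  by (simp add: fun_eq_iff velocity_norm_def velocity_inner_def L2_norm_square)

lemma seminormed_pressure: "ns_setting P \<Longrightarrow> seminormed (pressure_space P)"
  using semi_inner_imp_seminormed[OF semi_inner_pressure, of P]
  by (simp add: pressure_space_def pressure_norm_eq)

lemma seminormed_velocity: "ns_setting P \<Longrightarrow> seminormed (velocity_space P)"
  using semi_inner_imp_seminormed[OF semi_inner_velocity, of P]
  by (simp add: velocity_space_def velocity_norm_eq)

lemma seminormed_H:
  fixes P :: "('n::finite) ns_data"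
  assumes P: "ns_setting P"
  shows "seminormed (H_space P)"
proof -
  let ?V = "fst (velocity_space P)" and ?Q = "fst (pressure_space P)"
  note V = semi_inner_velocity[OF P] and Q = semi_inner_pressure[OF P]
  have S: "subspace (H_carrier P)"
    unfolding H_carrier_def by (intro subspace_Times semi_innerD(1)[OF V] semi_innerD(1)[OF Q])
  have z: "velocity_inner P 0 0 = 0" "pressure_inner P 0 0 = 0"
    using semi_innerD(5)[OF V, of 0 0 0] subspace_0[OF semi_innerD(1)[OF V]]
      semi_innerD(5)[OF Q, of 0 0 0] subspace_0[OF semi_innerD(1)[OF Q]] by simp_all
  have "semi_inner (H_carrier P) (\<lambda>w w'. velocity_inner P (fst w) (fst w'))"
    by (rule semi_inner_pullback[OF V S, where T = fst]) (auto simp: H_carrier_def z)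
  moreover have "semi_inner (H_carrier P) (\<lambda>w w'. pressure_inner P (snd w) (snd w'))"
    by (rule semi_inner_pullback[OF Q S, where T = snd]) (auto simp: H_carrier_def z)
  ultimately have "semi_inner (H_carrier P) (\<lambda>w w'. velocity_inner P (fst w) (fst w') + pressure_inner P (snd w) (snd w'))"
    by (rule semi_inner_add)
  from semi_inner_imp_seminormed[OF this] 
  have "seminormed (H_carrier P, \<lambda>w. sqrt (velocity_inner P (fst w) (fst w) + pressure_inner P (snd w) (snd w)))" .
  moreover have "snd (H_space P) w = sqrt (velocity_inner P (fst w) (fst w) + pressure_inner P (snd w) (snd w))"
    if "w \<in> H_carrier P" for w
    using that semi_innerD(7)[OF V, of "fst w"] semi_innerD(7)[OF Q, of "snd w"]
    by (simp add: H_space_def H_norm_def velocity_norm_eq pressure_norm_eq H_carrier_def mem_Times_iff)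
  ultimately show ?thesis
    unfolding seminormed_def H_space_def fst_conv snd_conv
    by (metis S subspace_add subspace_scale)
qed

section \<open>Energy, metric and loss gradient\<close>

lemma semi_inner_Q: "semi_inner (Q_carrier P) (Q_inner P)"
proof -
  have S: "subspace (Q_carrier P)"
    unfolding Q_carrier_def by (intro subspace_Times subspace_L2)
  have eq: "Q_inner P = (\<lambda>r s. L2_inner (cylinder P) (fst r) (fst s) +
      L2_inner (cylinder P) (fst (snd r)) (fst (snd s)) +
      L2_inner (lateral P) (fst (snd (snd r))) (fst (snd (snd s))) +
      L2_inner (space_dom P) (snd (snd (snd r))) (snd (snd (snd s))))"
    by (auto simp: Q_inner_def fun_eq_iff)
  show ?thesis
    unfolding eq
    by (intro semi_inner_add
        semi_inner_L2_pullback[OF S, where T = fst]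
        semi_inner_L2_pullback[OF S, where T = "\<lambda>r. fst (snd r)"]
        semi_inner_L2_pullback[OF S, where T = "\<lambda>r. fst (snd (snd r))"]
        semi_inner_L2_pullback[OF S, where T = "\<lambda>r. snd (snd (snd r))"])
      (auto simp: Q_carrier_def)
qed

lemma Q_space_eq: "Q_space P = (Q_carrier P, \<lambda>r. sqrt (Q_inner P r r))"
  by (simp add: Q_space_def Q_norm_def[abs_def])

lemma fst_H_space [simp]: "fst (H_space P) = H_carrier P"
  and snd_H_space [simp]: "snd (H_space P) = H_norm P"
  by (simp_all add: H_space_def)

lemma subspace_H: "ns_setting P \<Longrightarrow> subspace (H_carrier P)"
  using seminormed_subspace[OF seminormed_H] by simp

lemma has_frechet_deriv_residual:
  assumes "residual_smooth P" "w \<in> H_carrier P"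
  shows "has_frechet_deriv (H_space P) (Q_space P) (residual P) (DR P w) w"
  using assms unfolding residual_smooth_def DR_def by (blast intro: has_frechet_deriv_frechet_deriv)

text \<open>The metric is the inner product of the residual space pulled back by the derivative of the residual.\<close>

lemma semi_inner_metric:
  assumes P: "ns_setting P" and R: "residual_smooth P" and w: "w \<in> H_carrier P"
  shows "semi_inner (H_carrier P) (metric P w)"
proof -
  note D = has_frechet_derivD(1)[OF has_frechet_deriv_residual[OF R w]]
  have Dc: "DR P w x \<in> Q_carrier P" if "x \<in> H_carrier P" for x
    using bounded_linear_intoD(1)[OF D] that by (simp add: Q_space_eq)
  have "semi_inner (H_carrier P) (\<lambda>x y. Q_inner P (DR P w x) (DR P w y))"
    by (rule semi_inner_pullback[OF semi_inner_Q subspace_H[OF P] Dc])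
      (use bounded_linear_intoD(2)[OF D] in \<open>simp_all add: Q_space_eq\<close>)
  then show ?thesis by (simp add: metric_def[abs_def])
qed

text \<open>Chain rule for half the squared norm after the residual; this shows that the derivative chosen by
  \<^const>\<open>DE\<close> exists.\<close>

lemma has_frechet_deriv_energy:
  assumes P: "ns_setting P" and R: "residual_smooth P" and w: "w \<in> H_carrier P"
  shows "has_frechet_deriv (H_space P) normed_UNIV (energy P) (DE P w) w"
proof -
  have Q: "seminormed (Q_space P)" unfolding Q_space_eq by (rule semi_inner_imp_seminormed[OF semi_inner_Q])
  have res: "residual P x \<in> Q_carrier P" if "x \<in> H_carrier P" for x
    using R that by (simp add: residual_smooth_def)
  have en: "energy P = (\<lambda>x. 1/2 * Q_inner P (residual P x) (residual P x))"
    using semi_innerD(7)[OF semi_inner_Q]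
    by (auto simp: energy_def fun_eq_iff Q_norm_def Q_inner_def L2_inner_nonneg split: prod.split)
  have "has_frechet_deriv (H_space P) normed_UNIV (\<lambda>x. (\<lambda>y. 1/2 * Q_inner P y y) (residual P x))
      (\<lambda>h. Q_inner P (residual P w) (DR P w h)) w"
  proof (rule has_frechet_deriv_chain_real[OF seminormed_H[OF P] Q _ has_frechet_deriv_residual[OF R w]])
    show "residual P (w + h) \<in> fst (Q_space P)" if "h \<in> fst (H_space P)" for h
      using that w subspace_add[OF subspace_H[OF P]] by (simp add: Q_space_eq res)
    show "has_frechet_deriv (Q_space P) normed_UNIV (\<lambda>y. 1/2 * Q_inner P y y) (Q_inner P (residual P w)) (residual P w)"
      unfolding Q_space_eq by (rule has_frechet_deriv_half_square[OF semi_inner_Q res[OF w]])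
  qed
  then show ?thesis unfolding DE_def en by (rule has_frechet_deriv_frechet_deriv)
qed

lemma H_norm_le:
  assumes P: "ns_setting P" and "a \<in> fst (velocity_space P)" "b \<in> fst (pressure_space P)"
  shows "H_norm P (a, b) \<le> velocity_norm P a + pressure_norm P b"
  using seminormed_nonneg[OF seminormed_velocity[OF P] assms(2)]
    seminormed_nonneg[OF seminormed_pressure[OF P] assms(3)]
  by (simp add: H_norm_def velocity_space_def pressure_space_def sqrt_sum_squares_le_sum)

lemma H_norm_velocity:
  assumes P: "ns_setting P" and "a \<in> fst (velocity_space P)"
  shows "H_norm P (a, 0) = velocity_norm P a"
  using seminormed_nonneg[OF seminormed_velocity[OF P] assms(2)] seminormed_zero[OF seminormed_pressure[OF P]]
  by (simp add: H_norm_def velocity_space_def pressure_space_def)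

lemma H_norm_pressure:
  assumes P: "ns_setting P" and "b \<in> fst (pressure_space P)"
  shows "H_norm P (0, b) = pressure_norm P b"
  using seminormed_nonneg[OF seminormed_pressure[OF P] assms(2)] seminormed_zero[OF seminormed_velocity[OF P]]
  by (simp add: H_norm_def velocity_space_def pressure_space_def)

text \<open>Composition with an affine isometry. It turns a family of velocities into a family of states with the
  pressure held fixed, and likewise for pressures.\<close>

lemma has_frechet_deriv_embed:
  assumes Y: "seminormed Y" and X: "fst X = UNIV"
    and J: "\<And>y. y \<in> fst Y \<Longrightarrow> J y \<in> fst Z" "\<And>y. y \<in> fst Y \<Longrightarrow> snd Z (J y) = snd Y y"
    and lin: "\<And>x y. J (x - y) = J x - J y" "\<And>a b x y. J (a *\<^sub>R x + b *\<^sub>R y) = a *\<^sub>R J x + b *\<^sub>R J y"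
    and F: "\<And>x. F x \<in> fst Y" and D: "has_frechet_deriv X Y F A x"
  shows "has_frechet_deriv X Z (\<lambda>x. c + J (F x)) (\<lambda>h. J (A h)) x"
proof -
  note Ab = has_frechet_derivD(1)[OF D]
  note Y' = subspace_add[OF seminormed_subspace[OF Y]] subspace_scale[OF seminormed_subspace[OF Y]]
    subspace_diff[OF seminormed_subspace[OF Y]]
  have A: "A h \<in> fst Y" for h using bounded_linear_intoD(1)[OF Ab] X by simp
  have "bounded_linear_into X Z (\<lambda>h. J (A h))"
    unfolding bounded_linear_into_def
  proof (intro conjI ballI allI)
    fix h k a b
    show "J (A h) \<in> fst Z" using A J(1) by simp
    have "J (A (a *\<^sub>R h + b *\<^sub>R k)) - (a *\<^sub>R J (A h) + b *\<^sub>R J (A k)) = J (A (a *\<^sub>R h + b *\<^sub>R k) - (a *\<^sub>R A h + b *\<^sub>R A k))"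
      by (simp add: lin)
    then show "snd Z (J (A (a *\<^sub>R h + b *\<^sub>R k)) - (a *\<^sub>R J (A h) + b *\<^sub>R J (A k))) = 0"
      using J(2) A Y' bounded_linear_intoD(2)[OF Ab, of h k a b] X by simp
  next
    show "\<exists>C. \<forall>h\<in>fst X. snd Z (J (A h)) \<le> C * snd X h"
      using Ab A J(2) by (simp add: bounded_linear_into_def)
  qed
  moreover have "snd Z (c + J (F (x + h)) - (c + J (F x)) - J (A h)) = snd Y (F (x + h) - F x - A h)" for h
  proof -
    have "c + J (F (x + h)) - (c + J (F x)) - J (A h) = J (F (x + h) - F x - A h)" by (simp add: lin)
    then show ?thesis using J(2) A F Y' by simp
  qed
  ultimately show ?thesis using D by (simp add: has_frechet_deriv_def)
qed

lemma has_frechet_deriv_velocity_state: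
  assumes P: "ns_setting P" and u: "\<And>\<theta>. u \<theta> \<in> fst (velocity_space P)"
    and D: "has_frechet_deriv normed_UNIV (velocity_space P) u A \<theta>"
  shows "has_frechet_deriv normed_UNIV (H_space P) (\<lambda>\<theta>. (u \<theta>, q)) (\<lambda>h. (A h, 0)) \<theta>"
proof -
  have "has_frechet_deriv normed_UNIV (H_space P) (\<lambda>\<theta>. (0, q) + (u \<theta>, 0)) (\<lambda>h. (A h, 0)) \<theta>"
    by (rule has_frechet_deriv_embed[OF seminormed_velocity[OF P] _ _ _ _ _ u D, where J = "\<lambda>a. (a, 0)"])
      (use subspace_0[OF seminormed_subspace[OF seminormed_pressure[OF P]]] in
        \<open>auto simp: normed_UNIV_def H_carrier_def H_norm_velocity[OF P] velocity_space_def\<close>)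
  then show ?thesis by simp
qed

lemma has_frechet_deriv_pressure_state:
  assumes P: "ns_setting P" and p: "\<And>\<psi>. p \<psi> \<in> fst (pressure_space P)"
    and D: "has_frechet_deriv normed_UNIV (pressure_space P) p A \<psi>"
  shows "has_frechet_deriv normed_UNIV (H_space P) (\<lambda>\<psi>. (v, p \<psi>)) (\<lambda>h. (0, A h)) \<psi>"
proof -
  have "has_frechet_deriv normed_UNIV (H_space P) (\<lambda>\<psi>. (v, 0) + (0, p \<psi>)) (\<lambda>h. (0, A h)) \<psi>"
    by (rule has_frechet_deriv_embed[OF seminormed_pressure[OF P] _ _ _ _ _ p D, where J = "\<lambda>b. (0, b)"])
      (use subspace_0[OF seminormed_subspace[OF seminormed_velocity[OF P]]] in
        \<open>auto simp: normed_UNIV_def H_carrier_def H_norm_pressure[OF P] pressure_space_def\<close>)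
  then show ?thesis by simp
qed

text \<open>The partial derivatives of the loss are the energy derivative in the directions of the tangent
  vectors.\<close>

lemma gradient_energy_chain:
  fixes F :: "real^'m \<Rightarrow> ('n::finite) state"
  assumes P: "ns_setting P" and R: "residual_smooth P" and F: "\<And>x. F x \<in> H_carrier P"
    and D: "has_frechet_deriv normed_UNIV (H_space P) F A x"
  shows "gradient (\<lambda>x. energy P (F x)) x $ i = DE P (F x) (A (axis i 1))"
proof -
  have "has_frechet_deriv normed_UNIV normed_UNIV (\<lambda>x. energy P (F x)) (\<lambda>h. DE P (F x) (A h)) x"
    by (rule has_frechet_deriv_chain_real[OF seminormed_normed_UNIV seminormed_H[OF P] _ D
          has_frechet_deriv_energy[OF P R F]]) (simp add: F)
  from fun_cong[OF frechet_derivative_at[OF has_frechet_deriv_imp_has_derivative[OF this]], of "axis i 1"]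
  show ?thesis by (simp add: gradient_def)
qed

text \<open>Both families of tangent vectors, indexed like the rows of the Gauss-Newton matrix, which thereby
  becomes a single Gram matrix.\<close>

definition tangent_vector ::
    "('n::finite) ns_data \<Rightarrow> (real^'p \<Rightarrow> 'n velocity) \<Rightarrow> (real^'q \<Rightarrow> 'n pressure) \<Rightarrow>
     real^'p \<Rightarrow> real^'q \<Rightarrow> 'p + 'q \<Rightarrow> 'n state" where
  "tangent_vector P u p \<theta> \<psi> = case_sum (velocity_tangent P u \<theta>) (pressure_tangent P p \<psi>)"

lemma tangent_space_eq: "tangent_space P u p \<theta> \<psi> = span (range (tangent_vector P u p \<theta> \<psi>))"
  by (simp add: tangent_space_def tangent_vector_def UNIV_sum image_Un image_image flip: UNIV_Plus_UNIV)

lemma sum_UNIV_sum: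
  fixes f :: "'p::finite + 'q::finite \<Rightarrow> 'b::comm_monoid_add"
  shows "sum f UNIV = (\<Sum>i\<in>UNIV. f (Inl i)) + (\<Sum>j\<in>UNIV. f (Inr j))"
  by (simp add: sum.Plus flip: UNIV_Plus_UNIV)

lemma norm_block_vec: "(norm (block_vec a b))\<^sup>2 = (norm a)\<^sup>2 + (norm b)\<^sup>2"
  by (simp add: power2_norm_eq_inner inner_vec_def block_vec_def sum_UNIV_sum)

lemma block_vec_diff: "block_vec a b - block_vec c d = block_vec (a - c) (b - d)"
  by (simp add: block_vec_def vec_eq_iff split: sum.split)

section \<open>The Gauss-Newton step\<close>

text \<open>The vector with the Gauss-Newton step as coefficients solves the projection problem. The projection
  \<^const>\<open>orth_proj\<close> is chosen among all solutions, so that the two agree up to seminorm zero by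
  definiteness of the metric on the tangent space, to which their difference belongs.\<close>

lemma gn_step_is_projection:
  fixes P :: "('n::finite) ns_data"
    and u :: "real^'p \<Rightarrow> 'n velocity"
    and p :: "real^'q \<Rightarrow> 'n pressure"
  assumes P: "ns_setting P" and R: "residual_smooth P"
    and u: "\<And>\<theta>. u \<theta> \<in> fst (velocity_space P)" and p: "\<And>\<psi>. p \<psi> \<in> fst (pressure_space P)"
    and Du: "has_frechet_deriv normed_UNIV (velocity_space P) u (frechet_deriv normed_UNIV (velocity_space P) u \<theta>) \<theta>"
    and Dp: "has_frechet_deriv normed_UNIV (pressure_space P) p (frechet_deriv normed_UNIV (pressure_space P) p \<psi>) \<psi>"
    and d: "gn_direction P (u \<theta>, p \<psi>) d"
    and def: "metric_definite_on P (u \<theta>, p \<psi>) (tangent_space P u p \<theta> \<psi>)"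
  defines "v \<equiv> \<Sum>r\<in>UNIV. gn_step P u p \<theta> \<psi> $ r *\<^sub>R tangent_vector P u p \<theta> \<psi> r"
    and "\<pi> \<equiv> orth_proj P (u \<theta>, p \<psi>) (tangent_space P u p \<theta> \<psi>) d"
  shows "v \<in> H_carrier P" "\<pi> \<in> H_carrier P" "H_norm P (v - \<pi>) = 0"
proof -
  let ?w = "(u \<theta>, p \<psi>)" and ?e = "tangent_vector P u p \<theta> \<psi>" and ?T = "tangent_space P u p \<theta> \<psi>"
  have H: "(a, b) \<in> H_carrier P \<longleftrightarrow> a \<in> fst (velocity_space P) \<and> b \<in> fst (pressure_space P)" for a b
    by (auto simp: H_carrier_def)
  have w: "?w \<in> H_carrier P" using u p H by simp
  note M = semi_inner_metric[OF P R w]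
  have zero: "0 \<in> fst (velocity_space P)" "0 \<in> fst (pressure_space P)"
    using subspace_0[OF seminormed_subspace[OF seminormed_velocity[OF P]]]
      subspace_0[OF seminormed_subspace[OF seminormed_pressure[OF P]]] by auto
  have pd: "param_deriv (velocity_space P) u i \<theta> \<in> fst (velocity_space P)"
      "param_deriv (pressure_space P) p j \<psi> \<in> fst (pressure_space P)" for i j
    using bounded_linear_intoD(1)[OF has_frechet_derivD(1)[OF Du]] bounded_linear_intoD(1)[OF has_frechet_derivD(1)[OF Dp]]
    by (auto simp: param_deriv_def normed_UNIV_def)
  have e: "?e r \<in> H_carrier P" for r
    by (auto simp: tangent_vector_def velocity_tangent_def pressure_tangent_def H pd zero split: sum.split)

  have dH: "d \<in> H_carrier P" and dd: "\<And>\<delta>. \<delta> \<in> H_carrier P \<Longrightarrow> metric P ?w d \<delta> = DE P ?w \<delta>"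
    using d by (auto simp: gn_direction_def gn_operator_def metric_def)
  have G: "gn_matrix P u p \<theta> \<psi> = (\<chi> r s. metric P ?w (?e r) (?e s))"
    using semi_innerD(2)[OF M e e, of "Inr _" "Inl _"]
    by (auto simp: gn_matrix_def Let_def vec_eq_iff tangent_vector_def split: sum.split)
  have gu: "gradient (\<lambda>\<theta>'. loss P u p \<theta>' \<psi>) \<theta> $ i = DE P ?w (?e (Inl i))" for i
    unfolding loss_def
    by (subst gradient_energy_chain[OF P R _ has_frechet_deriv_velocity_state[OF P u Du]])
      (use u p H in \<open>auto simp: tangent_vector_def velocity_tangent_def param_deriv_def\<close>)
  have gp: "gradient (\<lambda>\<psi>'. loss P u p \<theta> \<psi>') \<psi> $ j = DE P ?w (?e (Inr j))" for j
    unfolding loss_def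
    by (subst gradient_energy_chain[OF P R _ has_frechet_deriv_pressure_state[OF P p Dp]])
      (use u p H in \<open>auto simp: tangent_vector_def pressure_tangent_def param_deriv_def\<close>)
  have b: "loss_gradient P u p \<theta> \<psi> = (\<chi> r. metric P ?w d (?e r))"
    by (auto simp: loss_gradient_def block_vec_def vec_eq_iff gu gp dd e split: sum.split)
  have v: "v = (\<Sum>r\<in>UNIV. (pinv (gn_matrix P u p \<theta> \<psi>) *v loss_gradient P u p \<theta> \<psi>) $ r *\<^sub>R ?e r)"
    by (simp add: v_def gn_step_def)
  note proj = gram_projection[OF M e dH G b v, folded tangent_space_eq]
  have "\<pi> \<in> ?T \<and> (\<forall>s\<in>?T. metric P ?w (d - \<pi>) s = 0)"
    unfolding \<pi>_def orth_proj_def by (rule someI[of _ v]) (use proj in auto)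
  then have pi: "\<pi> \<in> ?T" "\<And>s. s \<in> ?T \<Longrightarrow> metric P ?w (d - \<pi>) s = 0" by auto
  have TH: "?T \<subseteq> H_carrier P"
    unfolding tangent_space_eq using e by (intro span_minimal subspace_H[OF P]) auto
  then show vH: "v \<in> H_carrier P" and piH: "\<pi> \<in> H_carrier P" using proj(1) pi(1) by auto
  have vp: "v - \<pi> \<in> ?T" using proj(1) pi(1) unfolding tangent_space_eq by (rule span_diff)
  have "metric P ?w (v - \<pi>) (v - \<pi>) = metric P ?w ((d - \<pi>) - (d - v)) (v - \<pi>)" by simp
  also have "\<dots> = 0"
    using semi_innerD(8)[OF M, of "d - \<pi>" "d - v" "v - \<pi>"] dH vH piH vp TH pi(2)[OF vp] proj(2)[OF vp]
      subspace_diff[OF subspace_H[OF P]] by auto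
  finally show "H_norm P (v - \<pi>) = 0" using def vp by (simp add: metric_definite_on_def)
qed

text \<open>The error is what the update leaves over after the projected direction. In its norm the projection
  may be replaced by the tangent vector \<open>v\<close> of the step, which leaves the Taylor remainders of velocity
  and pressure; the length of the parameter increment is \<open>\<eta>\<close> times the length of the step.\<close>

theorem theorem3p2:
  fixes P :: "('n::finite) ns_data"
    and u :: "real^'p \<Rightarrow> 'n velocity"
    and p :: "real^'q \<Rightarrow> 'n pressure"
    and K :: "((real^'p) \<times> (real^'q)) set"
  assumes "ns_setting P" and "residual_smooth P"
    and "Ck_into 2 (velocity_space P) u" and "Ck_into 2 (pressure_space P) p"
    and "bounded K"
  shows "\<exists>C\<ge>0. \<forall>\<eta> \<theta> \<psi> d.
    gn_iteration P u p \<eta> \<theta> \<psi> \<longrightarrow>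
    (\<forall>k. gn_direction P (u (\<theta> k), p (\<psi> k)) (d k)) \<longrightarrow>
    (\<forall>k. metric_definite_on P (u (\<theta> k), p (\<psi> k)) (tangent_space P u p (\<theta> k) (\<psi> k))) \<longrightarrow>
    (\<exists>\<epsilon>. \<forall>k.
       \<epsilon> k \<in> H_carrier P \<and>
       (u (\<theta> (Suc k)), p (\<psi> (Suc k))) =
         (u (\<theta> k), p (\<psi> k))
         - \<eta> k *\<^sub>R orth_proj P (u (\<theta> k), p (\<psi> k)) (tangent_space P u p (\<theta> k) (\<psi> k)) (d k)
         + \<epsilon> k \<and>
       ((\<theta> k, \<psi> k) \<in> K \<and> (\<theta> (Suc k), \<psi> (Suc k)) \<in> K \<longrightarrow>
         H_norm P (\<epsilon> k) \<le> C * ((\<eta> k)\<^sup>2 * (norm (gn_step P u p (\<theta> k) (\<psi> k)))\<^sup>2)))"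
proof -
  note P = assms(1) and R = assms(2)
  obtain r where r: "\<And>z. z \<in> K \<Longrightarrow> norm z \<le> r" using assms(5) by (auto simp: bounded_iff)
  have rK: "norm a \<le> r" "norm b \<le> r" if "(a, b) \<in> K" for a b
    using r[OF that] norm_fst_le[of a b] norm_snd_le[of b a] by linarith+
  obtain C1 where C1: "C1 \<ge> 0" "\<And>x y. norm x \<le> r \<Longrightarrow> norm y \<le> r \<Longrightarrow>
     velocity_norm P (u y - u x - (\<Sum>i\<in>UNIV. (y - x) $ i *\<^sub>R param_deriv (velocity_space P) u i x)) \<le> C1 * (norm (y - x))\<^sup>2"
    using frechet_taylor_bound[OF seminormed_velocity[OF P] assms(3), of r] by (auto simp: velocity_space_def)
  obtain C2 where C2: "C2 \<ge> 0" "\<And>x y. norm x \<le> r \<Longrightarrow> norm y \<le> r \<Longrightarrow>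
     pressure_norm P (p y - p x - (\<Sum>i\<in>UNIV. (y - x) $ i *\<^sub>R param_deriv (pressure_space P) p i x)) \<le> C2 * (norm (y - x))\<^sup>2"
    using frechet_taylor_bound[OF seminormed_pressure[OF P] assms(4), of r] by (auto simp: pressure_space_def)
  note u = Ck_into_has_deriv[OF assms(3)[unfolded numeral_2_eq_2]]
  note p = Ck_into_has_deriv[OF assms(4)[unfolded numeral_2_eq_2]]
  note H' = subspace_add[OF subspace_H[OF P]] subspace_diff[OF subspace_H[OF P]] subspace_scale[OF subspace_H[OF P]]
  show ?thesis
  proof (intro exI[of _ "C1 + C2"] conjI allI impI)
    show "0 \<le> C1 + C2" using C1 C2 by simp
    fix \<eta> :: "nat \<Rightarrow> real" and \<theta> :: "nat \<Rightarrow> real^'p" and \<psi> :: "nat \<Rightarrow> real^'q" and d :: "nat \<Rightarrow> 'n state"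
    assume it: "gn_iteration P u p \<eta> \<theta> \<psi>"
      and d: "\<forall>k. gn_direction P (u (\<theta> k), p (\<psi> k)) (d k)"
      and def: "\<forall>k. metric_definite_on P (u (\<theta> k), p (\<psi> k)) (tangent_space P u p (\<theta> k) (\<psi> k))"
    define \<pi> where "\<pi> k = orth_proj P (u (\<theta> k), p (\<psi> k)) (tangent_space P u p (\<theta> k) (\<psi> k)) (d k)" for k
    define \<epsilon> where "\<epsilon> k = (u (\<theta> (Suc k)), p (\<psi> (Suc k))) - (u (\<theta> k), p (\<psi> k)) + \<eta> k *\<^sub>R \<pi> k" for k
    have main: "\<epsilon> k \<in> H_carrier P \<and>
       (u (\<theta> (Suc k)), p (\<psi> (Suc k))) = (u (\<theta> k), p (\<psi> k)) - \<eta> k *\<^sub>R \<pi> k + \<epsilon> k \<and>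
       ((\<theta> k, \<psi> k) \<in> K \<and> (\<theta> (Suc k), \<psi> (Suc k)) \<in> K \<longrightarrow>
         H_norm P (\<epsilon> k) \<le> (C1 + C2) * ((\<eta> k)\<^sup>2 * (norm (gn_step P u p (\<theta> k) (\<psi> k)))\<^sup>2))" for k
    proof (intro conjI impI)
      let ?s = "gn_step P u p (\<theta> k) (\<psi> k)"
      let ?\<theta> = "\<theta> (Suc k) - \<theta> k" and ?\<psi> = "\<psi> (Suc k) - \<psi> k"
      let ?e = "tangent_vector P u p (\<theta> k) (\<psi> k)"
      define v where "v = (\<Sum>r\<in>UNIV. ?s $ r *\<^sub>R ?e r)"
      note st = gn_step_is_projection[OF P R u(1) p(1) u(2) p(2) d[rule_format, of k] def[rule_format, of k]]
      have vH: "v \<in> H_carrier P" and piH: "\<pi> k \<in> H_carrier P" and vp: "H_norm P (v - \<pi> k) = 0"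
        using st by (simp_all add: v_def \<pi>_def)
      have wH: "(u x, p y) \<in> H_carrier P" for x y using u(1) p(1) by (simp add: H_carrier_def)
      show eH: "\<epsilon> k \<in> H_carrier P" unfolding \<epsilon>_def by (intro H' wH piH)
      show "(u (\<theta> (Suc k)), p (\<psi> (Suc k))) = (u (\<theta> k), p (\<psi> k)) - \<eta> k *\<^sub>R \<pi> k + \<epsilon> k"
        by (simp add: \<epsilon>_def)
      assume K: "(\<theta> k, \<psi> k) \<in> K \<and> (\<theta> (Suc k), \<psi> (Suc k)) \<in> K"
      have step: "block_vec ?\<theta> ?\<psi> = - (\<eta> k *\<^sub>R ?s)"
        using it by (simp add: gn_iteration_def flip: block_vec_diff)
      have st\<theta>: "?\<theta> $ i = - (\<eta> k * ?s $ Inl i)" for i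
        using arg_cong[OF step, of "\<lambda>x. x $ Inl i"] by (simp add: block_vec_def)
      have st\<psi>: "?\<psi> $ j = - (\<eta> k * ?s $ Inr j)" for j
        using arg_cong[OF step, of "\<lambda>x. x $ Inr j"] by (simp add: block_vec_def)
      have "(norm ?\<theta>)\<^sup>2 + (norm ?\<psi>)\<^sup>2 = (norm (\<eta> k *\<^sub>R ?s))\<^sup>2"
        using norm_block_vec[of ?\<theta> ?\<psi>] by (simp add: step)
      then have nrm: "(norm ?\<theta>)\<^sup>2 + (norm ?\<psi>)\<^sup>2 = (\<eta> k)\<^sup>2 * (norm ?s)\<^sup>2"
        by (simp add: power_mult_distrib)
      let ?a = "u (\<theta> (Suc k)) - u (\<theta> k) - (\<Sum>i\<in>UNIV. ?\<theta> $ i *\<^sub>R param_deriv (velocity_space P) u i (\<theta> k))"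
      let ?b = "p (\<psi> (Suc k)) - p (\<psi> k) - (\<Sum>j\<in>UNIV. ?\<psi> $ j *\<^sub>R param_deriv (pressure_space P) p j (\<psi> k))"
      have sumpair: "(\<Sum>i\<in>I. (f i, 0)) = (sum f I, 0)" "(\<Sum>i\<in>I. (0, f' i)) = (0, sum f' I)"
        for I :: "'c set" and f :: "'c \<Rightarrow> 'n velocity" and f' :: "'c \<Rightarrow> 'n pressure"
        by (induction I rule: infinite_finite_induct) (auto simp: zero_prod_def)
      have veq: "\<eta> k *\<^sub>R v = - (\<Sum>i\<in>UNIV. ?\<theta> $ i *\<^sub>R param_deriv (velocity_space P) u i (\<theta> k),
            \<Sum>j\<in>UNIV. ?\<psi> $ j *\<^sub>R param_deriv (pressure_space P) p j (\<psi> k))"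
        unfolding st\<theta> st\<psi> v_def sum_UNIV_sum
        by (simp add: tangent_vector_def velocity_tangent_def pressure_tangent_def sumpair
            scaleR_sum_right sum_negf)
      have ab: "(u (\<theta> (Suc k)), p (\<psi> (Suc k))) - (u (\<theta> k), p (\<psi> k)) + \<eta> k *\<^sub>R v = (?a, ?b)"
        unfolding veq by simp
      have "(?a, ?b) \<in> H_carrier P" unfolding ab[symmetric] by (intro H' wH vH)
      then have abm: "?a \<in> fst (velocity_space P)" "?b \<in> fst (pressure_space P)" by (auto simp: H_carrier_def)
      have "H_norm P (\<epsilon> k) \<le> H_norm P (?a, ?b) + H_norm P (\<epsilon> k - (?a, ?b))"
        using seminormed_le_add[OF seminormed_H[OF P], of "\<epsilon> k" "(?a, ?b)"] eH \<open>(?a, ?b) \<in> H_carrier P\<close> by simp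
      also have "\<epsilon> k - (?a, ?b) = (- \<eta> k) *\<^sub>R (v - \<pi> k)"
        unfolding ab[symmetric] \<epsilon>_def by (simp add: scaleR_diff_right)
      also have "H_norm P ((- \<eta> k) *\<^sub>R (v - \<pi> k)) = 0"
        using seminormed_scale[OF seminormed_H[OF P], of "v - \<pi> k" "- \<eta> k"] vp H'(2)[OF vH piH] by simp
      also have "H_norm P (?a, ?b) \<le> velocity_norm P ?a + pressure_norm P ?b" by (rule H_norm_le[OF P abm])
      also have "velocity_norm P ?a \<le> C1 * (norm ?\<theta>)\<^sup>2" using K rK by (intro C1(2)) blast+
      also have "pressure_norm P ?b \<le> C2 * (norm ?\<psi>)\<^sup>2" using K rK by (intro C2(2)) blast+
      also have "C1 * (norm ?\<theta>)\<^sup>2 + C2 * (norm ?\<psi>)\<^sup>2 \<le> (C1 + C2) * ((norm ?\<theta>)\<^sup>2 + (norm ?\<psi>)\<^sup>2)"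
        using C1(1) C2(1) by (simp add: algebra_simps)
      finally show "H_norm P (\<epsilon> k) \<le> (C1 + C2) * ((\<eta> k)\<^sup>2 * (norm ?s)\<^sup>2)"
        by (simp add: nrm)
    qed
    then show "\<exists>\<epsilon>. \<forall>k. \<epsilon> k \<in> H_carrier P \<and>
       (u (\<theta> (Suc k)), p (\<psi> (Suc k))) =
         (u (\<theta> k), p (\<psi> k))
         - \<eta> k *\<^sub>R orth_proj P (u (\<theta> k), p (\<psi> k)) (tangent_space P u p (\<theta> k) (\<psi> k)) (d k)
         + \<epsilon> k \<and>
       ((\<theta> k, \<psi> k) \<in> K \<and> (\<theta> (Suc k), \<psi> (Suc k)) \<in> K \<longrightarrow>
         H_norm P (\<epsilon> k) \<le> (C1 + C2) * ((\<eta> k)\<^sup>2 * (norm (gn_step P u p (\<theta> k) (\<psi> k)))\<^sup>2))"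
      unfolding \<pi>_def by (intro exI[of _ \<epsilon>] allI)
  qed
qed

end
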